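(* Let $N$ and $M$ be finitely generated torsion-free nilpotent groups. Let $\Psi:N\to M$ be a quasi-isometry with $\Psi(e_N)=e_M$ and with bounded Abelian defect, i.e. $$\Delta_{\mathrm{ab}}(\Psi):=\sup_{x,y\in N}\big\|\pi_M(\Psi(xy))-\pi_M(\Psi(x))-\pi_M(\Psi(y))\big\|<\infty.$$ Define $A:N\to M_{\mathrm{ab}}\otimes_{\mathbb Z}\mathbb R$ by $A(x):=\pi_M(\Psi(x))$. Then: (1) There exists a unique group homomorphism $H:N\to M_{\mathrm{ab}}\otimes_{\mathbb Z}\mathbb R$ such that $\sup_{x\in N}\|A(x)-H(x)\|<\infty$. In particular $H$ factors through the Abelianization of $N$, so there is a unique linear map $L_{ab}:N_{\mathrm{ab}}\otimes_{\mathbb Z}\mathbb R\to M_{\mathrm{ab}}\otimes_{\mathbb Z}\mathbb R$ with $H(x)=L_{ab}(\pi_N(x))$ for all $x\in N$, and $\sup_{x\in N}\|\pi_M(\Psi(x))-L_{ab}(\pi_N(x))\|<\infty$. (2) The linear map $L_{ab}$ is an isomorphism. Consequently one may define $T_\Psi:\mathrm{Hom}(N_{\mathrm{ab}},\mathbb R)\to\mathrm{Hom}(M_{\mathrm{ab}},\mathbb R)$ by $T_\Psi(\varphi):=\varphi\circ L_{ab}^{-1}$, i.e. $T_\Psi=(L_{ab}^{-1})^\ast$. (3) Let $r=\dim_{\mathbb R}\mathrm{Hom}(N_{\mathrm{ab}},\mathbb R)$, let $\{\varphi_i\}_{i=1}^r$ be a basis of $\mathrm{Hom}(N_{\mathrm{ab}},\mathbb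 R)$, and put $\psi_i:=T_\Psi(\varphi_i)$. Define $F_N(x):=(\varphi_i(\pi_N(x)))_{i=1}^r$ for $x\in N$ and $F_M(y):=(\psi_i(\pi_M(y)))_{i=1}^r$ for $y\in M$. Then $$\sup_{x\in N}\|F_M(\Psi(x))-F_N(x)\|<\infty.$$
   Context: $N_{\mathrm{ab}}=N/[N,N]$. $\pi_N:N\to N_{\mathrm{ab}}\otimes_{\mathbb Z}\mathbb R$ is the composition of the Abelianization $N\to N_{\mathrm{ab}}$ with the canonical map $N_{\mathrm{ab}}\to N_{\mathrm{ab}}\otimes_{\mathbb Z}\mathbb R$, $a\mapsto a\otimes 1$; similarly $\pi_M$. Elements of $\mathrm{Hom}(N_{\mathrm{ab}},\mathbb R)$ are viewed as linear functionals on $N_{\mathrm{ab}}\otimes_{\mathbb Z}\mathbb R$ (similarly for $M$). Norms on these finite-dimensional real vector spaces are fixed arbitrarily. Quasi-isometries are with respect to word metrics. *)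

theory Defs
  imports
    Complex_Main
    "HOL-Algebra.Generated_Groups"
    "HOL-Algebra.Free_Abelian_Groups"
    "Jordan_Normal_Form.VS_Connect"
begin

section \<open>Finitely generated torsion-free nilpotent groups\<close>

definition finite_generating_set :: "('a, 'c) monoid_scheme \<Rightarrow> 'a set \<Rightarrow> bool" where
  "finite_generating_set G S \<longleftrightarrow> finite S \<and> S \<subseteq> carrier G \<and> generate G S = carrier G"

definition torsion_free :: "('a, 'c) monoid_scheme \<Rightarrow> bool" where
  "torsion_free G \<longleftrightarrow>
    (\<forall>x\<in>carrier G. \<forall>n::nat. n > 0 \<longrightarrow> x [^]\<^bsub>G\<^esub> n = \<one>\<^bsub>G\<^esub> \<longrightarrow> x = \<one>\<^bsub>G\<^esub>)"

text \<open>The numbering starts at \<open>0\<close>: \<open>lower_central G 0 = G\<close> and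
  \<open>lower_central G (n + 1) = [G, lower_central G n]\<close>.\<close>
primrec lower_central :: "('a, 'c) monoid_scheme \<Rightarrow> nat \<Rightarrow> 'a set" where
  "lower_central G 0 = carrier G"
| "lower_central G (Suc n) =
    generate G {x \<otimes>\<^bsub>G\<^esub> y \<otimes>\<^bsub>G\<^esub> inv\<^bsub>G\<^esub> x \<otimes>\<^bsub>G\<^esub> inv\<^bsub>G\<^esub> y | x y.
                  x \<in> carrier G \<and> y \<in> lower_central G n}"

definition nilpotent :: "('a, 'c) monoid_scheme \<Rightarrow> bool" where
  "nilpotent G \<longleftrightarrow> (\<exists>n. lower_central G n = {\<one>\<^bsub>G\<^esub>})"


section \<open>Word metrics and quasi-isometries\<close>

definition word_length :: "('a, 'c) monoid_scheme \<Rightarrow> 'a set \<Rightarrow> 'a \<Rightarrow> nat" where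
  "word_length G S x =
    (LEAST n. \<exists>ws. length ws = n \<and> set ws \<subseteq> S \<union> m_inv G ` S \<and>
                   foldr (\<otimes>\<^bsub>G\<^esub>) ws \<one>\<^bsub>G\<^esub> = x)"

definition word_dist :: "('a, 'c) monoid_scheme \<Rightarrow> 'a set \<Rightarrow> 'a \<Rightarrow> 'a \<Rightarrow> real" where
  "word_dist G S x y = real (word_length G S (inv\<^bsub>G\<^esub> x \<otimes>\<^bsub>G\<^esub> y))"

definition quasi_isometry ::
  "'a set \<Rightarrow> ('a \<Rightarrow> 'a \<Rightarrow> real) \<Rightarrow> 'b set \<Rightarrow> ('b \<Rightarrow> 'b \<Rightarrow> real) \<Rightarrow> ('a \<Rightarrow> 'b) \<Rightarrow> bool" where
  "quasi_isometry X dX Y dY f \<longleftrightarrow>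
    f \<in> X \<rightarrow> Y \<and>
    (\<exists>K C. K \<ge> 1 \<and> C \<ge> 0 \<and>
      (\<forall>x\<in>X. \<forall>y\<in>X. dX x y / K - C \<le> dY (f x) (f y) \<and> dY (f x) (f y) \<le> K * dX x y + C) \<and>
      (\<forall>y\<in>Y. \<exists>x\<in>X. dY (f x) y \<le> C))"


section \<open>Abelianization and tensor product with the reals\<close>

definition abelianization :: "('a, 'c) monoid_scheme \<Rightarrow> 'a set monoid" where
  "abelianization G = G Mod derived G (carrier G)"

definition ab_class :: "('a, 'c) monoid_scheme \<Rightarrow> 'a \<Rightarrow> 'a set" where
  "ab_class G x = derived G (carrier G) #>\<^bsub>G\<^esub> x"

text \<open>For an abelian group \<open>A\<close>, the tensor product of \<open>A\<close> with the reals over the integers is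
  the free abelian group on the pairs \<open>(a, r)\<close> modulo the biadditivity relations; the scalar
  \<open>c\<close> acts by \<open>c (a \<otimes> r) = a \<otimes> (c r)\<close>.\<close>

definition tensor_free :: "('a, 'c) monoid_scheme \<Rightarrow> ('a \<times> real \<Rightarrow>\<^sub>0 int) monoid" where
  "tensor_free A = free_Abelian_group (carrier A \<times> UNIV)"

definition tensor_relations :: "('a, 'c) monoid_scheme \<Rightarrow> ('a \<times> real \<Rightarrow>\<^sub>0 int) set" where
  "tensor_relations A = generate (tensor_free A)
    ({frag_of (a \<otimes>\<^bsub>A\<^esub> b, r) - frag_of (a, r) - frag_of (b, r) | a b r.
        a \<in> carrier A \<and> b \<in> carrier A} \<union>
     {frag_of (a, r + s) - frag_of (a, r) - frag_of (a, s) | a r s. a \<in> carrier A})"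

definition tensor_scale :: "real \<Rightarrow> ('a \<times> real \<Rightarrow>\<^sub>0 int) \<Rightarrow> ('a \<times> real \<Rightarrow>\<^sub>0 int)" where
  "tensor_scale c = frag_extend (\<lambda>(a, r). frag_of (a, c * r))"

text \<open>The fields \<open>mult\<close> and \<open>one\<close> of the module record are not used.\<close>
definition real_tensor :: "('a, 'c) monoid_scheme \<Rightarrow> (real, ('a \<times> real \<Rightarrow>\<^sub>0 int) set) module" where
  "real_tensor A =
    \<lparr>carrier = carrier (tensor_free A Mod tensor_relations A),
     mult = (\<lambda>X Y. tensor_relations A),
     one = tensor_relations A,
     zero = \<one>\<^bsub>tensor_free A Mod tensor_relations A\<^esub>,
     add = (\<otimes>\<^bsub>tensor_free A Mod tensor_relations A\<^esub>),
     smult = (\<lambda>c X. \<Union>u\<in>X. tensor_relations A #>\<^bsub>tensor_free A\<^esub> tensor_scale c u)\<rparr>"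

definition pure_tensor :: "('a, 'c) monoid_scheme \<Rightarrow> 'a \<Rightarrow> real \<Rightarrow> ('a \<times> real \<Rightarrow>\<^sub>0 int) set" where
  "pure_tensor A a r = tensor_relations A #>\<^bsub>tensor_free A\<^esub> frag_of (a, r)"

definition ab_real ::
  "('a, 'c) monoid_scheme \<Rightarrow> (real, ('a set \<times> real \<Rightarrow>\<^sub>0 int) set) module" where
  "ab_real G = real_tensor (abelianization G)"

definition ab_proj :: "('a, 'c) monoid_scheme \<Rightarrow> 'a \<Rightarrow> ('a set \<times> real \<Rightarrow>\<^sub>0 int) set" where
  "ab_proj G x = pure_tensor (abelianization G) (ab_class G x) 1"


section \<open>Real-valued homomorphisms\<close>

text \<open>Functions are extensional, so that equal homomorphisms are equal in HOL.\<close>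
definition real_hom :: "('a, 'c) monoid_scheme \<Rightarrow> (real, 'a \<Rightarrow> real) module" where
  "real_hom A =
    \<lparr>carrier = hom A (add_monoid class_ring) \<inter> extensional (carrier A),
     mult = (\<lambda>f g. \<lambda>a\<in>carrier A. 0),
     one = (\<lambda>a\<in>carrier A. 0),
     zero = (\<lambda>a\<in>carrier A. 0),
     add = (\<lambda>f g. \<lambda>a\<in>carrier A. f a + g a),
     smult = (\<lambda>c f. \<lambda>a\<in>carrier A. c * f a)\<rparr>"

text \<open>A homomorphism from \<open>A\<close> to the reals, viewed as a linear functional on
  \<open>real_tensor A\<close>: it maps the class of \<open>\<Sum> n\<^sub>i (a\<^sub>i, r\<^sub>i)\<close> to \<open>\<Sum> n\<^sub>i r\<^sub>i \<phi>(a\<^sub>i)\<close>.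
  The value does not depend on the chosen representative (lemma \<open>functional_coset\<close>).\<close>

definition functional_rep :: "('a \<Rightarrow> real) \<Rightarrow> ('a \<times> real \<Rightarrow>\<^sub>0 int) \<Rightarrow> real" where
  "functional_rep \<phi> u =
    (\<Sum>p\<in>Poly_Mapping.keys u. of_int (Poly_Mapping.lookup u p) * (snd p * \<phi> (fst p)))"

definition functional :: "('a \<Rightarrow> real) \<Rightarrow> ('a \<times> real \<Rightarrow>\<^sub>0 int) set \<Rightarrow> real" where
  "functional \<phi> X = functional_rep \<phi> (SOME u. u \<in> X)"

text \<open>\<open>\<phi> \<mapsto> \<phi> \<circ> L\<inverse>\<close>, where \<open>L\<close> maps the real tensor product of \<open>A\<close> to that of \<open>B\<close>, as a map
  from \<open>real_hom A\<close> to \<open>real_hom B\<close>.\<close>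
definition inverse_dual ::
  "('a, 'c) monoid_scheme \<Rightarrow> ('b, 'd) monoid_scheme \<Rightarrow>
   (('a \<times> real \<Rightarrow>\<^sub>0 int) set \<Rightarrow> ('b \<times> real \<Rightarrow>\<^sub>0 int) set) \<Rightarrow> ('a \<Rightarrow> real) \<Rightarrow> 'b \<Rightarrow> real" where
  "inverse_dual A B L \<phi> =
    (\<lambda>b\<in>carrier B. functional \<phi> (inv_into (carrier (real_tensor A)) L (pure_tensor B b 1)))"


section \<open>Norms on real vector spaces given by a carrier\<close>

definition vs_norm :: "(real, 'v, 'c) module_scheme \<Rightarrow> ('v \<Rightarrow> real) \<Rightarrow> bool" where
  "vs_norm V nm \<longleftrightarrow>
    (\<forall>v\<in>carrier V. nm v \<ge> 0 \<and> (nm v = 0 \<longleftrightarrow> v = \<zero>\<^bsub>V\<^esub>)) \<and>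
    (\<forall>c. \<forall>v\<in>carrier V. nm (c \<odot>\<^bsub>V\<^esub> v) = \<bar>c\<bar> * nm v) \<and>
    (\<forall>v\<in>carrier V. \<forall>w\<in>carrier V. nm (v \<oplus>\<^bsub>V\<^esub> w) \<le> nm v + nm w)"

definition bounded_distance ::
  "(real, 'v, 'c) module_scheme \<Rightarrow> ('v \<Rightarrow> real) \<Rightarrow> 'x set \<Rightarrow> ('x \<Rightarrow> 'v) \<Rightarrow> ('x \<Rightarrow> 'v) \<Rightarrow> bool" where
  "bounded_distance V nm X f g \<longleftrightarrow> bdd_above ((\<lambda>x. nm (f x \<ominus>\<^bsub>V\<^esub> g x)) ` X)"

definition bounded_abelian_defect ::
  "('a, 'c) monoid_scheme \<Rightarrow> ('b, 'd) monoid_scheme \<Rightarrow>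
   (('b set \<times> real \<Rightarrow>\<^sub>0 int) set \<Rightarrow> real) \<Rightarrow> ('a \<Rightarrow> 'b) \<Rightarrow> bool" where
  "bounded_abelian_defect N M nm \<Psi> \<longleftrightarrow>
    bdd_above ((\<lambda>(x, y). nm (ab_proj M (\<Psi> (x \<otimes>\<^bsub>N\<^esub> y)) \<ominus>\<^bsub>ab_real M\<^esub> ab_proj M (\<Psi> x)
                              \<ominus>\<^bsub>ab_real M\<^esub> ab_proj M (\<Psi> y))) ` (carrier N \<times> carrier N))"

abbreviation coord_space :: "nat \<Rightarrow> (real, nat \<Rightarrow> real) module" where
  "coord_space r \<equiv> ring.func_space class_ring {1..r}"

definition coord_map ::
  "('a, 'c) monoid_scheme \<Rightarrow> nat \<Rightarrow> (nat \<Rightarrow> 'a set \<Rightarrow> real) \<Rightarrow> 'a \<Rightarrow> nat \<Rightarrow> real" where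
  "coord_map G r \<phi> x = (\<lambda>i\<in>{1..r}. functional (\<phi> i) (ab_proj G x))"


section \<open>The constructions are well defined\<close>

lemma tensor_free_comm_group: "comm_group (tensor_free A)"
  by (simp add: tensor_free_def abelian_free_Abelian_group)

lemma tensor_free_mult [simp]: "u \<otimes>\<^bsub>tensor_free A\<^esub> v = u + v"
  by (simp add: tensor_free_def)

lemma tensor_free_one [simp]: "\<one>\<^bsub>tensor_free A\<^esub> = 0"
  by (simp add: tensor_free_def)

lemma tensor_free_carrier: "u \<in> carrier (tensor_free A) \<longleftrightarrow> Poly_Mapping.keys u \<subseteq> carrier A \<times> UNIV"
  by (simp add: tensor_free_def)

lemma tensor_free_inv: "u \<in> carrier (tensor_free A) \<Longrightarrow> inv\<^bsub>tensor_free A\<^esub> u = - u"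
  by (simp add: tensor_free_def)

lemma tensor_free_diff:
  assumes "u \<in> carrier (tensor_free A)" "v \<in> carrier (tensor_free A)"
  shows "u - v \<in> carrier (tensor_free A)"
  using assms keys_diff[of u v] by (auto simp: tensor_free_carrier)

lemma tensor_free_frag: "a \<in> carrier A \<Longrightarrow> frag_of (a, r) \<in> carrier (tensor_free A)"
  by (simp add: tensor_free_def)

lemma tensor_free_induct [consumes 1, case_names zero diff frag]:
  assumes "u \<in> carrier (tensor_free A)"
    and "P 0"
    and "\<And>u v. \<lbrakk>u \<in> carrier (tensor_free A); v \<in> carrier (tensor_free A); P u; P v\<rbrakk> \<Longrightarrow> P (u - v)"
    and "\<And>a r. a \<in> carrier A \<Longrightarrow> P (frag_of (a, r))"
  shows "P u"
  using assms(1) unfolding tensor_free_carrier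
  by (rule free_Abelian_group_induct) (use assms in \<open>auto simp: tensor_free_carrier\<close>)

lemma tensor_scale_diff: "tensor_scale c (u - v) = tensor_scale c u - tensor_scale c v"
  by (simp add: tensor_scale_def frag_extend_diff)

lemma tensor_scale_add: "tensor_scale c (u + v) = tensor_scale c u + tensor_scale c v"
  by (simp add: tensor_scale_def frag_extend_add)

lemma tensor_scale_minus: "tensor_scale c (- u) = - tensor_scale c u"
  by (simp add: tensor_scale_def frag_extend_minus)

lemma tensor_scale_zero [simp]: "tensor_scale c 0 = 0"
  by (simp add: tensor_scale_def)

lemma tensor_scale_frag [simp]: "tensor_scale c (frag_of (a, r)) = frag_of (a, c * r)"
  by (simp add: tensor_scale_def)

lemma tensor_scale_closed:
  "u \<in> carrier (tensor_free A) \<Longrightarrow> tensor_scale c u \<in> carrier (tensor_free A)"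
proof (induction rule: tensor_free_induct)
  case zero
  then show ?case by (simp add: tensor_free_carrier)
qed (simp_all add: tensor_scale_diff tensor_free_diff tensor_free_frag)

lemma functional_rep_eq_sum:
  assumes "finite K" "Poly_Mapping.keys u \<subseteq> K"
  shows "functional_rep \<phi> u =
           (\<Sum>p\<in>K. of_int (Poly_Mapping.lookup u p) * (snd p * \<phi> (fst p)))"
  unfolding functional_rep_def using assms
  by (intro sum.mono_neutral_left) (auto simp: in_keys_iff)

lemma functional_rep_diff: "functional_rep \<phi> (u - v) = functional_rep \<phi> u - functional_rep \<phi> v"
proof -
  let ?K = "Poly_Mapping.keys u \<union> Poly_Mapping.keys v"
  have "functional_rep \<phi> (u - v) = (\<Sum>p\<in>?K. of_int (Poly_Mapping.lookup (u - v) p) * (snd p * \<phi> (fst p)))"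
    by (rule functional_rep_eq_sum) (auto dest: subsetD[OF keys_diff])
  also have "\<dots> = functional_rep \<phi> u - functional_rep \<phi> v"
    by (simp add: functional_rep_eq_sum[of ?K u] functional_rep_eq_sum[of ?K v] lookup_minus
        sum_subtractf left_diff_distrib)
  finally show ?thesis .
qed

lemma functional_rep_zero [simp]: "functional_rep \<phi> 0 = 0"
  by (simp add: functional_rep_def)

lemma functional_rep_minus: "functional_rep \<phi> (- u) = - functional_rep \<phi> u"
  using functional_rep_diff[of \<phi> 0 u] by simp

lemma functional_rep_add: "functional_rep \<phi> (u + v) = functional_rep \<phi> u + functional_rep \<phi> v"
  using functional_rep_diff[of \<phi> u "- v"] by (simp add: functional_rep_minus)

lemma functional_rep_frag [simp]: "functional_rep \<phi> (frag_of (a, r)) = r * \<phi> a"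
  by (simp add: functional_rep_def)

lemma functional_rep_scale: "functional_rep \<phi> (tensor_scale c u) = c * functional_rep \<phi> u"
proof -
  have "u \<in> carrier (tensor_free \<lparr>carrier = UNIV, mult = (\<lambda>a b. a), one = undefined\<rparr>)"
    by (simp add: tensor_free_carrier)
  then show ?thesis
    by (induction rule: tensor_free_induct)
       (auto simp: tensor_scale_diff functional_rep_diff algebra_simps)
qed

context comm_group
begin

lemma tensor_relations_generators:
  "{frag_of (a \<otimes> b, r) - frag_of (a, r) - frag_of (b, r) | a b r. a \<in> carrier G \<and> b \<in> carrier G} \<union>
   {frag_of (a, r + s) - frag_of (a, r) - frag_of (a, s) | a r s. a \<in> carrier G} \<subseteq> carrier (tensor_free G)"
  by (auto intro!: tensor_free_diff tensor_free_frag)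

lemma tensor_relations_subgroup: "subgroup (tensor_relations G) (tensor_free G)"
  unfolding tensor_relations_def
  using tensor_relations_generators
  by (intro group.generate_is_subgroup comm_group.axioms tensor_free_comm_group) auto

lemma tensor_relations_normal: "tensor_relations G \<lhd> tensor_free G"
  using comm_group.subgroup_imp_normal[OF tensor_free_comm_group tensor_relations_subgroup] .

lemma tensor_relations_add: "u \<in> tensor_relations G \<Longrightarrow> v \<in> tensor_relations G \<Longrightarrow> u + v \<in> tensor_relations G"
  using subgroup.m_closed[OF tensor_relations_subgroup] by fastforce

lemma tensor_relations_carrier: "u \<in> tensor_relations G \<Longrightarrow> u \<in> carrier (tensor_free G)"
  using subgroup.subset[OF tensor_relations_subgroup] by blast

lemma tensor_relations_minus: "u \<in> tensor_relations G \<Longrightarrow> - u \<in> tensor_relations G"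
  using subgroup.m_inv_closed[OF tensor_relations_subgroup, of u]
  by (simp add: tensor_free_inv tensor_relations_carrier)

lemma tensor_relations_diff: "u \<in> tensor_relations G \<Longrightarrow> v \<in> tensor_relations G \<Longrightarrow> u - v \<in> tensor_relations G"
  using tensor_relations_add[of u "- v"] tensor_relations_minus by simp

lemma tensor_relations_zero: "0 \<in> tensor_relations G"
  using subgroup.one_closed[OF tensor_relations_subgroup] by simp

lemma tensor_relations_left:
  "a \<in> carrier G \<Longrightarrow> b \<in> carrier G \<Longrightarrow> frag_of (a \<otimes> b, r) - frag_of (a, r) - frag_of (b, r) \<in> tensor_relations G"
  unfolding tensor_relations_def by (rule generate.incl) blast

lemma tensor_relations_right:
  "a \<in> carrier G \<Longrightarrow> frag_of (a, r + s) - frag_of (a, r) - frag_of (a, s) \<in> tensor_relations G"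
  unfolding tensor_relations_def by (rule generate.incl) blast

lemma tensor_relations_induct [consumes 1, case_names zero left right minus add]:
  assumes "u \<in> tensor_relations G"
    and "P 0"
    and left: "\<And>a b r. a \<in> carrier G \<Longrightarrow> b \<in> carrier G \<Longrightarrow>
          P (frag_of (a \<otimes> b, r) - frag_of (a, r) - frag_of (b, r))"
    and right: "\<And>a r s. a \<in> carrier G \<Longrightarrow> P (frag_of (a, r + s) - frag_of (a, r) - frag_of (a, s))"
    and minus: "\<And>u. u \<in> tensor_relations G \<Longrightarrow> P u \<Longrightarrow> P (- u)"
    and add: "\<And>u v. u \<in> tensor_relations G \<Longrightarrow> v \<in> tensor_relations G \<Longrightarrow> P u \<Longrightarrow> P v \<Longrightarrow> P (u + v)"
  shows "P u"
  using assms(1) unfolding tensor_relations_def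
proof (induction rule: generate.induct)
  case one
  then show ?case using assms(2) by simp
next
  case (incl h)
  then show ?case using left right by blast
next
  case (inv h)
  then have h: "h \<in> tensor_relations G" unfolding tensor_relations_def by (rule generate.incl)
  have "P h" using inv left right by blast
  with minus[OF h] h show ?case by (simp add: tensor_free_inv tensor_relations_carrier)
next
  case (eng h1 h2)
  then show ?case using add by (simp add: tensor_relations_def)
qed

lemma tensor_scale_relations:
  assumes "u \<in> tensor_relations G"
  shows "tensor_scale c u \<in> tensor_relations G"
  using assms
proof (induction rule: tensor_relations_induct)
  case zero
  then show ?case by (simp add: tensor_relations_zero)
next
  case (left a b r)
  then show ?case by (simp add: tensor_scale_diff tensor_relations_left)
next
  case (right a r s)
  then show ?case
    using tensor_relations_right[of a "c * r" "c * s"] by (simp add: tensor_scale_diff distrib_left)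
next
  case (minus u)
  then show ?case by (simp add: tensor_scale_minus tensor_relations_minus)
next
  case (add u v)
  then show ?case by (simp add: tensor_scale_add tensor_relations_add)
qed

lemma tensor_free_add:
  "u \<in> carrier (tensor_free G) \<Longrightarrow> v \<in> carrier (tensor_free G) \<Longrightarrow> u + v \<in> carrier (tensor_free G)"
  using keys_add[of u v] by (auto simp: tensor_free_carrier)

lemma tensor_coset_iff: "v \<in> tensor_relations G #>\<^bsub>tensor_free G\<^esub> u \<longleftrightarrow> v - u \<in> tensor_relations G"
proof
  assume "v - u \<in> tensor_relations G"
  then show "v \<in> tensor_relations G #>\<^bsub>tensor_free G\<^esub> u"
    unfolding r_coset_def by (intro UN_I[of "v - u"]) simp_all
qed (auto simp: r_coset_def)

lemma tensor_coset_eq_iff: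
  "tensor_relations G #>\<^bsub>tensor_free G\<^esub> u = tensor_relations G #>\<^bsub>tensor_free G\<^esub> v \<longleftrightarrow>
     u - v \<in> tensor_relations G"
proof
  assume "tensor_relations G #>\<^bsub>tensor_free G\<^esub> u = tensor_relations G #>\<^bsub>tensor_free G\<^esub> v"
  then show "u - v \<in> tensor_relations G"
    using tensor_coset_iff[of u u] tensor_coset_iff[of u v] by (simp add: tensor_relations_zero)
next
  assume uv: "u - v \<in> tensor_relations G"
  have "w - u \<in> tensor_relations G \<longleftrightarrow> w - v \<in> tensor_relations G" for w
    using tensor_relations_add[OF _ uv, of "w - u"] tensor_relations_diff[OF _ uv, of "w - v"]
    by auto
  then show "tensor_relations G #>\<^bsub>tensor_free G\<^esub> u = tensor_relations G #>\<^bsub>tensor_free G\<^esub> v"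
    by (simp add: set_eq_iff tensor_coset_iff)
qed

lemma tensor_carrier: "carrier (real_tensor G) = (\<lambda>u. tensor_relations G #>\<^bsub>tensor_free G\<^esub> u) ` carrier (tensor_free G)"
  by (simp add: real_tensor_def carrier_FactGroup)

lemma tensor_zero: "\<zero>\<^bsub>real_tensor G\<^esub> = tensor_relations G #>\<^bsub>tensor_free G\<^esub> 0"
proof -
  interpret F: comm_group "tensor_free G" by (rule tensor_free_comm_group)
  show ?thesis
    using F.coset_mult_one[of "tensor_relations G"] subgroup.subset[OF tensor_relations_subgroup]
    by (simp add: real_tensor_def)
qed

lemma tensor_add:
  assumes "u \<in> carrier (tensor_free G)" "v \<in> carrier (tensor_free G)"
  shows "(tensor_relations G #>\<^bsub>tensor_free G\<^esub> u) \<oplus>\<^bsub>real_tensor G\<^esub> (tensor_relations G #>\<^bsub>tensor_free G\<^esub> v) = tensor_relations G #>\<^bsub>tensor_free G\<^esub> (u + v)"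
  using normal.rcos_sum[OF tensor_relations_normal assms] by (simp add: real_tensor_def)

lemma tensor_self_coset: "u \<in> tensor_relations G #>\<^bsub>tensor_free G\<^esub> u"
  by (simp add: tensor_coset_iff tensor_relations_zero)

lemma tensor_smult:
  "c \<odot>\<^bsub>real_tensor G\<^esub> (tensor_relations G #>\<^bsub>tensor_free G\<^esub> u) =
     tensor_relations G #>\<^bsub>tensor_free G\<^esub> tensor_scale c u"
proof -
  have eq: "tensor_relations G #>\<^bsub>tensor_free G\<^esub> tensor_scale c v =
        tensor_relations G #>\<^bsub>tensor_free G\<^esub> tensor_scale c u"
    if "v \<in> tensor_relations G #>\<^bsub>tensor_free G\<^esub> u" for v
    using that tensor_scale_relations[of "v - u" c]
    by (simp add: tensor_coset_iff tensor_coset_eq_iff tensor_scale_diff)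
  have "c \<odot>\<^bsub>real_tensor G\<^esub> (tensor_relations G #>\<^bsub>tensor_free G\<^esub> u) =
    (\<Union>v\<in>tensor_relations G #>\<^bsub>tensor_free G\<^esub> u. tensor_relations G #>\<^bsub>tensor_free G\<^esub> tensor_scale c v)"
    by (simp add: real_tensor_def)
  also have "\<dots> = (\<Union>v\<in>tensor_relations G #>\<^bsub>tensor_free G\<^esub> u. tensor_relations G #>\<^bsub>tensor_free G\<^esub> tensor_scale c u)"
    by (rule SUP_cong[OF refl eq])
  also have "\<dots> = tensor_relations G #>\<^bsub>tensor_free G\<^esub> tensor_scale c u"
    using tensor_self_coset[of u] by (simp only: UN_constant) auto
  finally show ?thesis .
qed

lemma tensor_scale_add_left:
  assumes "u \<in> carrier (tensor_free G)"
  shows "tensor_scale (c + d) u - (tensor_scale c u + tensor_scale d u) \<in> tensor_relations G"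
  using assms
proof (induction rule: tensor_free_induct)
  case zero
  then show ?case by (simp add: tensor_relations_zero)
next
  case (diff u v)
  then show ?case
    using tensor_relations_diff[OF diff(3,4)] by (simp add: tensor_scale_diff algebra_simps)
next
  case (frag a r)
  then show ?case
    using tensor_relations_right[of a "c * r" "d * r"] by (simp add: algebra_simps)
qed

lemma tensor_scale_scale:
  "u \<in> carrier (tensor_free G) \<Longrightarrow> tensor_scale (c * d) u = tensor_scale c (tensor_scale d u)"
  by (induction rule: tensor_free_induct) (auto simp: tensor_scale_diff mult.assoc)

lemma tensor_scale_one: "u \<in> carrier (tensor_free G) \<Longrightarrow> tensor_scale 1 u = u"
  by (induction rule: tensor_free_induct) (auto simp: tensor_scale_diff)

lemma tensor_cases:
  assumes "X \<in> carrier (real_tensor G)"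
  obtains u where "u \<in> carrier (tensor_free G)" "X = tensor_relations G #>\<^bsub>tensor_free G\<^esub> u"
  using assms by (auto simp: tensor_carrier)

lemma real_tensor_abelian_group: "abelian_group (real_tensor G)"
proof (rule abelian_groupI)
  have zero: "0 \<in> carrier (tensor_free G)" by (simp add: tensor_free_carrier)
  then show "\<zero>\<^bsub>real_tensor G\<^esub> \<in> carrier (real_tensor G)"
    by (simp add: tensor_zero tensor_carrier)
  fix x assume "x \<in> carrier (real_tensor G)"
  then obtain u where u: "u \<in> carrier (tensor_free G)"
    "x = tensor_relations G #>\<^bsub>tensor_free G\<^esub> u" by (rule tensor_cases)
  from u zero show "\<zero>\<^bsub>real_tensor G\<^esub> \<oplus>\<^bsub>real_tensor G\<^esub> x = x"
    by (simp add: tensor_zero tensor_add)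
  from u have m: "- u \<in> carrier (tensor_free G)" by (simp add: tensor_free_carrier)
  with u show "\<exists>y\<in>carrier (real_tensor G). y \<oplus>\<^bsub>real_tensor G\<^esub> x = \<zero>\<^bsub>real_tensor G\<^esub>"
    by (intro bexI[of _ "tensor_relations G #>\<^bsub>tensor_free G\<^esub> (- u)"])
       (simp_all add: tensor_zero tensor_add tensor_carrier)
  fix y assume "y \<in> carrier (real_tensor G)"
  then obtain v where v: "v \<in> carrier (tensor_free G)"
    "y = tensor_relations G #>\<^bsub>tensor_free G\<^esub> v" by (rule tensor_cases)
  from u v show "x \<oplus>\<^bsub>real_tensor G\<^esub> y \<in> carrier (real_tensor G)"
    by (simp add: tensor_add tensor_carrier tensor_free_add)
  from u v show "x \<oplus>\<^bsub>real_tensor G\<^esub> y = y \<oplus>\<^bsub>real_tensor G\<^esub> x"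
    by (simp add: tensor_add add.commute)
  fix z assume "z \<in> carrier (real_tensor G)"
  then obtain w where w: "w \<in> carrier (tensor_free G)"
    "z = tensor_relations G #>\<^bsub>tensor_free G\<^esub> w" by (rule tensor_cases)
  from u v w show "x \<oplus>\<^bsub>real_tensor G\<^esub> y \<oplus>\<^bsub>real_tensor G\<^esub> z =
      x \<oplus>\<^bsub>real_tensor G\<^esub> (y \<oplus>\<^bsub>real_tensor G\<^esub> z)"
    by (simp add: tensor_add tensor_free_add add.assoc)
qed

lemma real_tensor_vectorspace: "vectorspace class_ring (real_tensor G)"
proof (rule vectorspace.intro)
  show "field (class_ring :: real ring)" by (rule class_field.field_axioms)
  show "module class_ring (real_tensor G)"
  proof (rule moduleI)
    show "cring (class_ring :: real ring)" by (rule class_cring.cring_axioms)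
    show "abelian_group (real_tensor G)" by (rule real_tensor_abelian_group)
    fix c x assume "x \<in> carrier (real_tensor G)"
    then obtain u where u: "u \<in> carrier (tensor_free G)"
      "x = tensor_relations G #>\<^bsub>tensor_free G\<^esub> u" by (rule tensor_cases)
    from u show "c \<odot>\<^bsub>real_tensor G\<^esub> x \<in> carrier (real_tensor G)"
      by (simp add: tensor_smult tensor_carrier tensor_scale_closed)
    from u show "\<one>\<^bsub>class_ring\<^esub> \<odot>\<^bsub>real_tensor G\<^esub> x = x"
      by (simp add: tensor_smult tensor_scale_one)
    fix d
    from u show "(c \<oplus>\<^bsub>class_ring\<^esub> d) \<odot>\<^bsub>real_tensor G\<^esub> x =
        c \<odot>\<^bsub>real_tensor G\<^esub> x \<oplus>\<^bsub>real_tensor G\<^esub> d \<odot>\<^bsub>real_tensor G\<^esub> x"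
      by (simp add: tensor_add tensor_smult tensor_scale_closed tensor_coset_eq_iff
          tensor_scale_add_left)
    from u show "(c \<otimes>\<^bsub>class_ring\<^esub> d) \<odot>\<^bsub>real_tensor G\<^esub> x =
        c \<odot>\<^bsub>real_tensor G\<^esub> (d \<odot>\<^bsub>real_tensor G\<^esub> x)"
      by (simp add: tensor_smult tensor_scale_scale)
    fix y assume "y \<in> carrier (real_tensor G)"
    then obtain v where v: "v \<in> carrier (tensor_free G)"
      "y = tensor_relations G #>\<^bsub>tensor_free G\<^esub> v" by (rule tensor_cases)
    from u v show "c \<odot>\<^bsub>real_tensor G\<^esub> (x \<oplus>\<^bsub>real_tensor G\<^esub> y) =
        c \<odot>\<^bsub>real_tensor G\<^esub> x \<oplus>\<^bsub>real_tensor G\<^esub> c \<odot>\<^bsub>real_tensor G\<^esub> y"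
      by (simp add: tensor_add tensor_smult tensor_scale_closed tensor_scale_add)
  qed
qed

lemma functional_rep_relations:
  assumes "\<phi> \<in> carrier (real_hom G)" "u \<in> tensor_relations G"
  shows "functional_rep \<phi> u = 0"
  using assms(2)
proof (induction rule: tensor_relations_induct)
  case (left a b r)
  then have "\<phi> (a \<otimes> b) = \<phi> a + \<phi> b"
    using assms(1) by (auto simp: real_hom_def hom_def)
  then show ?case by (simp add: functional_rep_diff distrib_left)
qed (auto simp: functional_rep_diff functional_rep_add functional_rep_minus algebra_simps)

lemma functional_coset:
  assumes "\<phi> \<in> carrier (real_hom G)"
  shows "functional \<phi> (tensor_relations G #>\<^bsub>tensor_free G\<^esub> u) = functional_rep \<phi> u"
proof -
  define v where "v = (SOME v. v \<in> tensor_relations G #>\<^bsub>tensor_free G\<^esub> u)"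
  have "v \<in> tensor_relations G #>\<^bsub>tensor_free G\<^esub> u"
    unfolding v_def using tensor_self_coset[of u] by (rule someI)
  then have "functional_rep \<phi> (v - u) = 0"
    using functional_rep_relations[OF assms] by (simp add: tensor_coset_iff)
  then show ?thesis
    by (simp add: functional_def v_def functional_rep_diff)
qed

lemma functional_pure_tensor:
  assumes "\<phi> \<in> carrier (real_hom G)" "a \<in> carrier G"
  shows "functional \<phi> (pure_tensor G a r) = r * \<phi> a"
  using assms by (simp add: pure_tensor_def functional_coset tensor_free_frag)

lemma functional_linear:
  assumes "\<phi> \<in> carrier (real_hom G)" "X \<in> carrier (real_tensor G)" "Y \<in> carrier (real_tensor G)"
  shows "functional \<phi> (X \<oplus>\<^bsub>real_tensor G\<^esub> Y) = functional \<phi> X + functional \<phi> Y"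
    and "functional \<phi> (c \<odot>\<^bsub>real_tensor G\<^esub> X) = c * functional \<phi> X"
proof -
  from assms(2) obtain u where u: "u \<in> carrier (tensor_free G)"
    "X = tensor_relations G #>\<^bsub>tensor_free G\<^esub> u" by (rule tensor_cases)
  from assms(3) obtain v where v: "v \<in> carrier (tensor_free G)"
    "Y = tensor_relations G #>\<^bsub>tensor_free G\<^esub> v" by (rule tensor_cases)
  from u v assms(1) show "functional \<phi> (X \<oplus>\<^bsub>real_tensor G\<^esub> Y) = functional \<phi> X + functional \<phi> Y"
    by (simp add: tensor_add functional_coset functional_rep_add)
  from u assms(1) show "functional \<phi> (c \<odot>\<^bsub>real_tensor G\<^esub> X) = c * functional \<phi> X"
    by (simp add: tensor_smult functional_coset functional_rep_scale)
qed

end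

lemma real_hom_carrier:
  "f \<in> carrier (real_hom A) \<longleftrightarrow>
     f \<in> extensional (carrier A) \<and>
     (\<forall>x\<in>carrier A. \<forall>y\<in>carrier A. f (x \<otimes>\<^bsub>A\<^esub> y) = f x + f y)"
  by (auto simp: real_hom_def hom_def)

lemma real_hom_vectorspace:
  assumes "group A"
  shows "vectorspace class_ring (real_hom A)"
proof (rule vectorspace.intro)
  interpret group A by fact
  show "field (class_ring :: real ring)" by (rule class_field.field_axioms)
  have ops: "\<zero>\<^bsub>real_hom A\<^esub> = (\<lambda>a\<in>carrier A. 0)"
    "f \<oplus>\<^bsub>real_hom A\<^esub> g = (\<lambda>a\<in>carrier A. f a + g a)"
    "c \<odot>\<^bsub>real_hom A\<^esub> f = (\<lambda>a\<in>carrier A. c * f a)" for f g c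
    by (simp_all add: real_hom_def)
  have ext: "(\<lambda>a\<in>carrier A. f a) = f" if "f \<in> carrier (real_hom A)" for f
    using that by (simp add: real_hom_carrier extensional_restrict)
  have ag: "abelian_group (real_hom A)"
  proof (rule abelian_groupI)
    show "\<exists>g\<in>carrier (real_hom A). g \<oplus>\<^bsub>real_hom A\<^esub> f = \<zero>\<^bsub>real_hom A\<^esub>"
      if "f \<in> carrier (real_hom A)" for f
      using that
      by (intro bexI[of _ "\<lambda>a\<in>carrier A. - f a"]) (auto simp: real_hom_carrier ops)
    show "\<zero>\<^bsub>real_hom A\<^esub> \<oplus>\<^bsub>real_hom A\<^esub> f = f" if "f \<in> carrier (real_hom A)" for f
      using ext[OF that] by (simp add: ops cong: restrict_cong)
  qed (auto simp: real_hom_carrier ops add_ac cong: restrict_cong)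
  show "module class_ring (real_hom A)"
  proof (rule moduleI)
    show "cring (class_ring :: real ring)" by (rule class_cring.cring_axioms)
    show "abelian_group (real_hom A)" by (rule ag)
    show "\<one>\<^bsub>class_ring\<^esub> \<odot>\<^bsub>real_hom A\<^esub> f = f" if "f \<in> carrier (real_hom A)" for f
      using ext[OF that] by (simp add: ops)
  qed (auto simp: real_hom_carrier ops distrib_left distrib_right mult.assoc cong: restrict_cong)
qed

lemma abelianization_comm_group:
  assumes "group G"
  shows "comm_group (abelianization G)"
  unfolding abelianization_def
  using group.derived_quot_is_comm_group[OF assms] .

end

theory Submission
  imports Defs
begin

text \<open>In coordinates on \<open>M\<^sub>a\<^sub>b \<otimes> \<real>\<close>, the map \<open>\<pi>\<^sub>M \<circ> \<Psi>\<close> is a tuple of quasimorphisms on \<open>N\<close>. A homogeneous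
  quasimorphism on a nilpotent group is a homomorphism, so homogenization gives \<open>H\<close>, and \<open>H\<close> extends
  linearly to \<open>L\<close>.

  \<open>L\<close> is onto because a covector vanishing on its image would give a bounded, hence zero,
  homomorphism on \<open>M\<close>. \<open>L\<close> is injective for a geometric reason: if \<open>L v = 0\<close> with \<open>v \<noteq> 0\<close>, a path in
  \<open>N\<close> that follows the direction \<open>v\<close> moves away linearly, while its image under \<open>\<Psi>\<close> stays within bounded
  distance of \<open>[M, M]\<close>. But a product of \<open>n\<close> elements of a finite subset of \<open>[M, M]\<close> has length
  \<open>O(\<surd>n)\<close>, which is proved by commutator collection: at scale \<open>R\<close>, words with \<open>O(R\<^sup>k)\<close> letters from the
  \<open>k\<close>-th term of the lower central series have length \<open>O(R)\<close>.\<close>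

section \<open>Commutators and the lower central series\<close>

text \<open>The collection argument combines two inductions that run in opposite directions. Upward
  in the weight, a power y^n with n at most R^i is shown to be short up to a correction of greater
  weight: for y = [x, u] one has [x^q, u^m] = y^(q m) up to such a correction, and an exponent of
  order R^(i+1) splits into q of order R and m of order R^i. Downward in the weight, starting beyond
  the nilpotency class, the corrections are short as well, hence so are all words of bounded mass.
  Letters of least weight are removed one at a time, which requires finitely many letters of each
  weight. An element of [M, M] is a letter of weight 2 and mass R^-2, so n of them have bounded mass
  at a scale R of order sqrt n. The abelianizations may have torsion, so they need not have a basis.
  Coordinates on the tensor product come instead from a maximal independent set of generators and
  the real homomorphisms dual to it; boundedness in an arbitrary norm is translated into boundedness
  of these coordinates.\<close>

declare lower_central.simps(2) [simp del]

context group
begin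

lemma inv_mult_cancel: "x \<in> carrier G \<Longrightarrow> y \<in> carrier G \<Longrightarrow> inv x \<otimes> (x \<otimes> y) = y"
  by (simp flip: m_assoc)

lemma mult_inv_cancel: "x \<in> carrier G \<Longrightarrow> y \<in> carrier G \<Longrightarrow> x \<otimes> (inv x \<otimes> y) = y"
  by (simp flip: m_assoc)

lemmas word_simps = m_assoc inv_mult_group inv_mult_cancel mult_inv_cancel

definition commutator :: "'a \<Rightarrow> 'a \<Rightarrow> 'a" where
  "commutator x y = x \<otimes> y \<otimes> inv x \<otimes> inv y"

lemma commutator_closed [simp]:
  "x \<in> carrier G \<Longrightarrow> y \<in> carrier G \<Longrightarrow> commutator x y \<in> carrier G"
  by (simp add: commutator_def)

lemma conj_commutator:
  "x \<in> carrier G \<Longrightarrow> y \<in> carrier G \<Longrightarrow> g \<in> carrier G \<Longrightarrow>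
    g \<otimes> commutator x y \<otimes> inv g = commutator (g \<otimes> x \<otimes> inv g) (g \<otimes> y \<otimes> inv g)"
  by (simp add: commutator_def word_simps)

lemma commutator_mult_left:
  "x \<in> carrier G \<Longrightarrow> y \<in> carrier G \<Longrightarrow> z \<in> carrier G \<Longrightarrow>
    commutator (x \<otimes> y) z = (x \<otimes> commutator y z \<otimes> inv x) \<otimes> commutator x z"
  by (simp add: commutator_def word_simps)

lemma commutator_mult_right:
  "x \<in> carrier G \<Longrightarrow> y \<in> carrier G \<Longrightarrow> z \<in> carrier G \<Longrightarrow>
    commutator x (y \<otimes> z) = commutator x y \<otimes> (y \<otimes> commutator x z \<otimes> inv y)"
  by (simp add: commutator_def word_simps)

lemma commutator_inv_left:
  "x \<in> carrier G \<Longrightarrow> z \<in> carrier G \<Longrightarrow>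
    commutator (inv x) z = inv x \<otimes> inv (commutator x z) \<otimes> x"
  by (simp add: commutator_def word_simps)

lemma lower_central_Suc:
  "lower_central G (Suc n) = generate G {commutator x y | x y. x \<in> carrier G \<and> y \<in> lower_central G n}"
  by (simp add: commutator_def lower_central.simps(2))

lemma lower_central_normal: "lower_central G n \<lhd> G"
proof (induction n)
  case 0
  show ?case by (simp add: normal_self)
next
  case (Suc n)
  interpret L: normal "lower_central G n" G by fact
  show ?case
    unfolding lower_central_Suc
  proof (rule normal_generateI)
    show "{commutator x y |x y. x \<in> carrier G \<and> y \<in> lower_central G n} \<subseteq> carrier G"
      using L.subset by auto
    fix h g
    assume "h \<in> {commutator x y |x y. x \<in> carrier G \<and> y \<in> lower_central G n}" and g: "g \<in> carrier G"
    then obtain x y where h: "h = commutator x y" "x \<in> carrier G" "y \<in> lower_central G n"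
      by blast
    then have "g \<otimes> h \<otimes> inv g = commutator (g \<otimes> x \<otimes> inv g) (g \<otimes> y \<otimes> inv g)"
      using g L.subset by (simp add: conj_commutator subset_iff)
    with h g show "g \<otimes> h \<otimes> inv g \<in> {commutator x y |x y. x \<in> carrier G \<and> y \<in> lower_central G n}"
      using L.inv_op_closed2 by blast
  qed
qed

lemma lower_central_carrier: "x \<in> lower_central G n \<Longrightarrow> x \<in> carrier G"
  using normal_imp_subgroup[OF lower_central_normal] subgroup.mem_carrier by fast

lemma commutator_lower_central:
  "x \<in> carrier G \<Longrightarrow> y \<in> lower_central G n \<Longrightarrow> commutator x y \<in> lower_central G (Suc n)"
  unfolding lower_central_Suc by (rule generate.incl) blast

lemma lower_central_Suc_subset: "lower_central G (Suc n) \<subseteq> lower_central G n"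
proof -
  interpret L: normal "lower_central G n" G by (rule lower_central_normal)
  have "commutator x y \<in> lower_central G n" if "x \<in> carrier G" "y \<in> lower_central G n" for x y
    using that L.inv_op_closed2 L.m_closed L.m_inv_closed by (simp add: commutator_def)
  then show ?thesis
    unfolding lower_central_Suc
    by (intro generate_subgroup_incl L.subgroup_axioms) auto
qed

lemma lower_central_antimono: "m \<le> n \<Longrightarrow> lower_central G n \<subseteq> lower_central G m"
  using lower_central_Suc_subset by (rule lift_Suc_antimono_le)

lemma commutator_mem_imp_coset_comm:
  assumes "P \<lhd> G" "x \<in> carrier G" "y \<in> carrier G" "commutator x y \<in> P"
  shows "(P #> x) \<otimes>\<^bsub>G Mod P\<^esub> (P #> y) = (P #> y) \<otimes>\<^bsub>G Mod P\<^esub> (P #> x)"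
proof -
  interpret P: normal P G by fact
  have "x \<otimes> y = commutator x y \<otimes> (y \<otimes> x)"
    using assms by (simp add: commutator_def word_simps)
  then have "x \<otimes> y \<in> P #> (y \<otimes> x)"
    using assms by (auto simp: r_coset_def)
  then have "P #> (x \<otimes> y) = P #> (y \<otimes> x)"
    using assms by (metis P.is_subgroup m_closed repr_independence)
  then show ?thesis
    using assms by (simp add: P.rcos_sum)
qed

text \<open>Moving \<open>c\<close> behind \<open>y\<close>, and \<open>d\<close> behind
  \<open>inv c\<close> and \<open>inv x\<close>, makes both cancel. This is applied in a quotient of
  the group, where \<open>c\<close> and \<open>d\<close> are the factors that a conjugation adds to
  \<open>x\<close> and \<open>y\<close>.\<close>

lemma commutator_central_perturb:
  assumes "x \<in> carrier G" "y \<in> carrier G" "c \<in> carrier G" "d \<in> carrier G"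
    and cy: "c \<otimes> y = y \<otimes> c" and d: "\<And>g. g \<in> carrier G \<Longrightarrow> d \<otimes> g = g \<otimes> d"
  shows "commutator (x \<otimes> c) (y \<otimes> d) = commutator x y"
proof -
  have "commutator (x \<otimes> c) (y \<otimes> d) = x \<otimes> (c \<otimes> y) \<otimes> (d \<otimes> (inv c \<otimes> inv x)) \<otimes> inv d \<otimes> inv y"
    using assms(1-4) by (simp add: commutator_def word_simps)
  also have "\<dots> = x \<otimes> (y \<otimes> c) \<otimes> ((inv c \<otimes> inv x) \<otimes> d) \<otimes> inv d \<otimes> inv y"
    using assms(1-4) d[of "inv c \<otimes> inv x"] by (simp add: cy)
  also have "\<dots> = commutator x y"
    using assms(1-4) by (simp add: commutator_def word_simps)
  finally show ?thesis .
qed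

text \<open>A subgroup contains a term of the lower central series as soon as it contains its
  generators, so weights of commutators have to be checked only when \<open>a\<close> is itself a
  commutator.\<close>

lemma commutator_centralizer_subgroup:
  assumes "P \<lhd> G" "Z \<subseteq> carrier G"
  shows "subgroup {a \<in> carrier G. \<forall>z\<in>Z. commutator a z \<in> P} G"
proof -
  interpret P: normal P G by fact
  show ?thesis
  proof (rule subgroupI)
    show "{a \<in> carrier G. \<forall>z\<in>Z. commutator a z \<in> P} \<noteq> {}"
      using assms(2) by (auto intro!: exI[of _ \<one>] simp: commutator_def subset_iff)
  next
    fix a assume a: "a \<in> {a \<in> carrier G. \<forall>z\<in>Z. commutator a z \<in> P}"
    have "commutator (inv a) z \<in> P" if z: "z \<in> Z" for z
    proof -
      have "inv (commutator a z) \<in> P" using a z by auto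
      then show ?thesis
        using a z assms(2) P.inv_op_closed1[of a] by (auto simp: commutator_inv_left)
    qed
    with a show "inv a \<in> {a \<in> carrier G. \<forall>z\<in>Z. commutator a z \<in> P}" by auto
    fix b assume b: "b \<in> {a \<in> carrier G. \<forall>z\<in>Z. commutator a z \<in> P}"
    have "commutator (a \<otimes> b) z \<in> P" if z: "z \<in> Z" for z
      using a b z assms(2) P.inv_op_closed2 by (auto simp: commutator_mult_left subset_iff)
    with a b show "a \<otimes> b \<in> {a \<in> carrier G. \<forall>z\<in>Z. commutator a z \<in> P}" by auto
  qed auto
qed

text \<open>Modulo \<open>lower_central G (i + k + 2)\<close>, conjugation by \<open>z\<close> multiplies \<open>x\<close> by an element that
  commutes with \<open>y\<close>, and \<open>y\<close> by a central element; so it fixes \<open>commutator x y\<close>.\<close>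
lemma commutator_lower_central_add:
  "a \<in> lower_central G i \<Longrightarrow> z \<in> lower_central G k \<Longrightarrow> commutator a z \<in> lower_central G (i + k + 1)"
proof (induction i arbitrary: k a z)
  case 0
  then show ?case using commutator_lower_central by simp
next
  case (Suc i)
  define P where "P = lower_central G (Suc i + k + 1)"
  have PN: "P \<lhd> G" unfolding P_def by (rule lower_central_normal)
  interpret P: normal P G by (rule PN)
  interpret Q: group "G Mod P" by (rule P.factorgroup_is_group)
  interpret p: group_hom G "G Mod P" "\<lambda>x. P #> x"
    by unfold_locales (rule P.r_coset_hom_Mod)
  let ?C = "{a \<in> carrier G. \<forall>z\<in>lower_central G k. commutator a z \<in> P}"
  have "lower_central G (Suc i) \<subseteq> ?C"
    unfolding lower_central_Suc
  proof (intro generate_subgroup_incl commutator_centralizer_subgroup PN)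
    show "{commutator x y |x y. x \<in> carrier G \<and> y \<in> lower_central G i} \<subseteq> ?C"
    proof clarify
      fix x y assume x: "x \<in> carrier G" and y: "y \<in> lower_central G i"
      then have yc: "y \<in> carrier G" by (simp add: lower_central_carrier)
      have "commutator (commutator x y) z \<in> P" if z: "z \<in> lower_central G k" for z
      proof -
        have zc: "z \<in> carrier G" using z by (rule lower_central_carrier)
        define c where "c = commutator (inv x) z"
        define d where "d = commutator (inv y) z"
        have c: "c \<in> lower_central G (Suc k)"
          using x z commutator_lower_central by (simp add: c_def)
        have "inv y \<in> lower_central G i"
          using y subgroup.m_inv_closed[OF normal_imp_subgroup[OF lower_central_normal]] by blast
        then have d: "d \<in> lower_central G (i + k + 1)"
          unfolding d_def using z by (rule Suc.IH)
        have cc: "c \<in> carrier G" "d \<in> carrier G" using lower_central_carrier[OF c] lower_central_carrier[OF d] .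
        \<comment> \<open>In general z x z^-1 = x [x^-1, z], which explains the inverses in the
          definitions of \<open>c\<close> and \<open>d\<close>.\<close>
        have zx: "z \<otimes> x \<otimes> inv z = x \<otimes> c" "z \<otimes> y \<otimes> inv z = y \<otimes> d"
          using x yc zc by (simp_all add: c_def d_def commutator_def word_simps)
        have conj: "z \<otimes> commutator x y \<otimes> inv z = commutator (x \<otimes> c) (y \<otimes> d)"
          using x yc zc by (simp add: conj_commutator zx)
        have hom_comm: "P #> commutator u v = Q.commutator (P #> u) (P #> v)"
          if "u \<in> carrier G" "v \<in> carrier G" for u v
          using that unfolding commutator_def Q.commutator_def
          by (simp only: p.hom_mult p.hom_inv m_closed inv_closed)
        \<comment> \<open>The index of \<open>y\<close> is one less than that of the commutator
          [x, y] and the index of \<open>c\<close> one more than that of \<open>z\<close>, so the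
          induction hypothesis for \<open>Suc k\<close> lands in the same term
          \<open>P\<close>.\<close>
        have "commutator y c \<in> P"
          using Suc.IH[OF y c] by (simp add: P_def)
        then have cy: "(P #> c) \<otimes>\<^bsub>G Mod P\<^esub> (P #> y) = (P #> y) \<otimes>\<^bsub>G Mod P\<^esub> (P #> c)"
          using commutator_mem_imp_coset_comm[OF PN yc cc(1)] by simp
        have dg: "(P #> d) \<otimes>\<^bsub>G Mod P\<^esub> g = g \<otimes>\<^bsub>G Mod P\<^esub> (P #> d)" if "g \<in> carrier (G Mod P)" for g
        proof -
          from that obtain u where u: "u \<in> carrier G" "g = P #> u"
            by (auto simp: carrier_FactGroup)
          have "commutator u d \<in> P"
            using commutator_lower_central[OF u(1) d] by (simp add: P_def)
          then show ?thesis
            using commutator_mem_imp_coset_comm[OF PN u(1) cc(2)] u by simp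
        qed
        have "P #> (z \<otimes> commutator x y \<otimes> inv z) = P #> commutator x y"
          using x yc cc Q.commutator_central_perturb[of "P #> x" "P #> y" "P #> c" "P #> d", OF _ _ _ _ cy dg]
          by (simp add: conj hom_comm)
        moreover have "commutator (commutator x y) z =
            inv (z \<otimes> commutator x y \<otimes> inv z \<otimes> inv (commutator x y))"
          using x yc zc by (simp add: commutator_def word_simps)
        moreover have "u \<otimes> inv v \<in> P" if "P #> u = P #> v" "u \<in> carrier G" "v \<in> carrier G" for u v
        proof -
          have "u \<in> P #> v"
            using that rcos_self[OF that(2) P.subgroup_axioms] by simp
          then show ?thesis
            using that by (auto simp: r_coset_def word_simps subset_iff intro: P.mem_carrier)
        qed
        ultimately show ?thesis
          using x yc zc by (metis P.m_inv_closed commutator_closed inv_closed m_closed)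
      qed
      with x yc show "commutator x y \<in> carrier G \<and> (\<forall>z\<in>lower_central G k. commutator (commutator x y) z \<in> P)"
        by simp
    qed
  qed (auto intro: lower_central_carrier)
  with Suc.prems show ?case by (auto simp: P_def)
qed

end

section \<open>Word length\<close>

context group
begin

abbreviation word_prod :: "'a list \<Rightarrow> 'a" where
  "word_prod ws \<equiv> foldr (\<otimes>) ws \<one>"

lemma word_prod_closed: "set ws \<subseteq> carrier G \<Longrightarrow> word_prod ws \<in> carrier G"
  by (induction ws) auto

lemma word_prod_append:
  "set ws \<subseteq> carrier G \<Longrightarrow> set vs \<subseteq> carrier G \<Longrightarrow> word_prod (ws @ vs) = word_prod ws \<otimes> word_prod vs"
  by (induction ws) (auto simp: m_assoc word_prod_closed)

lemma inv_word_prod: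
  "set ws \<subseteq> carrier G \<Longrightarrow> inv (word_prod ws) = word_prod (map (m_inv G) (rev ws))"
proof (induction ws)
  case (Cons x ws)
  have "word_prod (map (m_inv G) (rev (x # ws))) = word_prod (map (m_inv G) (rev ws)) \<otimes> word_prod [inv x]"
    using Cons.prems by (simp only: rev.simps map_append list.map) (rule word_prod_append, auto)
  with Cons show ?case by (simp add: inv_mult_group word_prod_closed)
qed simp

end

locale finitely_generated_group = group +
  fixes S
  assumes finite_generating_set: "finite_generating_set G S"
begin

abbreviation wl :: "'a \<Rightarrow> nat" where
  "wl \<equiv> word_length G S"

abbreviation letters :: "'a set" where
  "letters \<equiv> S \<union> m_inv G ` S"

lemma generators_closed: "S \<subseteq> carrier G"
  using finite_generating_set by (simp add: finite_generating_set_def)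

lemma finite_generators: "finite S"
  using finite_generating_set by (simp add: finite_generating_set_def)

lemma letters_closed: "letters \<subseteq> carrier G"
  using generators_closed by auto

lemma inv_letters: "s \<in> letters \<Longrightarrow> inv s \<in> letters"
  using generators_closed by (auto simp: subset_iff)

lemma ex_word:
  assumes "x \<in> carrier G"
  shows "\<exists>ws. set ws \<subseteq> letters \<and> word_prod ws = x"
proof -
  have "x \<in> generate G S"
    using assms finite_generating_set by (simp add: finite_generating_set_def)
  then show ?thesis
  proof induction
    case one
    show ?case by (rule exI[of _ "[]"]) simp
  next
    case (incl h)
    then show ?case
      using generators_closed by (intro exI[of _ "[h]"]) auto
  next
    case (inv h)
    then show ?case
      using generators_closed by (intro exI[of _ "[inv h]"]) auto
  next
    case (eng h1 h2)
    then obtain ws vs where "set ws \<subseteq> letters" "word_prod ws = h1" "set vs \<subseteq> letters" "word_prod vs = h2"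
      by blast
    then show ?case
      using letters_closed word_prod_append[of ws vs] by (intro exI[of _ "ws @ vs"]) auto
  qed
qed

lemma word_length_le: "set ws \<subseteq> letters \<Longrightarrow> wl (word_prod ws) \<le> length ws"
  unfolding word_length_def by (rule Least_le) auto

lemma obtain_word:
  assumes "x \<in> carrier G"
  obtains ws where "set ws \<subseteq> letters" "word_prod ws = x" "length ws = wl x"
proof -
  let ?P = "\<lambda>n. \<exists>ws. length ws = n \<and> set ws \<subseteq> letters \<and> word_prod ws = x"
  have "\<exists>n. ?P n" using ex_word[OF assms] by auto
  then have "?P (LEAST n. ?P n)" by (rule LeastI_ex)
  then show ?thesis using that unfolding word_length_def by blast
qed

lemma word_length_one [simp]: "wl \<one> = 0"
  using word_length_le[of "[]"] by simp

lemma word_length_mult: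
  assumes "x \<in> carrier G" "y \<in> carrier G"
  shows "wl (x \<otimes> y) \<le> wl x + wl y"
proof -
  obtain ws where ws: "set ws \<subseteq> letters" "word_prod ws = x" "length ws = wl x"
    using obtain_word[OF assms(1)] .
  obtain vs where vs: "set vs \<subseteq> letters" "word_prod vs = y" "length vs = wl y"
    using obtain_word[OF assms(2)] .
  have "word_prod (ws @ vs) = x \<otimes> y"
    using word_prod_append ws vs letters_closed by (metis subset_trans)
  then show ?thesis
    using word_length_le[of "ws @ vs"] ws vs by simp
qed

lemma word_length_inv:
  assumes "x \<in> carrier G"
  shows "wl (inv x) \<le> wl x"
proof -
  obtain ws where ws: "set ws \<subseteq> letters" "word_prod ws = x" "length ws = wl x"
    using obtain_word[OF assms(1)] .
  have "set (map (m_inv G) (rev ws)) \<subseteq> letters"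
    using ws(1) inv_letters by (auto simp: subset_iff)
  moreover have "inv x = word_prod (map (m_inv G) (rev ws))"
    using inv_word_prod[of ws] ws letters_closed by auto
  ultimately show ?thesis
    using word_length_le[of "map (m_inv G) (rev ws)"] ws by simp
qed

lemma word_length_pow: "x \<in> carrier G \<Longrightarrow> wl (x [^] (n::nat)) \<le> n * wl x"
proof (induction n)
  case (Suc n)
  then show ?case using word_length_mult[of "x [^] n" x] by simp
qed simp

lemma word_length_commutator:
  assumes "x \<in> carrier G" "y \<in> carrier G"
  shows "wl (commutator x y) \<le> 2 * wl x + 2 * wl y"
  using word_length_mult[of "x \<otimes> y \<otimes> inv x" "inv y"] word_length_mult[of "x \<otimes> y" "inv x"]
    word_length_mult[of x y] word_length_inv[of x] word_length_inv[of y] assms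
  by (simp add: commutator_def)

lemma finite_word_ball: "finite {x \<in> carrier G. wl x \<le> n}"
proof (rule finite_subset)
  show "{x \<in> carrier G. wl x \<le> n} \<subseteq> word_prod ` {ws. set ws \<subseteq> letters \<and> length ws \<le> n}"
  proof
    fix x assume "x \<in> {x \<in> carrier G. wl x \<le> n}"
    then have x: "x \<in> carrier G" "wl x \<le> n" by auto
    then obtain ws where "set ws \<subseteq> letters" "word_prod ws = x" "length ws = wl x"
      using obtain_word by blast
    with x show "x \<in> word_prod ` {ws. set ws \<subseteq> letters \<and> length ws \<le> n}"
      by (intro image_eqI[of _ _ ws]) auto
  qed
  show "finite (word_prod ` {ws. set ws \<subseteq> letters \<and> length ws \<le> n})"
    using finite_generators by (intro finite_imageI finite_lists_length_le) auto
qed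

lemma real_hom_word_length:
  fixes f :: "'a \<Rightarrow> real"
  assumes f: "\<And>x y. x \<in> carrier G \<Longrightarrow> y \<in> carrier G \<Longrightarrow> f (x \<otimes> y) = f x + f y"
  shows "\<exists>C\<ge>0. \<forall>x\<in>carrier G. \<bar>f x\<bar> \<le> C * real (wl x)"
proof (rule exI[of _ "\<Sum>s\<in>letters. \<bar>f s\<bar>"], intro conjI ballI)
  let ?C = "\<Sum>s\<in>letters. \<bar>f s\<bar>"
  show "0 \<le> ?C" by (rule sum_nonneg) simp
  fix x assume "x \<in> carrier G"
  then obtain ws where ws: "set ws \<subseteq> letters" "word_prod ws = x" "length ws = wl x"
    using obtain_word by metis
  have f1: "f \<one> = 0" using f[of \<one> \<one>] by simp
  have "\<bar>f (word_prod ws)\<bar> \<le> ?C * length ws"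
    using ws(1)
  proof (induction ws)
    case (Cons s ws)
    have "\<bar>f s\<bar> \<le> ?C"
      using Cons.prems finite_generators by (intro member_le_sum) auto
    moreover have "f (word_prod (s # ws)) = f s + f (word_prod ws)"
      using Cons.prems letters_closed by (auto intro!: f word_prod_closed)
    moreover have "\<bar>f (word_prod ws)\<bar> \<le> ?C * length ws"
      using Cons by auto
    ultimately show ?case by (simp add: algebra_simps)
  qed (simp add: f1)
  then show "\<bar>f x\<bar> \<le> ?C * wl x" using ws by simp
qed

end

section \<open>Weighted words\<close>

text \<open>Mass estimates are proved letter by letter: a further letter of mass \<open>x\<close>
  contributes a factor 1 + x, and these factors multiply to at most the exponential of the total
  mass.\<close>

lemma one_plus_le_exp_mult: "0 \<le> x \<Longrightarrow> c + x \<le> d \<Longrightarrow> (1 + x) * exp c \<le> exp (d::real)"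
proof -
  assume "0 \<le> x" "c + x \<le> d"
  have "(1 + x) * exp c \<le> exp x * exp c"
    by (intro mult_right_mono) auto
  also have "\<dots> \<le> exp d" using \<open>c + x \<le> d\<close> by (simp add: exp_add[symmetric])
  finally show ?thesis .
qed

context group
begin

text \<open>A letter of weight \<open>k\<close> has mass \<open>\<rho> ^ k\<close>. At scale \<open>R\<close>, with \<open>\<rho> = 1 / R\<close>, words of bounded mass
  have \<open>O(R ^ k)\<close> letters of weight \<open>k\<close>; the point of the mass is that conjugation by a word of
  mass \<open>c\<close> multiplies it by at most \<open>exp c\<close>.\<close>
inductive weighted_word :: "(nat \<Rightarrow> 'a set) \<Rightarrow> real \<Rightarrow> real \<Rightarrow> 'a \<Rightarrow> bool" for X \<rho> where
  one: "0 \<le> c \<Longrightarrow> weighted_word X \<rho> c \<one>"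
| step: "y \<in> X k \<Longrightarrow> weighted_word X \<rho> c x \<Longrightarrow> c + \<rho> ^ k \<le> d \<Longrightarrow> weighted_word X \<rho> d (y \<otimes> x)"

lemma weighted_word_mono:
  assumes "weighted_word X \<rho> c x" "c \<le> d" "\<And>k. X k \<subseteq> Y k"
  shows "weighted_word Y \<rho> d x"
  using assms(1,2)
proof (induction arbitrary: d)
  case (step y k c x d' d)
  then show ?case
    using assms(3) by (intro weighted_word.step[of y Y k \<rho> c]) auto
qed (auto intro: weighted_word.one)

lemma weighted_word_mono_mass:
  "weighted_word X \<rho> c x \<Longrightarrow> c \<le> d \<Longrightarrow> weighted_word X \<rho> d x"
  using weighted_word_mono by blast

lemma weighted_word_closed:
  assumes "weighted_word X \<rho> c x" "\<And>k. X k \<subseteq> carrier G"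
  shows "x \<in> carrier G"
  using assms(1) by induction (use assms(2) in auto)

lemma weighted_word_nonneg:
  assumes "weighted_word X \<rho> c x" "0 \<le> \<rho>"
  shows "0 \<le> c"
  using assms(1)
proof induction
  case (step y k c x d)
  then show ?case using zero_le_power[OF assms(2), of k] by linarith
qed

lemma weighted_word_letter:
  assumes "y \<in> X k" "X k \<subseteq> carrier G"
  shows "weighted_word X \<rho> (\<rho> ^ k) y"
proof -
  have "weighted_word X \<rho> (\<rho> ^ k) (y \<otimes> \<one>)"
    using assms(1) by (rule weighted_word.step[of _ _ _ _ 0]) (simp_all add: weighted_word.one)
  then show ?thesis using assms by auto
qed

lemma weighted_word_mult:
  assumes "weighted_word X \<rho> c x" "weighted_word X \<rho> d y" "\<And>k. X k \<subseteq> carrier G"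
  shows "weighted_word X \<rho> (c + d) (x \<otimes> y)"
  using assms(1)
proof induction
  case (one c)
  then show ?case
    using assms weighted_word_closed[OF assms(2)] by (auto intro: weighted_word_mono_mass)
next
  case (step z k c x c')
  have "z \<otimes> x \<otimes> y = z \<otimes> (x \<otimes> y)"
    using step assms weighted_word_closed[OF assms(2)] weighted_word_closed[OF step(2)]
    by (intro m_assoc) auto
  then show ?case
    using step by (auto intro!: weighted_word.step[of z X k \<rho> "c + d"])
qed

lemma weighted_word_inv:
  assumes "weighted_word X \<rho> c x" "\<And>k. X k \<subseteq> carrier G" "\<And>k y. y \<in> X k \<Longrightarrow> inv y \<in> X k"
  shows "weighted_word X \<rho> c (inv x)"
  using assms(1)
proof induction
  case (step y k c x d)
  have "weighted_word X \<rho> (c + \<rho> ^ k) (inv x \<otimes> inv y)"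
    using step assms by (intro weighted_word_mult weighted_word_letter) auto
  moreover have "inv x \<otimes> inv y = inv (y \<otimes> x)"
    using step assms(2) weighted_word_closed[OF step(2)] by (subst inv_mult_group) auto
  ultimately show ?case using step by (auto intro: weighted_word_mono_mass)
qed (auto intro: weighted_word.one)

lemma weighted_word_pow:
  assumes "weighted_word X \<rho> c x" "\<And>k. X k \<subseteq> carrier G"
  shows "weighted_word X \<rho> (real n * c) (x [^] n)"
proof (induction n)
  case (Suc n)
  then show ?case
    using weighted_word_mult[OF Suc assms(1,2)] by (simp add: algebra_simps)
qed (auto intro: weighted_word.one)

text \<open>Since a b a^-1 = [a, b] b, each letter \<open>b\<close> is kept and joined by one letter
  whose weight is greater by \<open>i\<close>, that is, whose mass is that of \<open>b\<close> times
  \<open>\<rho> ^ i\<close>.\<close>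

lemma weighted_word_conj_letter:
  assumes "weighted_word Z \<rho> d z" "0 \<le> \<rho>" "\<And>k. Z k \<subseteq> carrier G" "a \<in> carrier G"
    and "\<And>k b. b \<in> Z k \<Longrightarrow> commutator a b \<in> Z (k + i)"
  shows "weighted_word Z \<rho> ((1 + \<rho> ^ i) * d) (a \<otimes> z \<otimes> inv a)"
  using assms(1)
proof induction
  case (one c)
  then show ?case
    using assms(2,4) by (auto intro!: weighted_word.one)
next
  case (step b k c x d)
  have b: "b \<in> carrier G" using step(1) assms(3) by auto
  have x: "x \<in> carrier G" using weighted_word_closed[OF step(2) assms(3)] .
  have "weighted_word Z \<rho> (\<rho> ^ (k + i) + (\<rho> ^ k + (1 + \<rho> ^ i) * c))
      (commutator a b \<otimes> (b \<otimes> (a \<otimes> x \<otimes> inv a)))"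
    using step assms by (intro weighted_word_mult weighted_word_letter) auto
  moreover have "commutator a b \<otimes> (b \<otimes> (a \<otimes> x \<otimes> inv a)) = a \<otimes> (b \<otimes> x) \<otimes> inv a"
    using b x assms(4) by (simp add: commutator_def word_simps)
  moreover have "\<rho> ^ (k + i) + (\<rho> ^ k + (1 + \<rho> ^ i) * c) = (1 + \<rho> ^ i) * (c + \<rho> ^ k)"
    by (simp add: algebra_simps power_add)
  moreover have "(1 + \<rho> ^ i) * (c + \<rho> ^ k) \<le> (1 + \<rho> ^ i) * d"
    using step(3) assms(2) by (intro mult_left_mono) auto
  ultimately show ?case by (metis weighted_word_mono_mass)
qed

lemma weighted_word_conj:
  assumes "weighted_word X \<rho> c g" "weighted_word Z \<rho> d z" "0 \<le> \<rho>"
    and X: "\<And>k. X k \<subseteq> carrier G" and Z: "\<And>k. Z k \<subseteq> carrier G"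
    and XZ: "\<And>i k a b. a \<in> X i \<Longrightarrow> b \<in> Z k \<Longrightarrow> commutator a b \<in> Z (i + k)"
  shows "weighted_word Z \<rho> (exp c * d) (g \<otimes> z \<otimes> inv g)"
  using assms(1)
proof induction
  case (one c)
  have "1 * d \<le> exp c * d"
    using weighted_word_nonneg[OF assms(2,3)] one by (intro mult_right_mono) auto
  then show ?case
    using weighted_word_closed[OF assms(2) Z] assms(2) by (auto intro: weighted_word_mono_mass)
next
  case (step a i c g c')
  have z: "z \<in> carrier G" using weighted_word_closed[OF assms(2) Z] .
  have g: "g \<in> carrier G" using weighted_word_closed[OF step(2) X] .
  have a: "a \<in> carrier G" using step(1) X by auto
  have "weighted_word Z \<rho> ((1 + \<rho> ^ i) * (exp c * d)) (a \<otimes> (g \<otimes> z \<otimes> inv g) \<otimes> inv a)"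
    using step(4) assms(3) Z a
  proof (rule weighted_word_conj_letter)
    show "commutator a b \<in> Z (k + i)" if "b \<in> Z k" for k b
      using XZ[OF step(1) that] by (simp add: add.commute)
  qed
  moreover have "a \<otimes> (g \<otimes> z \<otimes> inv g) \<otimes> inv a = (a \<otimes> g) \<otimes> z \<otimes> inv (a \<otimes> g)"
    using a g z by (simp add: word_simps)
  moreover have "(1 + \<rho> ^ i) * (exp c * d) \<le> exp c' * d"
    using one_plus_le_exp_mult[of "\<rho> ^ i" c c'] step(3) assms(3) weighted_word_nonneg[OF assms(2,3)]
    by (simp flip: mult.assoc) (rule mult_right_mono, auto)
  ultimately show ?case by (metis weighted_word_mono_mass)
qed

text \<open>The identity [a g, b] = (a [g, b] a^-1) [a, b] turns a bound s into (1 + r) s + r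
  \<open>\<rho> ^ k\<close> with r = \<open>\<rho> ^ i\<close>; on s = (exp c - 1)
  \<open>\<rho> ^ k\<close> this replaces exp c by (1 + r) exp c. The families are kept apart
  because \<open>Z\<close> will contain only letters of weight at least the sum of the least weights
  in \<open>X\<close> and \<open>Y\<close>.\<close>

lemma weighted_word_commutator_letter:
  assumes "weighted_word X \<rho> c g" "b \<in> Y k" "0 \<le> \<rho>"
    and X: "\<And>k. X k \<subseteq> carrier G" and Y: "\<And>k. Y k \<subseteq> carrier G" and Z: "\<And>k. Z k \<subseteq> carrier G"
    and XY: "\<And>i k a b. a \<in> X i \<Longrightarrow> b \<in> Y k \<Longrightarrow> commutator a b \<in> Z (i + k)"
    and XZ: "\<And>i k a b. a \<in> X i \<Longrightarrow> b \<in> Z k \<Longrightarrow> commutator a b \<in> Z (i + k)"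
  shows "weighted_word Z \<rho> ((exp c - 1) * \<rho> ^ k) (commutator g b)"
  using assms(1)
proof induction
  case (one c)
  have "b \<in> carrier G" using assms(2) Y by auto
  then show ?case
    using one assms(3) by (auto simp: commutator_def intro!: weighted_word.one)
next
  case (step a i c g c')
  have b: "b \<in> carrier G" using assms(2) Y by auto
  have g: "g \<in> carrier G" using weighted_word_closed[OF step(2) X] .
  have a: "a \<in> carrier G" using step(1) X by auto
  have "weighted_word Z \<rho> ((1 + \<rho> ^ i) * ((exp c - 1) * \<rho> ^ k)) (a \<otimes> commutator g b \<otimes> inv a)"
    using step(4) assms(3) Z a
  proof (rule weighted_word_conj_letter)
    show "commutator a b \<in> Z (k + i)" if "b \<in> Z k" for k b
      using XZ[OF step(1) that] by (simp add: add.commute)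
  qed
  then have "weighted_word Z \<rho> ((1 + \<rho> ^ i) * ((exp c - 1) * \<rho> ^ k) + \<rho> ^ (i + k)) (commutator (a \<otimes> g) b)"
    using XY[OF step(1) assms(2)] a b g Z
    by (auto simp: commutator_mult_left intro!: weighted_word_mult weighted_word_letter)
  moreover have "(1 + \<rho> ^ i) * ((exp c - 1) * \<rho> ^ k) + \<rho> ^ (i + k) = ((1 + \<rho> ^ i) * exp c - 1) * \<rho> ^ k"
    by (simp add: algebra_simps power_add)
  moreover have "\<dots> \<le> (exp c' - 1) * \<rho> ^ k"
    using one_plus_le_exp_mult[of "\<rho> ^ i" c c'] step(3) assms(3) by (intro mult_right_mono) auto
  ultimately show ?case by (metis weighted_word_mono_mass)
qed

text \<open>The recursion of the preceding lemma now runs over the letters of \<open>x\<close>. The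
  product form matters: the bound is small as soon as one of the two masses is, which keeps sums
  over many commutators bounded.\<close>

lemma weighted_word_commutator:
  assumes "weighted_word X \<rho> c g" "weighted_word Y \<rho> d x" "0 \<le> \<rho>"
    and X: "\<And>k. X k \<subseteq> carrier G" and Y: "\<And>k. Y k \<subseteq> carrier G" and Z: "\<And>k. Z k \<subseteq> carrier G"
    and XY: "\<And>i k a b. a \<in> X i \<Longrightarrow> b \<in> Y k \<Longrightarrow> commutator a b \<in> Z (i + k)"
    and XZ: "\<And>i k a b. a \<in> X i \<Longrightarrow> b \<in> Z k \<Longrightarrow> commutator a b \<in> Z (i + k)"
    and YZ: "\<And>i k a b. a \<in> Y i \<Longrightarrow> b \<in> Z k \<Longrightarrow> commutator a b \<in> Z (i + k)"
  shows "weighted_word Z \<rho> ((exp c - 1) * (exp d - 1)) (commutator g x)"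
  using assms(2)
proof induction
  case (one d)
  have "g \<in> carrier G" using weighted_word_closed[OF assms(1) X] .
  moreover have "0 \<le> (exp c - 1) * (exp d - 1)"
    using one weighted_word_nonneg[OF assms(1,3)] by simp
  ultimately show ?case
    using assms(3) by (auto simp: commutator_def intro!: weighted_word.one)
next
  case (step b i d x d')
  have g: "g \<in> carrier G" using weighted_word_closed[OF assms(1) X] .
  have x: "x \<in> carrier G" using weighted_word_closed[OF step(2) Y] .
  have b: "b \<in> carrier G" using step(1) Y by auto
  have c0: "0 \<le> c" using weighted_word_nonneg[OF assms(1,3)] .
  have "weighted_word Z \<rho> ((1 + \<rho> ^ i) * ((exp c - 1) * (exp d - 1))) (b \<otimes> commutator g x \<otimes> inv b)"
    using step(4) assms(3) Z b
  proof (rule weighted_word_conj_letter)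
    show "commutator b b' \<in> Z (k + i)" if "b' \<in> Z k" for k b'
      using YZ[OF step(1) that] by (simp add: add.commute)
  qed
  moreover have "weighted_word Z \<rho> ((exp c - 1) * \<rho> ^ i) (commutator g b)"
    using weighted_word_commutator_letter[of X \<rho> c g b Y i Z] assms(1,3) step(1) X Y Z XY XZ by blast
  ultimately have "weighted_word Z \<rho> ((exp c - 1) * \<rho> ^ i + (1 + \<rho> ^ i) * ((exp c - 1) * (exp d - 1)))
      (commutator g (b \<otimes> x))"
    using g b x Z by (simp add: commutator_mult_right weighted_word_mult)
  moreover have "(exp c - 1) * \<rho> ^ i + (1 + \<rho> ^ i) * ((exp c - 1) * (exp d - 1))
      = (exp c - 1) * ((1 + \<rho> ^ i) * exp d - 1)"
    by (simp add: algebra_simps)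
  moreover have "\<dots> \<le> (exp c - 1) * (exp d' - 1)"
    using one_plus_le_exp_mult[of "\<rho> ^ i" d d'] step(3) assms(3) c0 by (intro mult_left_mono) auto
  ultimately show ?case by (metis weighted_word_mono_mass)
qed

text \<open>A new \<open>t\<close> on the left is moved across \<open>z\<close> by passing to t z
  t^-1, at the price of a factor 1 + \<open>\<rho> ^ j\<close>. The occurrences of \<open>t\<close>
  have total mass at most \<open>c\<close>, so these factors multiply to at most
  \<open>exp c\<close>. The commutators created on the way are letters of \<open>Y\<close> and need
  not be collected.\<close>

lemma weighted_word_collect:
  assumes "weighted_word X \<rho> c x" "0 \<le> \<rho>" "t \<in> carrier G"
    and Y: "\<And>k. Y k \<subseteq> carrier G"
    and XY: "\<And>k y. y \<in> X k \<Longrightarrow> y \<in> Y k \<or> k = j \<and> y = t"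
    and tY: "\<And>k b. b \<in> Y k \<Longrightarrow> commutator t b \<in> Y (k + j)"
  shows "\<exists>(p::nat) z. x = z \<otimes> t [^] p \<and> weighted_word Y \<rho> (c * exp c) z \<and> real p * \<rho> ^ j \<le> c"
  using assms(1)
proof induction
  case (one c)
  then show ?case
    by (intro exI[of _ 0] exI[of _ \<one>]) (auto intro!: weighted_word.one)
next
  case (step y k c x d)
  then obtain p z where p: "x = z \<otimes> t [^] (p::nat)" "weighted_word Y \<rho> (c * exp c) z" "real p * \<rho> ^ j \<le> c"
    by blast
  have z: "z \<in> carrier G" using weighted_word_closed[OF p(2) Y] .
  have c0: "0 \<le> c" using weighted_word_nonneg[OF step(2) assms(2)] .
  \<comment> \<open>The first bound serves the case that the new letter is \<open>t\<close>, the
    second the case that it stays a letter of \<open>z\<close>.\<close>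
  have d: "c * (1 + \<rho> ^ k) * exp c \<le> d * exp d" "c * exp c + \<rho> ^ k \<le> d * exp d"
  proof -
    have r: "0 \<le> \<rho> ^ k" using assms(2) by simp
    have "c * ((1 + \<rho> ^ k) * exp c) \<le> d * exp d"
      using one_plus_le_exp_mult[OF r step(3)] c0 r step(3) by (intro mult_mono) auto
    then show "c * (1 + \<rho> ^ k) * exp c \<le> d * exp d" by (simp add: mult.assoc)
    have "\<rho> ^ k * 1 \<le> \<rho> ^ k * exp c" using r c0 by (intro mult_left_mono) auto
    then have "c * exp c + \<rho> ^ k \<le> (c + \<rho> ^ k) * exp c" by (simp add: algebra_simps)
    also have "\<dots> \<le> d * exp d" using c0 r step(3) by (intro mult_mono) auto
    finally show "c * exp c + \<rho> ^ k \<le> d * exp d" .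
  qed
  from XY[OF step(1)] show ?case
  proof
    assume y: "y \<in> Y k"
    have "weighted_word Y \<rho> (d * exp d) (y \<otimes> z)"
      using y p(2) d(2) by (rule weighted_word.step)
    moreover have "y \<otimes> x = y \<otimes> z \<otimes> t [^] p"
      using y Y z assms(3) p(1) by (auto simp: m_assoc subset_iff)
    moreover have "real p * \<rho> ^ j \<le> d" using p(3) step(3) zero_le_power[OF assms(2), of k] by linarith
    ultimately show ?thesis by blast
  next
    assume y: "k = j \<and> y = t"
    have "weighted_word Y \<rho> ((1 + \<rho> ^ j) * (c * exp c)) (t \<otimes> z \<otimes> inv t)"
      using p(2) assms(2) Y assms(3) tY by (rule weighted_word_conj_letter)
    then have "weighted_word Y \<rho> (d * exp d) (t \<otimes> z \<otimes> inv t)"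
      using d(1) y by (auto intro: weighted_word_mono_mass simp: mult_ac)
    moreover have "y \<otimes> x = (t \<otimes> z \<otimes> inv t) \<otimes> t [^] Suc p"
      using z assms(3) p(1) y nat_pow_Suc2[OF assms(3), of p]
      by (simp add: word_simps del: nat_pow_Suc Group.nat_pow_Suc)
    moreover have "real (Suc p) * \<rho> ^ j \<le> d" using p(3) step(3) y by (simp add: algebra_simps)
    ultimately show ?thesis by blast
  qed
qed

end

section \<open>Sublinear distortion of the commutator subgroup\<close>

text \<open>The closed form dominates the solution of s(p + 1) = exp \<open>\<delta>\<close> s(p) +
  \<open>\<epsilon>\<close> with s(0) = 0: each of p summands \<open>\<epsilon>\<close> is
  multiplied by at most exp (p \<open>\<delta>\<close>).\<close>

lemma exp_recursion_bound:
  assumes "0 \<le> \<epsilon>" "0 \<le> \<delta>"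
  shows "exp \<delta> * (real p * (\<epsilon> * exp (real p * \<delta>))) + \<epsilon> \<le> real (Suc p) * (\<epsilon> * exp (real (Suc p) * \<delta>))"
proof -
  have "\<epsilon> * 1 \<le> \<epsilon> * exp (real (Suc p) * \<delta>)" using assms by (intro mult_left_mono) auto
  then show ?thesis by (simp add: algebra_simps exp_add)
qed

lemma exp_minus_one_le: "0 \<le> r \<Longrightarrow> r \<le> 1 \<Longrightarrow> exp r - 1 \<le> 2 * (r::real)"
  using exp_bound[of r] mult_left_mono[of r 1 r] by (simp add: power2_eq_square)

lemma exp_nat_le: "exp (real n) \<le> 3 ^ n"
  using power_mono[OF exp_le, of n] by (simp add: exp_of_nat_mult[symmetric])

text \<open>Numbered from \<open>1\<close>, the terms of the lower central series have weights that add up under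
  commutators.\<close>
definition (in group) lcs :: "nat \<Rightarrow> 'a set" where
  "lcs k = lower_central G (k - 1)"

context finitely_generated_group
begin

lemma lcs_carrier: "x \<in> lcs k \<Longrightarrow> x \<in> carrier G"
  unfolding lcs_def by (rule lower_central_carrier)

lemma lcs_inv: "x \<in> lcs k \<Longrightarrow> inv x \<in> lcs k"
  unfolding lcs_def using subgroup.m_inv_closed[OF normal_imp_subgroup[OF lower_central_normal]] .

lemma commutator_lcs:
  assumes "a \<in> lcs i" "b \<in> lcs k" "1 \<le> i" "1 \<le> k"
  shows "commutator a b \<in> lcs (i + k)"
proof -
  have "commutator a b \<in> lower_central G ((i - 1) + (k - 1) + 1)"
    using assms by (intro commutator_lower_central_add) (simp_all add: lcs_def)
  moreover have "(i - 1) + (k - 1) + 1 = i + k - 1" using assms by simp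
  ultimately show ?thesis unfolding lcs_def by (simp only:)
qed

text \<open>The radius \<open>D * 4 ^ k\<close> makes the family closed under commutators.\<close>
definition letter_ball :: "nat \<Rightarrow> nat \<Rightarrow> nat \<Rightarrow> 'a set" where
  "letter_ball D j k = (if j \<le> k then {x \<in> lcs k. wl x \<le> D * 4 ^ k} else {})"

lemma letter_ball_carrier: "letter_ball D j k \<subseteq> carrier G"
  using lcs_carrier by (auto simp: letter_ball_def)

lemma letter_ball_inv: "x \<in> letter_ball D j k \<Longrightarrow> inv x \<in> letter_ball D j k"
  using lcs_inv lcs_carrier word_length_inv by (fastforce simp: letter_ball_def split: if_splits)

lemma letter_ball_mono: "D \<le> D' \<Longrightarrow> j' \<le> j \<Longrightarrow> letter_ball D j k \<subseteq> letter_ball D' j' k"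
  by (auto simp: letter_ball_def intro: order_trans)

lemma finite_letter_ball: "finite (letter_ball D j k)"
  by (rule finite_subset[OF _ finite_word_ball[of "D * 4 ^ k"]]) (auto simp: letter_ball_def lcs_carrier)

text \<open>A commutator has length at most twice the sum of the lengths of its entries, and 2 * 4^k
  + 2 * 4^l is at most 4^(k + l) for positive k and l, with equality at k = l = 1. This is the
  origin of the base 4.\<close>

lemma commutator_letter_ball:
  assumes "a \<in> letter_ball D i k" "b \<in> letter_ball D j l" "1 \<le> i" "1 \<le> j"
  shows "commutator a b \<in> letter_ball D (i + j) (k + l)"
proof -
  have a: "a \<in> lcs k" "wl a \<le> D * 4 ^ k" "i \<le> k" and b: "b \<in> lcs l" "wl b \<le> D * 4 ^ l" "j \<le> l"
    using assms by (auto simp: letter_ball_def split: if_splits)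
  have "(4::nat) ^ k * 4 ^ 1 \<le> 4 ^ k * 4 ^ l" "(4::nat) ^ 1 * 4 ^ l \<le> 4 ^ k * 4 ^ l"
    using a b assms by (intro mult_left_mono mult_right_mono power_increasing; simp)+
  then have p: "2 * 4 ^ k + 2 * 4 ^ l \<le> (4::nat) ^ (k + l)"
    unfolding power_add power_one_right by linarith
  have "wl (commutator a b) \<le> 2 * (D * 4 ^ k) + 2 * (D * 4 ^ l)"
    using word_length_commutator[of a b] a b lcs_carrier by fastforce
  also have "\<dots> = D * (2 * 4 ^ k + 2 * 4 ^ l)" by (simp add: algebra_simps)
  also have "\<dots> \<le> D * 4 ^ (k + l)"
    using p by (rule mult_left_mono) simp
  finally show ?thesis
    using a b assms commutator_lcs[of a k b l] by (simp add: letter_ball_def)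
qed

lemma commutator_letter_ball':
  assumes "a \<in> letter_ball D i k" "b \<in> letter_ball D j l" "1 \<le> i" "1 \<le> j"
  shows "commutator a b \<in> letter_ball D j (k + l)"
  using commutator_letter_ball[OF assms] letter_ball_mono[of D D j "i + j"] by auto

abbreviation scaled_word :: "nat \<Rightarrow> nat \<Rightarrow> nat \<Rightarrow> real \<Rightarrow> 'a \<Rightarrow> bool" where
  "scaled_word D j R c x \<equiv> weighted_word (letter_ball D j) (1 / real R) c x"

lemma scaled_word_mono:
  "scaled_word D j R c x \<Longrightarrow> D \<le> D' \<Longrightarrow> j' \<le> j \<Longrightarrow> c \<le> c' \<Longrightarrow> scaled_word D' j' R c' x"
  by (rule weighted_word_mono) (auto dest: letter_ball_mono)

lemma scaled_word_closed: "scaled_word D j R c x \<Longrightarrow> x \<in> carrier G"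
  using weighted_word_closed letter_ball_carrier by metis

lemma scaled_word_nonneg: "scaled_word D j R c x \<Longrightarrow> 0 \<le> c"
  by (rule weighted_word_nonneg) auto

lemma scaled_word_mult:
  "scaled_word D j R c x \<Longrightarrow> scaled_word D j R d y \<Longrightarrow> scaled_word D j R (c + d) (x \<otimes> y)"
  by (rule weighted_word_mult) (auto simp: letter_ball_carrier)

lemma scaled_word_inv: "scaled_word D j R c x \<Longrightarrow> scaled_word D j R c (inv x)"
  by (rule weighted_word_inv) (auto simp: letter_ball_carrier letter_ball_inv)

lemma scaled_word_pow: "scaled_word D j R c x \<Longrightarrow> scaled_word D j R (real n * c) (x [^] n)"
  by (rule weighted_word_pow) (auto simp: letter_ball_carrier)

lemma scaled_word_conj:
  assumes "scaled_word D i R c g" "scaled_word D j R d z" "1 \<le> i" "1 \<le> j"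
  shows "scaled_word D j R (exp c * d) (g \<otimes> z \<otimes> inv g)"
  using assms(1,2) by (rule weighted_word_conj)
    (use assms letter_ball_carrier commutator_letter_ball' in auto)

lemma scaled_word_commutator:
  assumes "scaled_word D i R c x" "scaled_word D j R d y" "1 \<le> i" "1 \<le> j"
  shows "scaled_word D (i + j) R ((exp c - 1) * (exp d - 1)) (commutator x y)"
  using assms(1,2) by (rule weighted_word_commutator[where Z = "letter_ball D (i + j)"])
    (use assms letter_ball_carrier commutator_letter_ball commutator_letter_ball' in auto)

lemma scaled_word_letter:
  "x \<in> lcs k \<Longrightarrow> wl x \<le> D * 4 ^ k \<Longrightarrow> scaled_word D k R ((1 / real R) ^ k) x"
  by (rule weighted_word_letter[OF _ letter_ball_carrier]) (simp add: letter_ball_def)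

lemma scaled_word_letter':
  assumes "x \<in> lcs k" "wl x \<le> D"
  shows "scaled_word D k R ((1 / real R) ^ k) x"
proof (rule scaled_word_letter[OF assms(1)])
  have "D * 1 \<le> D * 4 ^ k" by (intro mult_left_mono) auto
  with assms(2) show "wl x \<le> D * 4 ^ k" by linarith
qed

text \<open>If f l = z t^l, then the next value is e_l (t z t^-1) t^(l+1); so the correction obeys
  the recursion of \<open>exp_recursion_bound\<close>, with exp \<open>\<delta>\<close> coming from
  the conjugation by \<open>t\<close>. This serves for f l = [x^l, u] and for the powers of a
  conjugate of \<open>u\<close>.\<close>

lemma scaled_word_interleave:
  assumes "f 0 = \<one>" "\<And>l. l < p \<Longrightarrow> f (Suc l) = e l \<otimes> t \<otimes> f l"
    and "\<And>l. l < p \<Longrightarrow> scaled_word D k R \<epsilon> (e l)" "scaled_word D i R \<delta> t" "1 \<le> i" "1 \<le> k" "0 \<le> \<epsilon>"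
  shows "\<exists>z. f p = z \<otimes> t [^] p \<and> scaled_word D k R (real p * (\<epsilon> * exp (real p * \<delta>))) z"
  using assms(2,3)
proof (induction p)
  case 0
  then show ?case
    using assms(1) by (intro exI[of _ \<one>]) (auto intro: weighted_word.one)
next
  case (Suc p)
  then obtain z where z: "f p = z \<otimes> t [^] p" "scaled_word D k R (real p * (\<epsilon> * exp (real p * \<delta>))) z"
    by (metis less_Suc_eq)
  have t: "t \<in> carrier G" and zc: "z \<in> carrier G" and e: "e p \<in> carrier G"
    using scaled_word_closed assms(4) z(2) Suc.prems(2)[of p] by auto
  have "scaled_word D k R (exp \<delta> * (real p * (\<epsilon> * exp (real p * \<delta>)))) (t \<otimes> z \<otimes> inv t)"
    using assms(4) z(2) assms(5,6) by (rule scaled_word_conj)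
  then have "scaled_word D k R (\<epsilon> + exp \<delta> * (real p * (\<epsilon> * exp (real p * \<delta>)))) (e p \<otimes> (t \<otimes> z \<otimes> inv t))"
    using Suc.prems(2)[of p] by (intro scaled_word_mult) auto
  then have "scaled_word D k R (real (Suc p) * (\<epsilon> * exp (real (Suc p) * \<delta>))) (e p \<otimes> (t \<otimes> z \<otimes> inv t))"
    using exp_recursion_bound[of \<epsilon> \<delta> p] assms(7) scaled_word_nonneg[OF assms(4)]
    by (auto intro: weighted_word_mono_mass)
  moreover have "f (Suc p) = e p \<otimes> (t \<otimes> z \<otimes> inv t) \<otimes> t [^] Suc p"
    using Suc.prems(1)[of p] z(1) t zc e nat_pow_Suc2[OF t, of p]
    by (simp add: word_simps del: nat_pow_Suc Group.nat_pow_Suc)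
  ultimately show ?case by blast
qed

text \<open>From a b a^q b^q = (a [b, a^q] a^-1) a^(q+1) b^(q+1) each step conjugates the correction
  by \<open>a \<otimes> b\<close> and adds one commutator whose mass is of order
  \<open>\<beta>\<close>; as p \<open>\<beta>\<close> is at most 1, the sum stays bounded.\<close>

lemma scaled_word_mult_pow:
  assumes "scaled_word D j R \<alpha> a" "scaled_word D k R \<beta> b" "1 \<le> j" "1 \<le> k"
    and p\<alpha>: "real p * \<alpha> \<le> 1" and p\<beta>: "real p * \<beta> \<le> 1"
  shows "\<exists>z. (a \<otimes> b) [^] p = z \<otimes> (a [^] p \<otimes> b [^] p) \<and> scaled_word D (j + k) R 108 z"
proof (cases "p = 0")
  case True
  then show ?thesis
    by (intro exI[of _ \<one>]) (auto intro: weighted_word.one)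
next
  case False
  have a: "a \<in> carrier G" and b: "b \<in> carrier G"
    using scaled_word_closed assms(1,2) by auto
  have nn: "0 \<le> \<alpha>" "0 \<le> \<beta>" using scaled_word_nonneg assms(1,2) by auto
  \<comment> \<open>The mass of a [b, a^q] a^-1: \<open>exp \<alpha>\<close> is the cost of the
    conjugation, and \<open>exp 1 - 1\<close> belongs to a^q, whose mass is at most p
    \<open>\<alpha>\<close>, hence at most 1.\<close>
  define \<epsilon> where "\<epsilon> = exp \<alpha> * ((exp \<beta> - 1) * (exp 1 - 1))"
  have \<epsilon>: "0 \<le> \<epsilon>" using nn by (simp add: \<epsilon>_def)
  have "\<exists>z. (a \<otimes> b) [^] q = z \<otimes> (a [^] q \<otimes> b [^] q) \<and>
      scaled_word D (j + k) R (real q * (\<epsilon> * exp (real q * (\<alpha> + \<beta>)))) z" if "q \<le> p" for q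
    using that
  proof (induction q)
    case 0
    show ?case
      by (intro exI[of _ \<one>]) (auto intro: weighted_word.one)
  next
    case (Suc q)
    then obtain z where z: "(a \<otimes> b) [^] q = z \<otimes> (a [^] q \<otimes> b [^] q)"
      "scaled_word D (j + k) R (real q * (\<epsilon> * exp (real q * (\<alpha> + \<beta>)))) z" by auto
    have zc: "z \<in> carrier G" using z(2) scaled_word_closed by blast
    have ab: "scaled_word D 1 R (\<alpha> + \<beta>) (a \<otimes> b)"
      using assms by (intro scaled_word_mult) (auto intro: scaled_word_mono)
    have 1: "scaled_word D (j + k) R (exp (\<alpha> + \<beta>) * (real q * (\<epsilon> * exp (real q * (\<alpha> + \<beta>)))))
        (a \<otimes> b \<otimes> z \<otimes> inv (a \<otimes> b))"
      using assms by (intro scaled_word_conj[OF ab z(2)]) auto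
    have "real q * \<alpha> \<le> real p * \<alpha>" using Suc.prems nn by (intro mult_right_mono) auto
    then have "scaled_word D j R 1 (a [^] q)"
      using p\<alpha> scaled_word_pow[OF assms(1), of q] by (auto intro: weighted_word_mono_mass)
    then have "scaled_word D (k + j) R ((exp \<beta> - 1) * (exp 1 - 1)) (commutator b (a [^] q))"
      using assms by (intro scaled_word_commutator) auto
    then have 2: "scaled_word D (j + k) R \<epsilon> (a \<otimes> commutator b (a [^] q) \<otimes> inv a)"
      unfolding \<epsilon>_def using assms by (intro scaled_word_conj[OF assms(1)]) (auto simp: add.commute)
    have "scaled_word D (j + k) R (real (Suc q) * (\<epsilon> * exp (real (Suc q) * (\<alpha> + \<beta>))))
        ((a \<otimes> b \<otimes> z \<otimes> inv (a \<otimes> b)) \<otimes> (a \<otimes> commutator b (a [^] q) \<otimes> inv a))"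
      using scaled_word_mult[OF 1 2] exp_recursion_bound[of \<epsilon> "\<alpha> + \<beta>" q] \<epsilon> nn
      by (auto intro: weighted_word_mono_mass)
    moreover have "(a \<otimes> b) [^] Suc q = ((a \<otimes> b \<otimes> z \<otimes> inv (a \<otimes> b)) \<otimes> (a \<otimes> commutator b (a [^] q) \<otimes> inv a))
        \<otimes> (a [^] Suc q \<otimes> b [^] Suc q)"
      using z(1) zc a b nat_pow_Suc2[OF a, of q] nat_pow_Suc2[OF b, of q] nat_pow_Suc2[of "a \<otimes> b" q]
      by (simp add: commutator_def word_simps del: nat_pow_Suc Group.nat_pow_Suc)
    ultimately show ?case by blast
  qed
  then obtain z where z: "(a \<otimes> b) [^] p = z \<otimes> (a [^] p \<otimes> b [^] p)"
    "scaled_word D (j + k) R (real p * (\<epsilon> * exp (real p * (\<alpha> + \<beta>)))) z" by blast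
  \<comment> \<open>Here 108 = 4 * 27. The two differences of exponentials contribute 2
    \<open>\<beta>\<close> and 2, and exp 1 * exp 2 is at most 27. That \<open>\<alpha>\<close> and
    \<open>\<beta>\<close> are at most 1 uses that p is positive.\<close>
  have "real p * (\<epsilon> * exp (real p * (\<alpha> + \<beta>))) \<le> 108"
  proof -
    have "1 * \<alpha> \<le> real p * \<alpha>" "1 * \<beta> \<le> real p * \<beta>"
      using False nn by (intro mult_right_mono; simp)+
    then have ab1: "\<alpha> \<le> 1" "\<beta> \<le> 1" using p\<alpha> p\<beta> by auto
    have "\<epsilon> \<le> exp 1 * ((2 * \<beta>) * 2)"
      unfolding \<epsilon>_def using nn ab1 exp_minus_one_le[of \<beta>] exp_minus_one_le[of 1]
      by (intro mult_mono) auto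
    then have "real p * (\<epsilon> * exp (real p * (\<alpha> + \<beta>))) \<le> real p * ((exp 1 * ((2 * \<beta>) * 2)) * exp 2)"
      using p\<alpha> p\<beta> \<epsilon> nn by (intro mult_left_mono mult_mono) (auto simp: distrib_left)
    also have "\<dots> = (real p * \<beta>) * (4 * exp 3)"
      using exp_add[of 1 "2::real"] by simp
    also have "\<dots> \<le> 1 * (4 * 27)"
      using p\<beta> nn exp_nat_le[of 3] by (intro mult_mono) auto
    finally show ?thesis by simp
  qed
  then show ?thesis using z by (auto intro: weighted_word_mono_mass)
qed

text \<open>Conjugation by \<open>x\<^sup>q\<close> maps \<open>u\<close> to \<open>[x\<^sup>q, u] u\<close>, where \<open>[x\<^sup>q, u]\<close> is a product of \<open>q\<close> conjugates of
  \<open>y\<close>; in the \<open>m\<close>-th power of this element the factors \<open>y\<close> and \<open>u\<close> are collected.\<close>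
lemma scaled_word_commutator_pow:
  assumes x: "x \<in> carrier G" and u: "u \<in> lcs i" and i: "1 \<le> i"
    and y: "y = commutator x u" and D: "wl x \<le> D" "wl u \<le> D" "wl y \<le> D"
    and R: "1 \<le> R" and q: "q \<le> R" and m: "m \<le> R ^ i"
  shows "\<exists>z. commutator (x [^] q) (u [^] m) = z \<otimes> y [^] (q * m) \<and> scaled_word D (i + 2) R 432 z"
proof -
  let ?r = "1 / real R"
  have uc: "u \<in> carrier G" using u by (rule lcs_carrier)
  have yl: "y \<in> lcs (i + 1)"
    using commutator_lcs[of x 1 u i] x u i by (simp add: y lcs_def add.commute)
  have yc: "y \<in> carrier G" using yl by (rule lcs_carrier)
  have r: "0 \<le> ?r" "?r \<le> 1" using R by auto
  have r_pow: "0 \<le> ?r ^ k" "?r ^ k \<le> 1" for k using r by (auto intro: power_le_one)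
  have Rr: "real n * ?r ^ k \<le> 1" if "n \<le> R ^ k" for n k
  proof -
    have "real n * ?r ^ k \<le> real (R ^ k) * ?r ^ k"
      using that r by (intro mult_right_mono) (auto simp flip: of_nat_power)
    also have "\<dots> = 1" using R by (simp add: power_divide)
    finally show ?thesis .
  qed
  \<comment> \<open>As q is at most R, repeating a letter q times costs as much as lowering its
    weight by one.\<close>
  have qr: "real q * ?r ^ Suc k \<le> ?r ^ k" for k
    using mult_right_mono[OF Rr[of q 1] r_pow(1)[of k]] q by (simp add: mult_ac)
  have wx: "scaled_word D 1 R ?r x"
    using scaled_word_letter'[of x 1 D R] x D by (simp add: lcs_def)
  have wu: "scaled_word D i R (?r ^ i) u"
    using scaled_word_letter' u D by blast
  have wy: "scaled_word D (i + 1) R (?r ^ (i + 1)) y"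
    using scaled_word_letter' yl D by blast
  \<comment> \<open>From [x^(l+1), u] = [x^l, y] y [x^l, u] the power y^q is collected, with the
    commutators [x^l, y] of weight i + 2 as errors.\<close>
  let ?f = "\<lambda>l::nat. commutator (x [^] l) u"
  have "\<exists>z. ?f q = z \<otimes> y [^] q \<and>
      scaled_word D (i + 2) R (real q * (4 * ?r ^ (i + 1) * exp (real q * ?r ^ (i + 1)))) z"
  proof (rule scaled_word_interleave[where e = "\<lambda>l. commutator (x [^] l) y" and i = "i + 1"])
    show "?f 0 = \<one>" using uc by (simp add: commutator_def)
    fix l assume l: "l < q"
    show "?f (Suc l) = commutator (x [^] l) y \<otimes> y \<otimes> ?f l"
      using x uc by (simp add: commutator_mult_left y commutator_def word_simps)
    have "scaled_word D 1 R 1 (x [^] l)"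
      using scaled_word_pow[OF wx, of l] Rr[of l 1] l q by (auto intro: weighted_word_mono_mass)
    then have "scaled_word D (1 + (i + 1)) R ((exp 1 - 1) * (exp (?r ^ (i + 1)) - 1)) (commutator (x [^] l) y)"
      using wy by (rule scaled_word_commutator) (use i in auto)
    moreover have "(exp 1 - 1) * (exp (?r ^ (i + 1)) - 1) \<le> 2 * (2 * ?r ^ (i + 1))"
      using exp_minus_one_le[OF r_pow, of "i + 1"] exp_minus_one_le[of 1] r_pow[of "i + 1"]
      by (intro mult_mono) auto
    ultimately show "scaled_word D (i + 2) R (4 * ?r ^ (i + 1)) (commutator (x [^] l) y)"
      by (auto intro: weighted_word_mono_mass)
  qed (use wy r_pow in auto)
  then obtain z where z: "?f q = z \<otimes> y [^] q"
    "scaled_word D (i + 2) R (real q * (4 * ?r ^ (i + 1) * exp (real q * ?r ^ (i + 1)))) z" by blast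
  have "real q * (4 * ?r ^ (i + 1) * exp (real q * ?r ^ (i + 1))) =
      4 * (real q * ?r ^ (i + 1)) * exp (real q * ?r ^ (i + 1))"
    by simp
  \<comment> \<open>The 4 is that of the mass of [x^l, y], and 3 bounds exp 1.\<close>
  also have "\<dots> \<le> 4 * ?r ^ i * 3"
  proof (intro mult_mono)
    have "real q * ?r ^ (i + 1) \<le> 1" using qr[of i] r_pow[of i] by simp
    then have "exp (real q * ?r ^ (i + 1)) \<le> exp 1" by simp
    then show "exp (real q * ?r ^ (i + 1)) \<le> 3" using exp_le by linarith
  qed (use qr[of i] in auto)
  finally have z': "scaled_word D (i + 2) R (12 * ?r ^ i) z"
    using z(2) by (auto intro: weighted_word_mono_mass)
  have zc: "z \<in> carrier G" using z' scaled_word_closed by blast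
  have wyq: "scaled_word D (i + 1) R (?r ^ i) (y [^] q)"
    using scaled_word_pow[OF wy, of q] qr[of i] by (auto intro: weighted_word_mono_mass)
  have wyu: "scaled_word D i R (2 * ?r ^ i) (y [^] q \<otimes> u)"
    using scaled_word_mult[of D i R "?r ^ i" "y [^] q" "?r ^ i" u] wu scaled_word_mono[OF wyq, of D i]
    by simp
  define g where "g = x [^] q \<otimes> u \<otimes> inv (x [^] q)"
  have g: "g = z \<otimes> (y [^] q \<otimes> u)"
  proof -
    have "g = ?f q \<otimes> u" using x uc by (simp add: g_def commutator_def word_simps)
    then show ?thesis using z(1) zc yc uc by (simp add: m_assoc)
  qed
  \<comment> \<open>The conjugate g of \<open>u\<close> equals z y^q u. Its power is collected in
    two stages: here the factors z are split off, afterwards y^q and \<open>u\<close> are separated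
    from each other.\<close>
  have "\<exists>z1. g [^] m = z1 \<otimes> (y [^] q \<otimes> u) [^] m \<and>
      scaled_word D (i + 2) R (real m * (12 * ?r ^ i * exp (real m * (2 * ?r ^ i)))) z1"
  proof (rule scaled_word_interleave[where f = "\<lambda>l. g [^] l" and e = "\<lambda>_. z" and i = i])
    show "g [^] Suc l = z \<otimes> (y [^] q \<otimes> u) \<otimes> g [^] l" for l
    proof -
      have "g \<in> carrier G" using g zc yc uc by simp
      then have "g [^] Suc l = g \<otimes> g [^] l" by (rule nat_pow_Suc2)
      then show ?thesis by (simp add: g)
    qed
  qed (use wyu z' i r_pow in auto)
  then obtain z1 where z1: "g [^] m = z1 \<otimes> (y [^] q \<otimes> u) [^] m"
    "scaled_word D (i + 2) R (real m * (12 * ?r ^ i * exp (real m * (2 * ?r ^ i)))) z1" by blast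
  have "real m * (12 * ?r ^ i * exp (real m * (2 * ?r ^ i))) =
      (12 * (real m * ?r ^ i)) * exp (2 * (real m * ?r ^ i))"
    by (simp add: mult_ac)
  also have "\<dots> \<le> (12 * 1) * 9"
  proof (intro mult_mono)
    have "exp (2 * (real m * ?r ^ i)) \<le> exp (real 2)" using Rr[OF m] by simp
    also have "\<dots> \<le> 9" using exp_nat_le[of 2] by simp
    finally show "exp (2 * (real m * ?r ^ i)) \<le> 9" .
  qed (use Rr[OF m] in auto)
  finally have z1': "scaled_word D (i + 2) R 108 z1"
    using z1(2) by (auto intro: weighted_word_mono_mass)
  \<comment> \<open>The correction has weight 2 i + 1, which is at least i + 2 because i is
    positive. The remaining power of y^q is y^(q m).\<close>
  obtain z2 where z2: "(y [^] q \<otimes> u) [^] m = z2 \<otimes> ((y [^] q) [^] m \<otimes> u [^] m)"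
    "scaled_word D (i + 1 + i) R 108 z2"
    using scaled_word_mult_pow[OF wyq wu, of m] i Rr[OF m] by auto
  have z2': "scaled_word D (i + 2) R 108 z2"
    using z2(2) i by (auto intro: scaled_word_mono)
  have zs: "z1 \<in> carrier G" "z2 \<in> carrier G" using z1' z2' scaled_word_closed by blast+
  have "g [^] l = x [^] q \<otimes> u [^] l \<otimes> inv (x [^] q)" for l :: nat
    by (induction l) (use x uc in \<open>auto simp: g_def word_simps\<close>)
  then have "commutator (x [^] q) (u [^] m) = g [^] m \<otimes> inv (u [^] m)"
    by (simp add: commutator_def)
  also have "\<dots> = (z1 \<otimes> z2) \<otimes> y [^] (q * m)"
    using z1(1) z2(1) zs yc uc by (simp add: word_simps nat_pow_pow)
  \<comment> \<open>The masses of z1 and z2 add up to 216, within the stated 432.\<close>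
  finally show ?thesis
    using scaled_word_mult[OF z1' z2'] by (intro exI[of _ "z1 \<otimes> z2"]) (auto intro: weighted_word_mono_mass)
qed

text \<open>For \<open>y = [x, u]\<close> with \<open>u\<close> of weight \<open>i - 1\<close> the exponent \<open>n \<le> R\<^sup>i\<close> can be split between \<open>x\<close> and
  \<open>u\<close>, which makes \<open>y\<^sup>n\<close> short at the expense of a correction \<open>z\<close> of greater weight.\<close>
definition short_powers :: "nat \<Rightarrow> 'a \<Rightarrow> bool" where
  "short_powers i y \<longleftrightarrow> (\<exists>D C. \<forall>R n. 1 \<le> R \<longrightarrow> n \<le> R ^ i \<longrightarrow>
     (\<exists>z. scaled_word D (i + 1) R C z \<and> real (wl (z \<otimes> y [^] n)) \<le> C * real R))"

text \<open>The letter radius can be enlarged at will, so that several facts of this kind can be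
  used with a common \<open>D\<close>. The sign of \<open>C\<close> follows from the word obtained
  for R = 1 and n = 0.\<close>

lemma short_powersE:
  assumes "short_powers i y"
  obtains D0 C where "0 \<le> C" "\<And>D R n. D0 \<le> D \<Longrightarrow> 1 \<le> R \<Longrightarrow> n \<le> R ^ i \<Longrightarrow>
     \<exists>z. scaled_word D (i + 1) R C z \<and> real (wl (z \<otimes> y [^] n)) \<le> C * real R"
proof -
  from assms obtain D0 C where C: "\<And>R n. 1 \<le> R \<Longrightarrow> n \<le> R ^ i \<Longrightarrow>
     \<exists>z. scaled_word D0 (i + 1) R C z \<and> real (wl (z \<otimes> y [^] n)) \<le> C * real R"
    unfolding short_powers_def by blast
  have "0 \<le> C" using C[of 1 0] scaled_word_nonneg by auto
  moreover have "\<exists>z. scaled_word D (i + 1) R C z \<and> real (wl (z \<otimes> y [^] n)) \<le> C * real R"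
    if "D0 \<le> D" "1 \<le> R" "n \<le> R ^ i" for D R n
    using C[OF that(2,3)] scaled_word_mono[OF _ that(1), of "i + 1" R C _ "i + 1" C] by blast
  ultimately show ?thesis using that by blast
qed

lemma scaled_word_pow_le_one:
  assumes "y \<in> lcs i" "wl y \<le> D" "n \<le> R ^ i"
  shows "scaled_word D i R 1 (y [^] n)"
\<comment> \<open>For R = 0 the scale 1 / R is 0 as well, and \<open>R ^ i\<close> cancels against
  its power only if i = 0; for positive i the exponent n must be 0.\<close>
proof (cases "R = 0 \<and> i > 0")
  case True
  then show ?thesis using assms by (auto intro: weighted_word.one simp: power_0_left)
next
  case False
  have "real n * (1 / real R) ^ i \<le> real (R ^ i) * (1 / real R) ^ i"
    using assms(3) by (intro mult_right_mono) (simp_all flip: of_nat_power)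
  also have "\<dots> = 1" using False by (auto simp: power_divide)
  finally show ?thesis
    using scaled_word_pow[OF scaled_word_letter'[OF assms(1,2), of R], of n]
    by (auto intro: weighted_word_mono_mass)
qed

lemma short_powers_1:
  assumes "y \<in> carrier G"
  shows "short_powers 1 y"
  unfolding short_powers_def
proof (intro exI allI impI)
  fix R n :: nat assume "n \<le> R ^ 1"
  have "wl (y [^] n) \<le> n * wl y" using assms by (rule word_length_pow)
  also have "\<dots> \<le> R * wl y" using \<open>n \<le> R ^ 1\<close> by simp
  finally have "real (wl (y [^] n)) \<le> real (wl y) * real R"
    by (metis mult.commute of_nat_le_iff of_nat_mult)
  then show "scaled_word 0 (1 + 1) R (real (wl y)) \<one> \<and> real (wl (\<one> \<otimes> y [^] n)) \<le> real (wl y) * real R"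
    using assms by (auto intro: weighted_word.one)
qed

lemma short_powers_one: "short_powers i \<one>"
  unfolding short_powers_def
  by (intro exI[of _ 0] allI impI exI[of _ \<one>]) (auto intro: weighted_word.one)

lemma short_powers_inv:
  assumes "short_powers i y" "y \<in> lcs i" "1 \<le> i"
  shows "short_powers i (inv y)"
proof -
  obtain D0 C where C: "0 \<le> C" "\<And>D R n. D0 \<le> D \<Longrightarrow> 1 \<le> R \<Longrightarrow> n \<le> R ^ i \<Longrightarrow>
     \<exists>z. scaled_word D (i + 1) R C z \<and> real (wl (z \<otimes> y [^] n)) \<le> C * real R"
    using short_powersE[OF assms(1)] by metis
  define D where "D = D0 + wl y"
  have yc: "y \<in> carrier G" using assms(2) by (rule lcs_carrier)
  show ?thesis
    unfolding short_powers_def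
  proof (rule exI, rule exI, intro allI impI)
    fix R n :: nat assume R: "1 \<le> R" and n: "n \<le> R ^ i"
    obtain z where z: "scaled_word D (i + 1) R C z" "real (wl (z \<otimes> y [^] n)) \<le> C * real R"
      using C(2)[of D R n] R n by (auto simp: D_def)
    have zc: "z \<in> carrier G" using z(1) scaled_word_closed by blast
    \<comment> \<open>Chosen so that its product with y^-n is the inverse of z y^n, which is
      short.\<close>
    let ?z = "inv (y [^] n) \<otimes> inv z \<otimes> inv (inv (y [^] n))"
    have "scaled_word D i R 1 (inv (y [^] n))"
      using scaled_word_pow_le_one[of y i D n R] assms n by (intro scaled_word_inv) (simp add: D_def)
    then have "scaled_word D (i + 1) R (exp 1 * C) ?z"
      using scaled_word_inv[OF z(1)] by (rule scaled_word_conj) (use assms in auto)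
    moreover have "?z \<otimes> inv y [^] n = inv (z \<otimes> y [^] n)"
      using yc zc by (simp add: word_simps nat_pow_inv)
    moreover have "wl (inv (z \<otimes> y [^] n)) \<le> wl (z \<otimes> y [^] n)"
      using yc zc by (intro word_length_inv) auto
    moreover have "1 * (C * real R) \<le> exp 1 * (C * real R)"
      using C(1) by (intro mult_right_mono) auto
    ultimately show "\<exists>z. scaled_word D (i + 1) R (exp 1 * C) z \<and> real (wl (z \<otimes> inv y [^] n)) \<le> exp 1 * C * real R"
      using z(2) by (intro exI[of _ ?z]) auto
  qed
qed

text \<open>The n-th power of the product is y^n y'^n up to a factor of weight 2 i, which is at
  least i + 1. So the short word (z1 y^n) (z2 y'^n) differs from it by an admissible correction,
  once z2 has been conjugated by y^n.\<close>

lemma short_powers_mult: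
  assumes "short_powers i y" "short_powers i y'" "y \<in> lcs i" "y' \<in> lcs i" "1 \<le> i"
  shows "short_powers i (y \<otimes> y')"
proof -
  obtain D1 C1 where C1: "0 \<le> C1" "\<And>D R n. D1 \<le> D \<Longrightarrow> 1 \<le> R \<Longrightarrow> n \<le> R ^ i \<Longrightarrow>
     \<exists>z. scaled_word D (i + 1) R C1 z \<and> real (wl (z \<otimes> y [^] n)) \<le> C1 * real R"
    using short_powersE[OF assms(1)] by metis
  obtain D2 C2 where C2: "0 \<le> C2" "\<And>D R n. D2 \<le> D \<Longrightarrow> 1 \<le> R \<Longrightarrow> n \<le> R ^ i \<Longrightarrow>
     \<exists>z. scaled_word D (i + 1) R C2 z \<and> real (wl (z \<otimes> y' [^] n)) \<le> C2 * real R"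
    using short_powersE[OF assms(2)] by metis
  define D where "D = D1 + D2 + wl y + wl y'"
  have yc: "y \<in> carrier G" "y' \<in> carrier G" using assms(3,4) by (auto intro: lcs_carrier)
  let ?C = "C1 + exp 1 * C2 + 108 + C2"
  show ?thesis
    unfolding short_powers_def
  proof (rule exI, rule exI, intro allI impI)
    fix R n :: nat assume R: "1 \<le> R" and n: "n \<le> R ^ i"
    obtain z1 where z1: "scaled_word D (i + 1) R C1 z1" "real (wl (z1 \<otimes> y [^] n)) \<le> C1 * real R"
      using C1(2)[of D R n] R n by (auto simp: D_def)
    obtain z2 where z2: "scaled_word D (i + 1) R C2 z2" "real (wl (z2 \<otimes> y' [^] n)) \<le> C2 * real R"
      using C2(2)[of D R n] R n by (auto simp: D_def)
    have zc: "z1 \<in> carrier G" "z2 \<in> carrier G" using z1(1) z2(1) scaled_word_closed by blast+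
    have rr: "real n * (1 / real R) ^ i \<le> 1"
    proof -
      have "real n * (1 / real R) ^ i \<le> real (R ^ i) * (1 / real R) ^ i"
        using n by (intro mult_right_mono) (simp_all flip: of_nat_power)
      then show ?thesis using R by (simp add: power_divide)
    qed
    obtain z3 where z3: "(y \<otimes> y') [^] n = z3 \<otimes> (y [^] n \<otimes> y' [^] n)" "scaled_word D (i + i) R 108 z3"
      using scaled_word_mult_pow[OF scaled_word_letter' scaled_word_letter', of y i D y' i n R] assms rr
      by (auto simp: D_def)
    have z3c: "z3 \<in> carrier G" using z3(2) scaled_word_closed by blast
    have z3': "scaled_word D (i + 1) R 108 (inv z3)"
      using scaled_word_mono[OF scaled_word_inv[OF z3(2)], of D "i + 1" 108] assms by simp
    have "scaled_word D i R 1 (y [^] n)"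
      using scaled_word_pow_le_one[of y i D n R] assms n by (simp add: D_def)
    then have "scaled_word D (i + 1) R (exp 1 * C2) (y [^] n \<otimes> z2 \<otimes> inv (y [^] n))"
      using z2(1) by (rule scaled_word_conj) (use assms in auto)
    then have "scaled_word D (i + 1) R (C1 + exp 1 * C2 + 108)
        (z1 \<otimes> (y [^] n \<otimes> z2 \<otimes> inv (y [^] n)) \<otimes> inv z3)"
      using z1(1) z3' by (intro scaled_word_mult)
    then have "scaled_word D (i + 1) R ?C (z1 \<otimes> (y [^] n \<otimes> z2 \<otimes> inv (y [^] n)) \<otimes> inv z3)"
      using C2(1) by (auto intro: weighted_word_mono_mass)
    moreover have "(z1 \<otimes> (y [^] n \<otimes> z2 \<otimes> inv (y [^] n)) \<otimes> inv z3) \<otimes> (y \<otimes> y') [^] n =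
        (z1 \<otimes> y [^] n) \<otimes> (z2 \<otimes> y' [^] n)"
      using yc zc z3c by (simp add: z3(1) word_simps)
    moreover have "wl ((z1 \<otimes> y [^] n) \<otimes> (z2 \<otimes> y' [^] n)) \<le> wl (z1 \<otimes> y [^] n) + wl (z2 \<otimes> y' [^] n)"
      using yc zc by (intro word_length_mult) auto
    moreover have "0 \<le> exp 1 * C2 * real R" using C2(1) by simp
    ultimately show "\<exists>z. scaled_word D (i + 1) R ?C z \<and> real (wl (z \<otimes> (y \<otimes> y') [^] n)) \<le> ?C * real R"
      using z1(2) z2(2)
      by (intro exI[of _ "z1 \<otimes> (y [^] n \<otimes> z2 \<otimes> inv (y [^] n)) \<otimes> inv z3"]) (auto simp: distrib_right)
  qed
qed

text \<open>The element [x^q, z0 u^m] is short, because x^q has length O(R) and z0 u^m is short by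
  assumption. Up to factors of greater weight it equals [x^q, u^m], hence y^(q m), where q m may be
  as large as R^(i+1).\<close>

lemma short_powers_commutator:
  assumes "short_powers i u" "u \<in> lcs i" "1 \<le> i" "x \<in> carrier G"
  shows "short_powers (i + 1) (commutator x u)"
proof -
  obtain D0 C where C: "0 \<le> C" "\<And>D R n. D0 \<le> D \<Longrightarrow> 1 \<le> R \<Longrightarrow> n \<le> R ^ i \<Longrightarrow>
     \<exists>z. scaled_word D (i + 1) R C z \<and> real (wl (z \<otimes> u [^] n)) \<le> C * real R"
    using short_powersE[OF assms(1)] by metis
  define y where "y = commutator x u"
  define D where "D = D0 + wl x + wl u + wl y"
  have uc: "u \<in> carrier G" using assms(2) by (rule lcs_carrier)
  have yl: "y \<in> lcs (i + 1)"
    using commutator_lcs[of x 1 u i] assms by (simp add: y_def lcs_def add.commute)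
  have yc: "y \<in> carrier G" using yl by (rule lcs_carrier)
  \<comment> \<open>The first term bounds the masses of [x^q, z0] and [z0, y^(q m)], at most 2 exp C
    each; the second is the mass 432 of z1 after conjugation by z0; the last two bound the length of
    [x^q, z0 u^m] divided by R.\<close>
  define C' where "C' = 4 * exp C + exp C * 432 + 2 * real (wl x) + 2 * C"
  have step: "\<exists>z. scaled_word D (i + 2) R C' z \<and> real (wl (z \<otimes> y [^] (q * m))) \<le> C' * real R"
    if R: "1 \<le> R" and q: "q \<le> R" and m: "m \<le> R ^ i" for R q m :: nat
  proof -
    obtain z0 where z0: "scaled_word D (i + 1) R C z0" "real (wl (z0 \<otimes> u [^] m)) \<le> C * real R"
      using C(2)[of D R m] R m by (auto simp: D_def)
    obtain z1 where z1: "commutator (x [^] q) (u [^] m) = z1 \<otimes> y [^] (q * m)" "scaled_word D (i + 2) R 432 z1"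
      using scaled_word_commutator_pow[of x u i y D R q m] assms R q m y_def by (auto simp: D_def)
    have zc: "z0 \<in> carrier G" "z1 \<in> carrier G" using z0(1) z1(2) scaled_word_closed by blast+
    have wx: "scaled_word D 1 R 1 (x [^] q)"
      using scaled_word_pow_le_one[of x 1 D q R] assms q by (simp add: D_def lcs_def)
    have "q * m \<le> R ^ (i + 1)" using q m by (simp add: mult_mono)
    then have wy: "scaled_word D (i + 1) R 1 (y [^] (q * m))"
      using scaled_word_pow_le_one[of y "i + 1" D "q * m" R] yl by (simp add: D_def)
    have e: "(exp 1 - 1) * (exp C - 1) \<le> 2 * exp C" "(exp C - 1) * (exp 1 - 1) \<le> exp C * 2"
      using exp_le C(1) by (auto intro!: mult_mono)
    have a: "scaled_word D (i + 2) R (2 * exp C) (commutator (x [^] q) z0)"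
      using scaled_word_commutator[OF wx z0(1)] e(1) assms by (auto intro: weighted_word_mono_mass)
    have b: "scaled_word D (i + 2) R (exp C * 432) (z0 \<otimes> z1 \<otimes> inv z0)"
      using z0(1) z1(2) by (rule scaled_word_conj) (use assms in auto)
    have "scaled_word D (i + 1 + (i + 1)) R ((exp C - 1) * (exp 1 - 1)) (commutator z0 (y [^] (q * m)))"
      using z0(1) wy by (rule scaled_word_commutator) (use assms in auto)
    then have c: "scaled_word D (i + 2) R (exp C * 2) (commutator z0 (y [^] (q * m)))"
      by (rule scaled_word_mono) (use e assms in auto)
    \<comment> \<open>Expanding [x^q, z0 u^m] yields [x^q, z0] times the conjugate by z0 of z1 y^(q
      m); the last factor of \<open>?z\<close> extracts y^(q m) from this conjugate.\<close>
    let ?z = "commutator (x [^] q) z0 \<otimes> (z0 \<otimes> z1 \<otimes> inv z0) \<otimes> commutator z0 (y [^] (q * m))"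
    have "scaled_word D (i + 2) R (2 * exp C + exp C * 432 + exp C * 2) ?z"
      using a b c by (intro scaled_word_mult)
    then have z: "scaled_word D (i + 2) R C' ?z"
      using C(1) by (auto simp: C'_def intro: weighted_word_mono_mass)
    have "commutator (x [^] q) (z0 \<otimes> u [^] m) =
        commutator (x [^] q) z0 \<otimes> (z0 \<otimes> commutator (x [^] q) (u [^] m) \<otimes> inv z0)"
      using assms uc zc by (simp add: commutator_mult_right)
    also have "\<dots> = ?z \<otimes> y [^] (q * m)"
      using assms uc zc yc unfolding z1(1) by (simp add: commutator_def word_simps)
    finally have eq: "?z \<otimes> y [^] (q * m) = commutator (x [^] q) (z0 \<otimes> u [^] m)" by simp
    have "wl (commutator (x [^] q) (z0 \<otimes> u [^] m)) \<le> 2 * wl (x [^] q) + 2 * wl (z0 \<otimes> u [^] m)"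
      using assms uc zc by (intro word_length_commutator) auto
    moreover have "wl (x [^] q) \<le> R * wl x"
      using order_trans[OF word_length_pow[OF assms(4)] mult_le_mono1[OF q]] .
    moreover from this have "real (wl (x [^] q)) \<le> real (wl x) * real R"
      by (metis mult.commute of_nat_le_iff of_nat_mult)
    moreover have "(2 * real (wl x) + 2 * C) * real R \<le> C' * real R"
      using C(1) by (intro mult_right_mono) (auto simp: C'_def)
    ultimately have "real (wl (?z \<otimes> y [^] (q * m))) \<le> C' * real R"
      using z0(2) unfolding eq by (simp add: algebra_simps)
    with z show ?thesis by blast
  qed
  have C'0: "0 \<le> C'" using C(1) by (simp add: C'_def)
  show ?thesis
    unfolding short_powers_def y_def[symmetric]
  proof (rule exI, rule exI, intro allI impI)
    fix R n :: nat assume R: "1 \<le> R" and n: "n \<le> R ^ (i + 1)"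
    \<comment> \<open>Not every n is a product q m with q at most R and m at most R^i, but both
      summands of n = (n div R^i) R^i + 1 (n mod R^i) are.\<close>
    let ?m = "R ^ i"
    have "n div ?m \<le> R" using n R div_le_mono[OF n, of ?m] by simp
    then obtain z1 where z1: "scaled_word D (i + 2) R C' z1"
      "real (wl (z1 \<otimes> y [^] (n div ?m * ?m))) \<le> C' * real R"
      using step[OF R, of "n div ?m" ?m] by blast
    have "n mod ?m \<le> ?m" using R by (simp add: order_less_imp_le)
    then obtain z2 where z2: "scaled_word D (i + 2) R C' z2"
      "real (wl (z2 \<otimes> y [^] (1 * (n mod ?m)))) \<le> C' * real R"
      using step[OF R R, of "n mod ?m"] by blast
    let ?a = "n div ?m * ?m" and ?b = "n mod ?m"
    have ab: "?a + ?b = n" by (rule div_mult_mod_eq)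
    have "?a \<le> R ^ (i + 1)" using n ab by linarith
    then have "scaled_word D (i + 1) R 1 (y [^] ?a)"
      by (rule scaled_word_pow_le_one[OF yl, rotated]) (simp add: D_def)
    then have "scaled_word D (i + 2) R (exp 1 * C') (y [^] ?a \<otimes> z2 \<otimes> inv (y [^] ?a))"
      using z2(1) by (rule scaled_word_conj) (use assms in auto)
    then have z: "scaled_word D (i + 2) R (C' + exp 1 * C') (z1 \<otimes> (y [^] ?a \<otimes> z2 \<otimes> inv (y [^] ?a)))"
      using z1(1) by (intro scaled_word_mult)
    have zc: "z1 \<in> carrier G" "z2 \<in> carrier G" using z1(1) z2(1) scaled_word_closed by blast+
    have "y [^] n = y [^] ?a \<otimes> y [^] ?b" using nat_pow_mult[OF yc, of ?a ?b] unfolding ab by (rule sym)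
    then have "z1 \<otimes> (y [^] ?a \<otimes> z2 \<otimes> inv (y [^] ?a)) \<otimes> y [^] n = (z1 \<otimes> y [^] ?a) \<otimes> (z2 \<otimes> y [^] ?b)"
      using zc yc by (simp add: word_simps)
    moreover have "wl ((z1 \<otimes> y [^] ?a) \<otimes> (z2 \<otimes> y [^] ?b)) \<le> wl (z1 \<otimes> y [^] ?a) + wl (z2 \<otimes> y [^] ?b)"
      using zc yc by (intro word_length_mult) auto
    moreover have "1 * (C' * real R) \<le> exp 1 * (C' * real R)"
      using C'0 by (intro mult_right_mono) auto
    ultimately have "real (wl (z1 \<otimes> (y [^] ?a \<otimes> z2 \<otimes> inv (y [^] ?a)) \<otimes> y [^] n)) \<le> (C' + exp 1 * C') * real R"
      using z1(2) z2(2) by (simp add: distrib_right)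
    with z show "\<exists>z. scaled_word D (i + 1 + 1) R (C' + exp 1 * C') z \<and>
        real (wl (z \<otimes> y [^] n)) \<le> (C' + exp 1 * C') * real R"
      by auto
  qed
qed

text \<open>The terms of the series are generated by commutators with elements of the preceding
  term, and the property survives commutators, inverses and products.\<close>

lemma short_powers_lcs:
  assumes "1 \<le> i" "y \<in> lcs i"
  shows "short_powers i y"
  using assms
proof (induction i arbitrary: y rule: nat_induct_at_least)
  case base
  then show ?case using short_powers_1 lcs_carrier by blast
next
  case (Suc i)
  have sub: "{commutator x u |x u. x \<in> carrier G \<and> u \<in> lower_central G (i - 1)} \<subseteq> carrier G"
    by (auto dest: lower_central_carrier)
  have eq: "lcs (Suc i) = generate G {commutator x u |x u. x \<in> carrier G \<and> u \<in> lower_central G (i - 1)}"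
    using Suc.hyps lower_central_Suc[of "i - 1"] by (simp add: lcs_def)
  have gen: "short_powers (Suc i) h"
    if "h \<in> {commutator x u |x u. x \<in> carrier G \<and> u \<in> lower_central G (i - 1)}" for h
    using that short_powers_commutator[of i] Suc by (auto simp: lcs_def)
  have "y \<in> generate G {commutator x u |x u. x \<in> carrier G \<and> u \<in> lower_central G (i - 1)}"
    using Suc.prems eq by simp
  then show ?case
  proof induction
    case one
    show ?case by (rule short_powers_one)
  next
    case (incl h)
    then show ?case by (rule gen)
  next
    case (inv h)
    then show ?case
      using gen[OF inv] short_powers_inv[of "Suc i" h] generate.incl[OF inv, of G] eq by simp
  next
    case (eng h1 h2)
    then show ?case using short_powers_mult eq by auto
  qed
qed

text \<open>One inclusion of a ball-box comparison: the box of elements written with O(R^k) letters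
  of each weight k from \<open>j\<close> on lies in a ball of radius O(R).\<close>

definition linear_length :: "nat \<Rightarrow> bool" where
  "linear_length j \<longleftrightarrow> (\<forall>D C. \<exists>K\<ge>0. \<forall>R x. 1 \<le> R \<longrightarrow> scaled_word D j R C x \<longrightarrow> real (wl x) \<le> K * real R)"

text \<open>The two inductions meet here: the correction z given by \<open>short_powers_lcs\<close>
  has weight j + 1 and is short by assumption, and t^n = z^-1 (z t^n).\<close>

lemma linear_length_powers:
  assumes "linear_length (j + 1)" "1 \<le> j" "t \<in> lcs j"
  shows "\<exists>K\<ge>0. \<forall>R n. 1 \<le> R \<longrightarrow> n \<le> R ^ j \<longrightarrow> real (wl (t [^] n)) \<le> K * real R"
proof -
  have tc: "t \<in> carrier G" using assms(3) by (rule lcs_carrier)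
  obtain D C where C: "0 \<le> C" "\<And>R n. 1 \<le> R \<Longrightarrow> n \<le> R ^ j \<Longrightarrow>
     \<exists>z. scaled_word D (j + 1) R C z \<and> real (wl (z \<otimes> t [^] n)) \<le> C * real R"
    using short_powersE[OF short_powers_lcs[OF assms(2,3)]] by (metis order_refl)
  obtain K where K: "0 \<le> K" "\<And>R x. 1 \<le> R \<Longrightarrow> scaled_word D (j + 1) R C x \<Longrightarrow> real (wl x) \<le> K * real R"
    using assms(1) unfolding linear_length_def by metis
  have "real (wl (t [^] n)) \<le> (K + C) * real R" if R: "1 \<le> R" and n: "n \<le> R ^ j" for R n
  proof -
    obtain z where z: "scaled_word D (j + 1) R C z" "real (wl (z \<otimes> t [^] n)) \<le> C * real R"
      using C(2)[OF R n] by blast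
    have zc: "z \<in> carrier G" using z(1) scaled_word_closed by blast
    have "wl (t [^] n) = wl (inv z \<otimes> (z \<otimes> t [^] n))"
      using zc tc by (simp add: word_simps)
    also have "\<dots> \<le> wl (inv z) + wl (z \<otimes> t [^] n)"
      using zc tc by (intro word_length_mult) auto
    also have "wl (inv z) \<le> wl z" using zc by (rule word_length_inv)
    finally show ?thesis using K(2)[OF R z(1)] z(2) by (simp add: distrib_right)
  qed
  then show ?thesis using K(1) C(1) by (intro exI[of _ "K + C"]) auto
qed

text \<open>The exponent is cut into at most C blocks of size R^j and a remainder.\<close>

lemma linear_length_powers':
  assumes "linear_length (j + 1)" "1 \<le> j" "t \<in> lcs j" "0 \<le> C"
  shows "\<exists>K\<ge>0. \<forall>R n. 1 \<le> R \<longrightarrow> real n * (1 / real R) ^ j \<le> C \<longrightarrow> real (wl (t [^] n)) \<le> K * real R"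
proof -
  have tc: "t \<in> carrier G" using assms(3) by (rule lcs_carrier)
  obtain K where K: "0 \<le> K" "\<And>R n. 1 \<le> R \<Longrightarrow> n \<le> R ^ j \<Longrightarrow> real (wl (t [^] n)) \<le> K * real R"
    using linear_length_powers[OF assms(1-3)] by metis
  have "real (wl (t [^] n)) \<le> (C + 1) * K * real R" if R: "1 \<le> R" and n: "real n * (1 / real R) ^ j \<le> C" for R n
  proof -
    let ?m = "R ^ j"
    have nC: "real n \<le> C * real ?m"
      using n R by (simp add: power_divide divide_le_eq)
    have "real (n div ?m) * real ?m \<le> real n"
      by (metis div_times_less_eq_dividend of_nat_le_iff of_nat_mult)
    with nC have "real (n div ?m) * real ?m \<le> C * real ?m" by linarith
    then have dC: "real (n div ?m) \<le> C" using R by simp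
    have "t [^] n = (t [^] ?m) [^] (n div ?m) \<otimes> t [^] (n mod ?m)"
      using tc by (simp add: nat_pow_pow nat_pow_mult)
    then have "wl (t [^] n) \<le> wl ((t [^] ?m) [^] (n div ?m)) + wl (t [^] (n mod ?m))"
      using tc word_length_mult by simp
    also have "wl ((t [^] ?m) [^] (n div ?m)) \<le> n div ?m * wl (t [^] ?m)"
      using tc by (intro word_length_pow) auto
    finally have "real (wl (t [^] n)) \<le> real (n div ?m) * real (wl (t [^] ?m)) + real (wl (t [^] (n mod ?m)))"
      by (simp flip: of_nat_mult of_nat_add)
    also have "\<dots> \<le> C * (K * real R) + K * real R"
      using dC K(2)[OF R, of ?m] K(2)[OF R, of "n mod ?m"] R assms(4)
      by (intro add_mono mult_mono) (auto simp: order_less_imp_le)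
    finally show ?thesis by (simp add: algebra_simps)
  qed
  then show ?thesis using K(1) assms(4) by (intro exI[of _ "(C + 1) * K"]) auto
qed

text \<open>The finitely many letters of weight j are removed in turn by
  \<open>weighted_word_collect\<close>. A commutator with such a letter has weight above j, so no
  letter of weight j is created. Each removal replaces the mass C by \<open>C * exp C\<close> and
  splits off a power t^p with p = O(R^j), which is short.\<close>

lemma linear_length_step:
  assumes H: "linear_length (j + 1)" and j: "1 \<le> j"
  shows "linear_length j"
proof -
  \<comment> \<open>The set \<open>Q\<close> interpolates between the two alphabets: it is empty for
    the letters of weight at least j + 1, and \<open>letter_ball D j j\<close> for those of weight
    at least j.\<close>
  let ?fam = "\<lambda>D Q k. if k = j then Q else letter_ball D (j + 1) k"
  have fam: "\<exists>K\<ge>0. \<forall>R x. 1 \<le> R \<longrightarrow> weighted_word (?fam D Q) (1 / real R) C x \<longrightarrow> real (wl x) \<le> K * real R"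
    if "finite Q" "Q \<subseteq> letter_ball D j j" for D Q C
    using that
  proof (induction Q arbitrary: C)
    case empty
    obtain K where "0 \<le> K" "\<And>R x. 1 \<le> R \<Longrightarrow> scaled_word D (j + 1) R C x \<Longrightarrow> real (wl x) \<le> K * real R"
      using H unfolding linear_length_def by metis
    moreover have "?fam D {} = letter_ball D (j + 1)"
      by (rule ext) (auto simp: letter_ball_def)
    ultimately show ?case by auto
  next
    case (insert t Q)
    show ?case
    proof (cases "0 \<le> C")
      case False
      then have "\<not> weighted_word (?fam D (insert t Q)) (1 / real R) C x" for R x
        using weighted_word_nonneg[of "?fam D (insert t Q)" "1 / real R" C x] by auto
      then show ?thesis by (intro exI[of _ 0]) auto
    next
      case True
      have t: "t \<in> letter_ball D j j" using insert.prems by simp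
      have tl: "t \<in> lcs j" using t by (simp add: letter_ball_def)
      have tc: "t \<in> carrier G" using tl by (rule lcs_carrier)
      have famc: "?fam D Q k \<subseteq> carrier G" for k
        using insert.prems letter_ball_carrier[of D] by (auto split: if_splits)
      obtain K1 where K1: "0 \<le> K1" "\<And>R x. 1 \<le> R \<Longrightarrow>
          weighted_word (?fam D Q) (1 / real R) (C * exp C) x \<Longrightarrow> real (wl x) \<le> K1 * real R"
        using insert.IH[of "C * exp C"] insert.prems by auto
      obtain K2 where K2: "0 \<le> K2" "\<And>R n. 1 \<le> R \<Longrightarrow> real n * (1 / real R) ^ j \<le> C \<Longrightarrow>
          real (wl (t [^] n)) \<le> K2 * real R"
        using linear_length_powers'[OF H j tl True] by metis
      have "real (wl x) \<le> (K1 + K2) * real R"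
        if R: "1 \<le> R" and x: "weighted_word (?fam D (insert t Q)) (1 / real R) C x" for R x
      proof -
        have "\<exists>(p::nat) z. x = z \<otimes> t [^] p \<and> weighted_word (?fam D Q) (1 / real R) (C * exp C) z \<and>
            real p * (1 / real R) ^ j \<le> C"
        proof (rule weighted_word_collect[OF x])
          fix k b assume b: "b \<in> ?fam D Q k"
          then have "b \<in> letter_ball D j k"
            using insert.prems letter_ball_mono[of D D j "j + 1" k] by (auto split: if_splits)
          then have "1 \<le> k" "commutator t b \<in> letter_ball D (j + j) (j + k)"
            using commutator_letter_ball[OF t _ j j] j by (auto simp: letter_ball_def split: if_splits)
          then show "commutator t b \<in> ?fam D Q (k + j)"
            using letter_ball_mono[of D D "j + 1" "j + j" "k + j"] j by (auto simp: add.commute)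
        qed (use tc famc in \<open>auto split: if_splits\<close>)
        then obtain p z where p: "x = z \<otimes> t [^] (p::nat)" "weighted_word (?fam D Q) (1 / real R) (C * exp C) z"
          "real p * (1 / real R) ^ j \<le> C" by blast
        have "z \<in> carrier G" using p(2) famc by (rule weighted_word_closed)
        then have "wl x \<le> wl z + wl (t [^] p)"
          using p(1) tc word_length_mult by auto
        then show ?thesis using K1(2)[OF R p(2)] K2(2)[OF R p(3)] by (simp add: distrib_right)
      qed
      then show ?thesis using K1(1) K2(1) by (intro exI[of _ "K1 + K2"]) auto
    qed
  qed
  show ?thesis
    unfolding linear_length_def
  proof (intro allI)
    fix D C
    have "?fam D (letter_ball D j j) = letter_ball D j"
      by (rule ext) (auto simp: letter_ball_def)
    then show "\<exists>K\<ge>0. \<forall>R x. 1 \<le> R \<longrightarrow> scaled_word D j R C x \<longrightarrow> real (wl x) \<le> K * real R"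
      using fam[OF finite_letter_ball order_refl, of D C] by simp
  qed
qed

lemma linear_length_nilpotent:
  assumes "nilpotent G" "1 \<le> j"
  shows "linear_length j"
proof -
  obtain c where c: "lower_central G c = {\<one>}"
    using assms(1) by (auto simp: nilpotent_def)
  show ?thesis
    using assms(2)
  \<comment> \<open>Descending induction on j. A letter of weight k lies in the term with index k -
    1 of the series, so it is trivial from weight c + 1 on.\<close>
  proof (induction "Suc c - j" arbitrary: j)
    case 0
    have lb: "letter_ball D j k \<subseteq> {\<one>}" for D k
    proof (cases "j \<le> k")
      case True
      then have "lcs k \<subseteq> {\<one>}"
        unfolding lcs_def c[symmetric] using 0 by (intro lower_central_antimono) linarith
      then show ?thesis by (auto simp: letter_ball_def)
    qed (simp add: letter_ball_def)
    have "x = \<one>" if "scaled_word D j R C x" for D R C x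
      using that
    proof induction
      case (step y k c x d)
      then show ?case using lb[of D k] by auto
    qed simp
    then show ?case
      unfolding linear_length_def by (metis less_eq_real_def mult_zero_left of_nat_0 word_length_one)
  next
    case (Suc d)
    then have "linear_length (j + 1)" by auto
    then show ?case using Suc.prems by (rule linear_length_step)
  qed
qed

text \<open>The elements of \<open>F\<close> are letters of weight 2 and mass R^-2, so a word of n
  of them has mass at most 1 as soon as R is at least sqrt n, and its length is O(R).\<close>

lemma commutator_subgroup_distortion:
  assumes "nilpotent G" "finite F" "F \<subseteq> lower_central G 1"
  shows "\<exists>K\<ge>0. \<forall>ws. set ws \<subseteq> F \<longrightarrow> real (wl (word_prod ws)) \<le> K * (sqrt (length ws) + 2)"
proof -
  define D where "D = (\<Sum>f\<in>F. wl f)"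
  have F: "f \<in> lcs 2" "wl f \<le> D" if "f \<in> F" for f
    using that assms member_le_sum[of f F wl] by (auto simp: lcs_def D_def)
  obtain K where K: "0 \<le> K" "\<And>R x. 1 \<le> R \<Longrightarrow> scaled_word D 2 R 1 x \<Longrightarrow> real (wl x) \<le> K * real R"
    using linear_length_nilpotent[OF assms(1), of 2, simplified] unfolding linear_length_def by metis
  have "real (wl (word_prod ws)) \<le> K * (sqrt (length ws) + 2)" if ws: "set ws \<subseteq> F" for ws
  proof -
    \<comment> \<open>Adding 1 keeps the scale positive for the empty word; together with the
      rounding it causes the 2 in the bound.\<close>
    define R where "R = nat \<lceil>sqrt (length ws)\<rceil> + 1"
    have R: "1 \<le> R" "sqrt (length ws) \<le> real R" "real R \<le> sqrt (length ws) + 2"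
      by (auto simp: R_def) linarith+
    have "scaled_word D 2 R (real (length ws) * (1 / real R) ^ 2) (word_prod ws)"
      using ws
    proof (induction ws)
      case (Cons f ws)
      have "scaled_word D 2 R ((1 / real R) ^ 2) f"
        using scaled_word_letter'[of f 2 D R] F Cons.prems by auto
      then have "scaled_word D 2 R ((1 / real R) ^ 2 + real (length ws) * (1 / real R) ^ 2) (f \<otimes> word_prod ws)"
        using Cons by (intro scaled_word_mult) auto
      then show ?case by (simp add: algebra_simps)
    qed (auto intro: weighted_word.one)
    moreover have "real (length ws) * (1 / real R) ^ 2 \<le> 1"
    proof -
      have "real (length ws) \<le> (real R) ^ 2"
        using power_mono[OF R(2), of 2] by simp
      then show ?thesis using R(1) by (simp add: power_divide divide_le_eq)
    qed
    ultimately have "scaled_word D 2 R 1 (word_prod ws)"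
      by (rule weighted_word_mono_mass)
    then have "real (wl (word_prod ws)) \<le> K * real R"
      by (rule K(2)[OF R(1)])
    also have "\<dots> \<le> K * (sqrt (length ws) + 2)"
      using R(3) K(1) by (rule mult_left_mono)
    finally show ?thesis .
  qed
  then show ?thesis using K(1) by blast
qed

end

section \<open>Quasimorphisms on nilpotent groups\<close>

lemma multiples_bounded_imp_zero:
  fixes d C :: real
  assumes "\<And>n::nat. real n * \<bar>d\<bar> \<le> C"
  shows "d = 0"
proof (rule ccontr)
  assume "d \<noteq> 0"
  then obtain n where "C < real n * \<bar>d\<bar>"
    using reals_Archimedean3[of "\<bar>d\<bar>"] by auto
  with assms[of n] show False by simp
qed

context group
begin

text \<open>There are n steps of cost D; the extra D pays for the value of \<open>q\<close> at the
  identity.\<close>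

lemma quasimorphism_pow:
  fixes q :: "'a \<Rightarrow> real"
  assumes q: "\<And>x y. x \<in> carrier G \<Longrightarrow> y \<in> carrier G \<Longrightarrow> \<bar>q (x \<otimes> y) - q x - q y\<bar> \<le> D"
    and x: "x \<in> carrier G"
  shows "\<bar>q (x [^] n) - real n * q x\<bar> \<le> real (Suc n) * D"
proof (induction n)
  case 0
  then show ?case using q[of \<one> \<one>] by simp
next
  case (Suc n)
  have "\<bar>q (x [^] n \<otimes> x) - q (x [^] n) - q x\<bar> \<le> D" using x by (intro q) auto
  with Suc show ?case by (simp add: algebra_simps)
qed

text \<open>The limit of q (x^(2^n)) / 2^n exists because each doubling costs a single defect, so
  the errors form a geometric series. Its sum is exactly D.\<close>

lemma homogenization:
  fixes q :: "'a \<Rightarrow> real"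
  assumes q: "\<And>x y. x \<in> carrier G \<Longrightarrow> y \<in> carrier G \<Longrightarrow> \<bar>q (x \<otimes> y) - q x - q y\<bar> \<le> D"
  obtains h where "\<And>x. x \<in> carrier G \<Longrightarrow> \<bar>q x - h x\<bar> \<le> D"
    "\<And>x n. x \<in> carrier G \<Longrightarrow> h (x [^] (n::nat)) = real n * h x"
proof -
  have D: "0 \<le> D" using q[of \<one> \<one>] by simp
  have lim: "\<exists>l. \<forall>n. \<bar>q (x [^] (2 ^ n :: nat)) - 2 ^ n * l\<bar> \<le> D" if x: "x \<in> carrier G" for x
  proof -
    define a where "a n = q (x [^] (2 ^ n :: nat)) / 2 ^ n" for n :: nat
    \<comment> \<open>The error D / 2^(n+1) is written as a difference so that the next estimate
      telescopes.\<close>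
    have step: "\<bar>a (Suc n) - a n\<bar> \<le> D / 2 ^ n - D / 2 ^ Suc n" for n
    proof -
      let ?y = "x [^] (2 ^ n :: nat)"
      have "x [^] (2 ^ Suc n :: nat) = ?y \<otimes> ?y"
        using x by (simp add: nat_pow_mult mult_2)
      moreover have "\<bar>q (?y \<otimes> ?y) - q ?y - q ?y\<bar> \<le> D" using x by (intro q) auto
      ultimately show ?thesis
        by (simp add: a_def field_simps abs_le_iff)
    qed
    have dist: "\<bar>a (n + k) - a n\<bar> \<le> D / 2 ^ n - D / 2 ^ (n + k)" for n k
    proof (induction k)
      case (Suc k)
      then show ?case using step[of "n + k"] by simp
    qed simp
    have dist': "\<bar>a m - a n\<bar> \<le> D / 2 ^ n" if "n \<le> m" for n m
    proof -
      have "0 \<le> D / 2 ^ m" using D by simp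
      then show ?thesis using dist[of n "m - n"] that by simp
    qed
    have "Cauchy a"
    proof (rule metric_CauchyI)
      fix e :: real assume "0 < e"
      obtain n where n: "2 * D / e < 2 ^ n" using real_arch_pow[of 2 "2 * D / e"] by auto
      have n': "D / 2 ^ n < e / 2" using n \<open>0 < e\<close> by (simp add: field_simps)
      have "dist (a m) (a k) < e" if "n \<le> m" "n \<le> k" for m k
        unfolding dist_real_def using dist'[OF that(1)] dist'[OF that(2)] n' by linarith
      then show "\<exists>n. \<forall>m\<ge>n. \<forall>k\<ge>n. dist (a m) (a k) < e" by blast
    qed
    then obtain l where l: "a \<longlonglongrightarrow> l"
      using Cauchy_convergent convergent_def by blast
    have "\<bar>q (x [^] (2 ^ n :: nat)) - 2 ^ n * l\<bar> \<le> D" for n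
    proof -
      have "(\<lambda>m. \<bar>a m - a n\<bar>) \<longlonglongrightarrow> \<bar>l - a n\<bar>"
        by (intro tendsto_intros l)
      then have "\<bar>l - a n\<bar> \<le> D / 2 ^ n"
        by (rule LIMSEQ_le_const2) (use dist' in blast)
      then have "2 ^ n * \<bar>l - a n\<bar> \<le> D" by (simp add: field_simps)
      moreover have "2 ^ n * \<bar>l - a n\<bar> = \<bar>2 ^ n * (l - a n)\<bar>" by (simp add: abs_mult)
      moreover have "2 ^ n * (l - a n) = 2 ^ n * l - q (x [^] (2 ^ n :: nat))"
        by (simp add: a_def algebra_simps)
      ultimately show ?thesis by linarith
    qed
    then show ?thesis by blast
  qed
  then obtain h where h: "\<And>x n. x \<in> carrier G \<Longrightarrow> \<bar>q (x [^] (2 ^ n :: nat)) - 2 ^ n * h x\<bar> \<le> D"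
    by metis
  have hom: "h (x [^] m) = real m * h x" if x: "x \<in> carrier G" for x and m :: nat
  proof -
    \<comment> \<open>Evaluating q at x^(m 2^n) in two ways compares 2^n h (x^m) with m 2^n h x up
      to an error independent of n; finally 2^n is replaced by the smaller factor n.\<close>
    have "real n * \<bar>h (x [^] m) - real m * h x\<bar> \<le> D + real (Suc m) * D + real m * D" for n :: nat
    proof -
      let ?y = "x [^] (2 ^ n :: nat)"
      have pow: "(x [^] m) [^] (2 ^ n :: nat) = ?y [^] m"
        using x by (simp add: nat_pow_pow mult.commute)
      have "\<bar>q (?y [^] m) - 2 ^ n * h (x [^] m)\<bar> \<le> D"
        unfolding pow[symmetric] using x by (intro h) auto
      moreover have "\<bar>q (?y [^] m) - real m * q ?y\<bar> \<le> real (Suc m) * D"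
        using x by (intro quasimorphism_pow q) auto
      moreover have "\<bar>real m * q ?y - real m * (2 ^ n * h x)\<bar> \<le> real m * D"
      proof -
        have "\<bar>real m * q ?y - real m * (2 ^ n * h x)\<bar> = real m * \<bar>q ?y - 2 ^ n * h x\<bar>"
          by (simp flip: right_diff_distrib add: abs_mult)
        also have "\<dots> \<le> real m * D" using h[OF x, of n] by (intro mult_left_mono) auto
        finally show ?thesis .
      qed
      ultimately have "\<bar>2 ^ n * h (x [^] m) - real m * (2 ^ n * h x)\<bar> \<le> D + real (Suc m) * D + real m * D"
        by linarith
      moreover have "2 ^ n * h (x [^] m) - real m * (2 ^ n * h x) = 2 ^ n * (h (x [^] m) - real m * h x)"
        by (simp add: algebra_simps)
      ultimately have "2 ^ n * \<bar>h (x [^] m) - real m * h x\<bar> \<le> D + real (Suc m) * D + real m * D"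
        by (simp add: abs_mult)
      moreover have "real n * \<bar>h (x [^] m) - real m * h x\<bar> \<le> 2 ^ n * \<bar>h (x [^] m) - real m * h x\<bar>"
        using of_nat_less_two_power[of n] by (intro mult_right_mono) (auto intro: less_imp_le)
      ultimately show ?thesis by linarith
    qed
    then have "h (x [^] m) - real m * h x = 0" by (rule multiples_bounded_imp_zero)
    then show ?thesis by simp
  qed
  show ?thesis
  proof (rule that)
    show "\<bar>q x - h x\<bar> \<le> D" if "x \<in> carrier G" for x
      using h[OF that, of 0] that by simp
  qed (rule hom)
qed

lemma coset_eq_of_mult:
  assumes "K \<lhd> G" "k \<in> K" "x \<in> carrier G"
  shows "K #> (k \<otimes> x) = K #> x"
proof -
  interpret K: normal K G by fact
  have "k \<otimes> x \<in> K #> x" using assms by (auto simp: r_coset_def)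
  then show ?thesis using repr_independence[OF _ assms(3) K.subgroup_axioms] by auto
qed

text \<open>For central \<open>c = [x, y]\<close> one has \<open>[x\<^sup>n, y] = c\<^sup>n\<close>, so that a homogeneous quasimorphism vanishes
  on \<open>c\<close>. The induction removes the terms of the lower central series one by one; \<open>K\<close> below is the
  subgroup by which the quasimorphism has already been shown to be invariant.\<close>
lemma homogeneous_quasimorphism_nilpotent:
  fixes h :: "'a \<Rightarrow> real"
  assumes nil: "nilpotent G"
    and q: "\<And>x y. x \<in> carrier G \<Longrightarrow> y \<in> carrier G \<Longrightarrow> \<bar>h (x \<otimes> y) - h x - h y\<bar> \<le> E"
    and hom: "\<And>x n. x \<in> carrier G \<Longrightarrow> h (x [^] (n::nat)) = real n * h x"
    and x: "x \<in> carrier G" and y: "y \<in> carrier G"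
  shows "h (x \<otimes> y) = h x + h y"
proof -
  \<comment> \<open>Conjugating x^n by \<open>y\<close> changes h by an amount bounded independently
    of n, and homogeneity forces a bounded multiple of the difference at \<open>x\<close> to
    vanish.\<close>
  have conj: "h (y \<otimes> x \<otimes> inv y) = h x" if x: "x \<in> carrier G" and y: "y \<in> carrier G" for x y
  proof -
    have "real n * \<bar>h (y \<otimes> x \<otimes> inv y) - h x\<bar> \<le> 2 * E + \<bar>h y + h (inv y)\<bar>" for n :: nat
    proof -
      have p: "(y \<otimes> x \<otimes> inv y) [^] n = y \<otimes> x [^] n \<otimes> inv y"
        by (induction n) (use x y in \<open>auto simp: word_simps\<close>)
      have "real n * \<bar>h (y \<otimes> x \<otimes> inv y) - h x\<bar> = \<bar>real n * h (y \<otimes> x \<otimes> inv y) - real n * h x\<bar>"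
        by (simp flip: right_diff_distrib add: abs_mult)
      also have "\<dots> = \<bar>h (y \<otimes> x [^] n \<otimes> inv y) - h (x [^] n)\<bar>"
        using hom[of "y \<otimes> x \<otimes> inv y" n] hom[of x n] x y by (simp add: p)
      also have "\<dots> \<le> 2 * E + \<bar>h y + h (inv y)\<bar>"
        using q[of "y \<otimes> x [^] n" "inv y"] q[of y "x [^] n"] x y by auto
      finally show ?thesis .
    qed
    then have "h (y \<otimes> x \<otimes> inv y) - h x = 0" by (rule multiples_bounded_imp_zero)
    then show ?thesis by simp
  qed
  define K where "K = {g \<in> carrier G. \<forall>x\<in>carrier G. h (x \<otimes> g) = h x}"
  have K_inv: "h (x \<otimes> g) = h x" if "g \<in> K" "x \<in> carrier G" for x g
    using that unfolding K_def by blast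
  have K_carrier: "g \<in> carrier G" if "g \<in> K" for g
    using that unfolding K_def by blast
  have "subgroup K G"
  proof (rule subgroupI)
    show "K \<noteq> {}" by (auto simp: K_def intro!: exI[of _ \<one>])
    fix a assume a: "a \<in> K"
    then have ac: "a \<in> carrier G" by (rule K_carrier)
    have "h (x \<otimes> inv a) = h x" if "x \<in> carrier G" for x
      using K_inv[OF a, of "x \<otimes> inv a"] that ac by (simp add: m_assoc)
    then show "inv a \<in> K" unfolding K_def using ac by simp
    fix b assume b: "b \<in> K"
    then have bc: "b \<in> carrier G" by (rule K_carrier)
    have "h (x \<otimes> (a \<otimes> b)) = h x" if "x \<in> carrier G" for x
      using K_inv[OF a that] K_inv[OF b, of "x \<otimes> a"] that ac bc by (simp add: m_assoc)
    then show "a \<otimes> b \<in> K" unfolding K_def using ac bc by simp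
  qed (auto simp: K_def)
  moreover have "z \<otimes> g \<otimes> inv z \<in> K" if z: "z \<in> carrier G" and g: "g \<in> K" for z g
  proof -
    have gc: "g \<in> carrier G" using g by (rule K_carrier)
    have "h (x \<otimes> (z \<otimes> g \<otimes> inv z)) = h x" if x: "x \<in> carrier G" for x
    proof -
      have "x \<otimes> (z \<otimes> g \<otimes> inv z) = z \<otimes> ((inv z \<otimes> x \<otimes> inv (inv z)) \<otimes> g) \<otimes> inv z"
        using x z gc by (simp add: word_simps)
      then have "h (x \<otimes> (z \<otimes> g \<otimes> inv z)) = h ((inv z \<otimes> x \<otimes> inv (inv z)) \<otimes> g)"
        using conj x z gc by simp
      also have "\<dots> = h (inv z \<otimes> x \<otimes> inv (inv z))"
        using x z by (intro K_inv[OF g]) auto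
      finally show ?thesis using conj[of x "inv z"] x z by simp
    qed
    then show ?thesis unfolding K_def using z gc by simp
  qed
  ultimately have KN: "K \<lhd> G" using normal_inv_iff by blast
  interpret K: normal K G by (rule KN)
  interpret Q: group "G Mod K" by (rule K.factorgroup_is_group)
  interpret p: group_hom G "G Mod K" "\<lambda>x. K #> x"
    by unfold_locales (rule K.r_coset_hom_Mod)
  have h_coset: "h a = h b" if "K #> a = K #> b" "a \<in> carrier G" "b \<in> carrier G" for a b
  proof -
    have "a \<in> K #> b" using rcos_self[OF that(2) K.subgroup_axioms] that(1) by simp
    then obtain k where k: "k \<in> K" "a = k \<otimes> b" by (auto simp: r_coset_def)
    have kc: "k \<in> carrier G" using k(1) by (rule K.mem_carrier)
    have "inv b \<otimes> k \<otimes> b \<in> K" using that(3) k(1) by (rule K.inv_op_closed1)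
    then have "h (b \<otimes> (inv b \<otimes> k \<otimes> b)) = h b" by (rule K_inv[OF _ that(3)])
    moreover have "b \<otimes> (inv b \<otimes> k \<otimes> b) = a" using k(2) kc that(3) by (simp add: word_simps)
    ultimately show ?thesis by simp
  qed
  have pow_coset: "K #> (a \<otimes> b) [^] n = K #> (a [^] n \<otimes> b [^] n)"
    if "a \<in> carrier G" "b \<in> carrier G" "commutator a b \<in> K" for a b and n :: nat
  proof -
    have "(K #> a) \<otimes>\<^bsub>G Mod K\<^esub> (K #> b) = (K #> b) \<otimes>\<^bsub>G Mod K\<^esub> (K #> a)"
      using commutator_mem_imp_coset_comm[OF KN that] .
    then have "((K #> a) \<otimes>\<^bsub>G Mod K\<^esub> (K #> b)) [^]\<^bsub>G Mod K\<^esub> n =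
        (K #> a) [^]\<^bsub>G Mod K\<^esub> n \<otimes>\<^bsub>G Mod K\<^esub> (K #> b) [^]\<^bsub>G Mod K\<^esub> n"
      using that by (intro Q.pow_mult_distrib) (auto intro: p.hom_closed)
    then show ?thesis
      using that by (metis m_closed nat_pow_closed p.hom_mult p.hom_nat_pow)
  qed
  have central: "commutator x y \<in> K"
    if x: "x \<in> carrier G" and y: "y \<in> carrier G"
      and cz: "\<And>z. z \<in> carrier G \<Longrightarrow> commutator z (commutator x y) \<in> K" for x y
  proof -
    define c where "c = commutator x y"
    have c: "c \<in> carrier G" using x y by (simp add: c_def)
    \<comment> \<open>By \<open>cz\<close> the element \<open>c\<close> is central modulo K, which
      gives x^n y x^-n = c^n y there.\<close>
    have powers: "K #> (x [^] n \<otimes> y \<otimes> inv (x [^] n)) = K #> (c [^] n \<otimes> y)" for n :: nat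
    proof (induction n)
      case 0
      then show ?case using y by simp
    next
      case (Suc n)
      let ?X = "x [^] n"
      have "x [^] Suc n \<otimes> y \<otimes> inv (x [^] Suc n) =
          commutator ?X c \<otimes> (c \<otimes> (?X \<otimes> y \<otimes> inv ?X))"
        using x y by (simp add: c_def commutator_def word_simps)
      then have "K #> (x [^] Suc n \<otimes> y \<otimes> inv (x [^] Suc n)) = K #> (c \<otimes> (?X \<otimes> y \<otimes> inv ?X))"
        using coset_eq_of_mult[OF KN cz[of ?X, folded c_def], of "c \<otimes> (?X \<otimes> y \<otimes> inv ?X)"] x y c
        by (simp only: m_closed inv_closed nat_pow_closed)
      also have "\<dots> = (K #> c) \<otimes>\<^bsub>G Mod K\<^esub> (K #> (c [^] n \<otimes> y))"
        using x y c Suc p.hom_mult[of c "?X \<otimes> y \<otimes> inv ?X"] by simp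
      also have "\<dots> = K #> (c [^] Suc n \<otimes> y)"
        using y c nat_pow_Suc2[OF c, of n] p.hom_mult[of c "c [^] n \<otimes> y"]
        by (simp only: m_assoc m_closed nat_pow_closed)
      finally show ?case .
    qed
    \<comment> \<open>Modulo K, c^n is the product of a conjugate of \<open>y\<close> and the
      inverse of \<open>y\<close>, so its value under h is bounded independently of n.\<close>
    have "real n * \<bar>h c\<bar> \<le> E + \<bar>h y + h (inv y)\<bar>" for n :: nat
    proof -
      let ?X = "x [^] n"
      have "K #> (?X \<otimes> y \<otimes> inv ?X \<otimes> inv y) = K #> (c [^] n \<otimes> y \<otimes> inv y)"
        using powers[of n] x y c p.hom_mult[of "?X \<otimes> y \<otimes> inv ?X" "inv y"] p.hom_mult[of "c [^] n \<otimes> y" "inv y"]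
        by simp
      moreover have "c [^] n \<otimes> y \<otimes> inv y = c [^] n" using y c by (simp add: word_simps)
      ultimately have "h (c [^] n) = h (?X \<otimes> y \<otimes> inv ?X \<otimes> inv y)"
        using h_coset[of "?X \<otimes> y \<otimes> inv ?X \<otimes> inv y" "c [^] n"] x y c by simp
      moreover have "\<bar>h (?X \<otimes> y \<otimes> inv ?X \<otimes> inv y) - h (?X \<otimes> y \<otimes> inv ?X) - h (inv y)\<bar> \<le> E"
        using x y by (intro q) auto
      moreover have "h (?X \<otimes> y \<otimes> inv ?X) = h y" using x y by (intro conj) auto
      moreover have "real n * \<bar>h c\<bar> = \<bar>h (c [^] n)\<bar>" using hom[OF c, of n] by (simp add: abs_mult)
      ultimately show ?thesis by linarith
    qed
    then have hc: "h c = 0" by (rule multiples_bounded_imp_zero)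
    have "h (z \<otimes> c) = h z" if z: "z \<in> carrier G" for z
    proof -
      have "real n * \<bar>h (z \<otimes> c) - h z\<bar> \<le> E" for n :: nat
      proof -
        have "h ((z \<otimes> c) [^] n) = h (z [^] n \<otimes> c [^] n)"
          using pow_coset[OF z c, of n] cz[OF z, folded c_def] z c by (intro h_coset) auto
        moreover have "\<bar>h (z [^] n \<otimes> c [^] n) - h (z [^] n) - h (c [^] n)\<bar> \<le> E"
          using z c by (intro q) auto
        moreover have "h (c [^] n) = 0" using hom[OF c, of n] hc by simp
        moreover have "real n * \<bar>h (z \<otimes> c) - h z\<bar> = \<bar>real n * h (z \<otimes> c) - real n * h z\<bar>"
          by (simp flip: right_diff_distrib add: abs_mult)
        ultimately show ?thesis
          using hom[of "z \<otimes> c" n] hom[OF z, of n] z c by simp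
      qed
      then have "h (z \<otimes> c) - h z = 0" by (rule multiples_bounded_imp_zero)
      then show ?thesis by simp
    qed
    then show ?thesis unfolding K_def c_def[symmetric] using c by simp
  qed
  obtain m where m: "lower_central G m = {\<one>}"
    using nil by (auto simp: nilpotent_def)
  \<comment> \<open>Descending induction: if the next term lies in K, the commutators that generate
    the present one are central modulo K.\<close>
  have "lower_central G (Suc k) \<subseteq> K" for k
  proof (induction "m - k" arbitrary: k)
    case 0
    then have "lower_central G (Suc k) \<subseteq> {\<one>}"
      unfolding m[symmetric] by (intro lower_central_antimono) simp
    then show ?case using K.one_closed by blast
  next
    case (Suc d)
    then have IH: "lower_central G (Suc (Suc k)) \<subseteq> K" by simp
    show ?case
      unfolding lower_central_Suc[of k]
    proof (intro generate_subgroup_incl K.subgroup_axioms subsetI)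
      fix c assume "c \<in> {commutator x y |x y. x \<in> carrier G \<and> y \<in> lower_central G k}"
      then obtain x y where c: "c = commutator x y" "x \<in> carrier G" "y \<in> lower_central G k" by blast
      have yc: "y \<in> carrier G" using c(3) by (rule lower_central_carrier)
      have "commutator z (commutator x y) \<in> K" if "z \<in> carrier G" for z
        using commutator_lower_central[OF that commutator_lower_central[OF c(2,3)]] IH by blast
      then show "c \<in> K" unfolding c(1) by (rule central[OF c(2) yc])
    qed
  qed
  then have comm: "commutator x y \<in> K"
    using commutator_lower_central[of x y 0] x y by auto
  have "real n * \<bar>h (x \<otimes> y) - h x - h y\<bar> \<le> E" for n :: nat
  proof -
    have "h ((x \<otimes> y) [^] n) = h (x [^] n \<otimes> y [^] n)"
      using pow_coset[OF x y comm, of n] x y by (intro h_coset) auto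
    moreover have "\<bar>h (x [^] n \<otimes> y [^] n) - h (x [^] n) - h (y [^] n)\<bar> \<le> E"
      using x y by (intro q) auto
    moreover have "real n * \<bar>h (x \<otimes> y) - h x - h y\<bar> = \<bar>real n * h (x \<otimes> y) - real n * h x - real n * h y\<bar>"
      by (simp flip: right_diff_distrib add: abs_mult)
    ultimately show ?thesis
      using hom[of "x \<otimes> y" n] hom[OF x, of n] hom[OF y, of n] x y by simp
  qed
  then have "h (x \<otimes> y) - h x - h y = 0" by (rule multiples_bounded_imp_zero)
  then show ?thesis by simp
qed

lemma quasimorphism_near_hom:
  fixes q :: "'a \<Rightarrow> real"
  assumes "nilpotent G"
    and q: "\<And>x y. x \<in> carrier G \<Longrightarrow> y \<in> carrier G \<Longrightarrow> \<bar>q (x \<otimes> y) - q x - q y\<bar> \<le> D"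
  obtains h where "\<And>x y. x \<in> carrier G \<Longrightarrow> y \<in> carrier G \<Longrightarrow> h (x \<otimes> y) = h x + h y"
    "\<And>x. x \<in> carrier G \<Longrightarrow> \<bar>q x - h x\<bar> \<le> D"
proof -
  obtain h where h: "\<And>x. x \<in> carrier G \<Longrightarrow> \<bar>q x - h x\<bar> \<le> D"
    "\<And>x n. x \<in> carrier G \<Longrightarrow> h (x [^] (n::nat)) = real n * h x"
    using homogenization[OF q] by blast
  \<comment> \<open>One D is the defect of q, the other three come from replacing q by h at three
    points.\<close>
  have "\<bar>h (x \<otimes> y) - h x - h y\<bar> \<le> 4 * D" if "x \<in> carrier G" "y \<in> carrier G" for x y
    using h(1)[OF that(1)] h(1)[OF that(2)] h(1)[of "x \<otimes> y"] q[OF that] that by simp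
  then show ?thesis
    using that homogeneous_quasimorphism_nilpotent[OF assms(1) _ h(2)] h(1) by blast
qed

end

section \<open>Coordinates on finitely generated abelian groups\<close>

context comm_group
begin

definition monomial :: "'a set \<Rightarrow> ('a \<Rightarrow> int) \<Rightarrow> 'a" where
  "monomial I n = finprod G (\<lambda>i. i [^] n i) I"

lemma monomial_closed: "I \<subseteq> carrier G \<Longrightarrow> monomial I n \<in> carrier G"
  unfolding monomial_def by (intro finprod_closed) auto

lemma monomial_insert:
  "finite I \<Longrightarrow> j \<notin> I \<Longrightarrow> insert j I \<subseteq> carrier G \<Longrightarrow> monomial (insert j I) n = j [^] n j \<otimes> monomial I n"
  unfolding monomial_def by (intro finprod_insert) auto

lemma monomial_empty [simp]: "monomial {} n = \<one>"
  by (simp add: monomial_def)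

lemma monomial_cong: "I \<subseteq> carrier G \<Longrightarrow> (\<And>i. i \<in> I \<Longrightarrow> n i = m i) \<Longrightarrow> monomial I n = monomial I m"
  unfolding monomial_def by (intro finprod_cong') auto

lemma monomial_add:
  "I \<subseteq> carrier G \<Longrightarrow> monomial I (\<lambda>i. n i + m i) = monomial I n \<otimes> monomial I m"
proof -
  assume I: "I \<subseteq> carrier G"
  then have "monomial I (\<lambda>i. n i + m i) = finprod G (\<lambda>i. i [^] n i \<otimes> i [^] m i) I"
    unfolding monomial_def by (intro finprod_cong') (auto simp: int_pow_mult)
  then show ?thesis
    unfolding monomial_def using I by (subst (asm) finprod_multf) auto
qed

lemma monomial_zero: "monomial I (\<lambda>_. 0) = \<one>"
  unfolding monomial_def by (intro finprod_one_eqI) simp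

lemma monomial_pow:
  assumes "I \<subseteq> carrier G"
  shows "monomial I (\<lambda>i. int k * n i) = monomial I n [^] k"
proof (induction k)
  case (Suc k)
  have "monomial I (\<lambda>i. int (Suc k) * n i) = monomial I (\<lambda>i. int k * n i + n i)"
    using assms by (intro monomial_cong) (simp_all add: algebra_simps)
  with Suc assms show ?case by (simp add: monomial_add)
qed (simp add: monomial_zero)

lemma monomial_minus:
  assumes "I \<subseteq> carrier G"
  shows "monomial I (\<lambda>i. - n i) = inv (monomial I n)"
proof (rule inv_equality[symmetric])
  have "monomial I (\<lambda>i. - n i) \<otimes> monomial I n = monomial I (\<lambda>i. - n i + n i)"
    using monomial_add[OF assms, of "\<lambda>i. - n i" n] by simp
  then show "monomial I (\<lambda>i. - n i) \<otimes> monomial I n = \<one>"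
    by (simp add: monomial_zero)
qed (use assms monomial_closed in auto)

lemma monomial_single:
  assumes "finite I" "I \<subseteq> carrier G" "j \<in> I"
  shows "monomial I (\<lambda>i. if i = j then n else 0) = j [^] n"
proof -
  have "monomial (I - {j}) (\<lambda>i. if i = j then n else 0) = \<one>"
    unfolding monomial_def by (intro finprod_one_eqI) auto
  then show ?thesis
    using assms monomial_insert[of "I - {j}" j "\<lambda>i. if i = j then n else 0"]
    by (auto simp: insert_absorb)
qed

lemma monomials_subgroup:
  assumes "I \<subseteq> carrier G"
  shows "subgroup (range (monomial I)) G"
proof (rule subgroupI)
  show "range (monomial I) \<subseteq> carrier G" using assms monomial_closed by auto
  fix a b assume "a \<in> range (monomial I)" "b \<in> range (monomial I)"
  then obtain n m where nm: "a = monomial I n" "b = monomial I m" by auto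
  show "inv a \<in> range (monomial I)"
    unfolding nm monomial_minus[OF assms, symmetric] by simp
  show "a \<otimes> b \<in> range (monomial I)"
    unfolding nm monomial_add[OF assms, symmetric] by simp
qed auto

definition independent :: "'a set \<Rightarrow> bool" where
  "independent I \<longleftrightarrow> (\<forall>n. monomial I n = \<one> \<longrightarrow> (\<forall>i\<in>I. n i = 0))"

lemma independent_unique:
  assumes "independent I" "I \<subseteq> carrier G" "monomial I n = monomial I m" "i \<in> I"
  shows "n i = m i"
proof -
  have "monomial I (\<lambda>i. n i + - m i) = \<one>"
    using assms by (simp only: monomial_add monomial_minus r_inv monomial_closed)
  then have "n i + - m i = 0" using assms unfolding independent_def by blast
  then show ?thesis by simp
qed

text \<open>\<open>I\<close> maps to a basis of the real tensor product, with dual basis \<open>e\<close>; the kernel of all \<open>e i\<close>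
  is the torsion subgroup.\<close>
definition coordinates :: "'a set \<Rightarrow> ('a \<Rightarrow> 'a \<Rightarrow> real) \<Rightarrow> bool" where
  "coordinates I e \<longleftrightarrow> finite I \<and> I \<subseteq> carrier G \<and>
     (\<forall>i\<in>I. e i \<in> carrier (real_hom G)) \<and>
     (\<forall>i\<in>I. \<forall>j\<in>I. e i j = (if i = j then 1 else 0)) \<and>
     (\<exists>k::nat. k > 0 \<and> (\<forall>a\<in>carrier G. \<exists>n. a [^] k = monomial I n \<and>
        (\<forall>i\<in>I. real_of_int (n i) = real k * e i a))) \<and>
     (\<forall>B. finite {a \<in> carrier G. \<forall>i\<in>I. \<bar>e i a\<bar> \<le> B})"

text \<open>If \<open>s\<close> lies outside a maximal independent set, a nontrivial relation
  between \<open>s\<close> and that set must involve \<open>s\<close>; solving it for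
  \<open>s\<close> makes a power of \<open>s\<close> a monomial.\<close>

lemma maximal_independent:
  assumes S: "finite S" "S \<subseteq> carrier G"
  obtains I where "I \<subseteq> S" "independent I" "\<And>s. s \<in> S \<Longrightarrow> \<exists>k>0. s [^] (k::nat) \<in> range (monomial I)"
proof -
  let ?F = "{I. I \<subseteq> S \<and> independent I}"
  have "finite ?F" using S(1) by simp
  moreover have "{} \<in> ?F" by (simp add: independent_def)
  ultimately obtain I where "I \<in> ?F" and max': "\<forall>J\<in>?F. I \<subseteq> J \<longrightarrow> I = J"
    using finite_has_maximal[of ?F] by blast
  then have I: "I \<subseteq> S" "independent I"
    and max: "\<And>J. J \<subseteq> S \<Longrightarrow> independent J \<Longrightarrow> I \<subseteq> J \<Longrightarrow> J = I"
    by blast+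
  have Ic: "I \<subseteq> carrier G" and fin: "finite I" using I S finite_subset by auto
  interpret M: subgroup "range (monomial I)" G using Ic by (rule monomials_subgroup)
  have "\<exists>k>0. s [^] (k::nat) \<in> range (monomial I)" if s: "s \<in> S" for s
  proof (cases "s \<in> I")
    case True
    have "s [^] (1::nat) = monomial I (\<lambda>i. if i = s then 1 else 0)"
      using monomial_single[OF fin Ic True] Ic True by auto
    then show ?thesis by (intro exI[of _ 1]) auto
  next
    case False
    have sc: "s \<in> carrier G" using s S by auto
    have "\<not> independent (insert s I)"
      using max[of "insert s I"] I s False by auto
    then obtain n j where n: "monomial (insert s I) n = \<one>" "j \<in> insert s I" "n j \<noteq> 0"
      by (auto simp: independent_def)
    have eq: "s [^] n s \<otimes> monomial I n = \<one>"
      using n(1) monomial_insert[OF fin False, of n] Ic sc by simp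
    have ns: "n s \<noteq> 0"
    proof
      assume "n s = 0"
      then have "monomial I n = \<one>" using eq Ic monomial_closed by simp
      then show False using n(2,3) \<open>n s = 0\<close> I(2) by (auto simp: independent_def)
    qed
    have "s [^] n s = inv (monomial I n)"
      using eq sc Ic monomial_closed by (metis int_pow_closed inv_equality)
    then have mem: "s [^] n s \<in> range (monomial I)" by simp
    have "s [^] nat \<bar>n s\<bar> \<in> range (monomial I)"
    proof (cases "n s \<ge> 0")
      case True
      then show ?thesis using mem by (simp add: pow_nat)
    next
      case False
      then have "s [^] nat \<bar>n s\<bar> = inv (s [^] n s)"
        using sc by (simp add: pow_nat int_pow_neg)
      then show ?thesis using mem by auto
    qed
    then show ?thesis using ns by (intro exI[of _ "nat \<bar>n s\<bar>"]) auto
  qed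
  then show ?thesis using that I by blast
qed

text \<open>The product k of the exponents found for the generators maps every a^k into the free
  subgroup generated by the independent set. The coordinates of \<open>a\<close> are the exponents
  of a^k divided by k.\<close>

lemma finitely_generated_coordinates:
  assumes S: "finite S" "S \<subseteq> carrier G" "generate G S = carrier G"
  obtains I e where "coordinates I e"
proof -
  obtain I where I: "I \<subseteq> S" "independent I"
    and roots: "\<And>s. s \<in> S \<Longrightarrow> \<exists>k>0. s [^] (k::nat) \<in> range (monomial I)"
    using maximal_independent[OF S(1,2)] by blast
  have Ic: "I \<subseteq> carrier G" and fin: "finite I" using I S finite_subset by auto
  interpret M: subgroup "range (monomial I)" G using Ic by (rule monomials_subgroup)
  obtain kk where kk: "\<And>s. s \<in> S \<Longrightarrow> 0 < kk s" "\<And>s. s \<in> S \<Longrightarrow> s [^] (kk s :: nat) \<in> range (monomial I)"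
    using roots by metis
  define k where "k = prod kk S"
  have k: "0 < k" unfolding k_def using kk(1) by (intro prod_pos) auto
  have pow_mem: "a [^] m \<in> range (monomial I)" if "a \<in> range (monomial I)" for a and m :: nat
    by (induction m) (use that in auto)
  have "subgroup {a \<in> carrier G. a [^] k \<in> range (monomial I)} G"
  proof (rule subgroupI)
    show "inv a \<in> {a \<in> carrier G. a [^] k \<in> range (monomial I)}"
      if "a \<in> {a \<in> carrier G. a [^] k \<in> range (monomial I)}" for a
      using that by (auto simp: nat_pow_inv)
    show "a \<otimes> b \<in> {a \<in> carrier G. a [^] k \<in> range (monomial I)}"
      if "a \<in> {a \<in> carrier G. a [^] k \<in> range (monomial I)}"
        "b \<in> {a \<in> carrier G. a [^] k \<in> range (monomial I)}" for a b
      using that by (simp add: nat_pow_distrib)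
  qed (use M.one_closed in \<open>auto intro!: exI[of _ \<one>]\<close>)
  moreover have "S \<subseteq> {a \<in> carrier G. a [^] k \<in> range (monomial I)}"
  proof
    fix s assume s: "s \<in> S"
    have "k = kk s * prod kk (S - {s})"
      unfolding k_def using S(1) s by (simp add: prod.remove)
    then have "s [^] k = (s [^] kk s) [^] prod kk (S - {s})"
      using s S by (auto simp: nat_pow_pow)
    then show "s \<in> {a \<in> carrier G. a [^] k \<in> range (monomial I)}"
      using pow_mem[OF kk(2)[OF s], of "prod kk (S - {s})"] s S by auto
  qed
  ultimately have "carrier G \<subseteq> {a \<in> carrier G. a [^] k \<in> range (monomial I)}"
    using generate_subgroup_incl S(3) by metis
  then have "\<forall>a\<in>carrier G. \<exists>n. a [^] k = monomial I n" by auto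
  then obtain c where c: "\<And>a. a \<in> carrier G \<Longrightarrow> a [^] k = monomial I (c a)" by metis
  define e where "e i = (\<lambda>a\<in>carrier G. real_of_int (c a i) / real k)" for i
  have uniq: "n i = c a i" if "a \<in> carrier G" "a [^] k = monomial I n" "i \<in> I" for a n i
    using independent_unique[OF I(2) Ic _ that(3)] c[OF that(1)] that(2) by simp
  have e_mult: "e i (a \<otimes> b) = e i a + e i b" if "i \<in> I" "a \<in> carrier G" "b \<in> carrier G" for i a b
  proof -
    have "(a \<otimes> b) [^] k = monomial I (\<lambda>i. c a i + c b i)"
      using nat_pow_distrib[OF that(2,3), of k]
      by (simp only: c[OF that(2)] c[OF that(3)] monomial_add[OF Ic])
    then have "c (a \<otimes> b) i = c a i + c b i"
      using uniq[of "a \<otimes> b" "\<lambda>i. c a i + c b i" i] that by simp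
    then show ?thesis using that by (simp add: e_def add_divide_distrib)
  qed
  have e_monomial: "e i (monomial I m) = real_of_int (m i)" if "i \<in> I" for i m
  proof -
    have "c (monomial I m) i = int k * m i"
      using uniq[OF monomial_closed[OF Ic] monomial_pow[OF Ic, symmetric] that] by simp
    then show ?thesis using monomial_closed[OF Ic, of m] k by (simp add: e_def)
  qed
  have dual: "e i j = (if i = j then 1 else 0)" if "i \<in> I" "j \<in> I" for i j
  proof -
    have "monomial I (\<lambda>i. if i = j then 1 else 0) = j"
      using monomial_single[OF fin Ic that(2), of 1] that(2) Ic by auto
    then show ?thesis
      using e_monomial[OF that(1), of "\<lambda>i. if i = j then 1 else 0"] by simp
  qed
  have fin_ball: "finite {a \<in> carrier G. \<forall>i\<in>I. \<bar>e i a\<bar> \<le> B}" for B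
  proof -
    \<comment> \<open>Reducing exponents modulo k writes every element as one of finitely many
      residues times a k-th power, and the latter is a monomial in \<open>I\<close>.\<close>
    define W where "W = monomial S ` (PiE S (\<lambda>_. {0..<int k}))"
    have Wfin: "finite W" unfolding W_def using S(1) by (intro finite_imageI finite_PiE) auto
    have Wc: "W \<subseteq> carrier G" unfolding W_def using S(2) monomial_closed by auto
    have decomp: "\<exists>w\<in>W. \<exists>m. a = w \<otimes> monomial I m" if a: "a \<in> carrier G" for a
    proof -
      have "S \<subseteq> range (monomial S)"
      proof
        fix s assume s: "s \<in> S"
        have "s = monomial S (\<lambda>i. if i = s then 1 else 0)"
          using monomial_single[OF S(1,2) s, of 1] s S(2) by auto
        then show "s \<in> range (monomial S)" by blast
      qed
      then have "generate G S \<subseteq> range (monomial S)"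
        by (intro generate_subgroup_incl monomials_subgroup S(2))
      with a S(3) obtain n where n: "a = monomial S n" by auto
      define r where "r = (\<lambda>s\<in>S. n s mod int k)"
      have "a = monomial S (\<lambda>s. r s + int k * (n s div int k))"
        unfolding n using S(2) by (intro monomial_cong) (auto simp: r_def)
      also have "\<dots> = monomial S r \<otimes> monomial S (\<lambda>s. n s div int k) [^] k"
        using S(2) by (simp add: monomial_add monomial_pow)
      also have "monomial S (\<lambda>s. n s div int k) [^] k = monomial I (c (monomial S (\<lambda>s. n s div int k)))"
        using c monomial_closed[OF S(2)] by blast
      finally have "a = monomial S r \<otimes> monomial I (c (monomial S (\<lambda>s. n s div int k)))" .
      moreover have "monomial S r \<in> W"
        unfolding W_def r_def using k by (intro imageI) auto
      ultimately show ?thesis by blast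
    qed
    \<comment> \<open>The exponents of the monomial are the coordinates of \<open>a\<close> minus
      those of the residue w; the double sum bounds the latter for all w at once.\<close>
    define B' where "B' = \<lceil>\<bar>B\<bar> + (\<Sum>w\<in>W. \<Sum>i\<in>I. \<bar>e i w\<bar>)\<rceil>"
    let ?T = "(\<lambda>(w, m). w \<otimes> monomial I m) ` (W \<times> PiE I (\<lambda>_. {-B'..B'}))"
    have "finite ?T" using Wfin fin by (intro finite_imageI finite_cartesian_product finite_PiE) auto
    moreover have "{a \<in> carrier G. \<forall>i\<in>I. \<bar>e i a\<bar> \<le> B} \<subseteq> ?T"
    proof
      fix a assume a: "a \<in> {a \<in> carrier G. \<forall>i\<in>I. \<bar>e i a\<bar> \<le> B}"
      then obtain w m where wm: "w \<in> W" "a = w \<otimes> monomial I m" using decomp by blast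
      have wc: "w \<in> carrier G" using wm Wc by auto
      have m: "m i \<in> {-B'..B'}" if i: "i \<in> I" for i
      proof -
        have "e i a = e i w + real_of_int (m i)"
          using e_mult[OF i wc monomial_closed[OF Ic]] e_monomial[OF i] wm(2) by simp
        moreover have "\<bar>e i w\<bar> \<le> (\<Sum>i\<in>I. \<bar>e i w\<bar>)"
          using fin i by (intro member_le_sum) auto
        moreover have "(\<Sum>i\<in>I. \<bar>e i w\<bar>) \<le> (\<Sum>w\<in>W. \<Sum>i\<in>I. \<bar>e i w\<bar>)"
          using Wfin wm(1) by (intro member_le_sum) (auto intro: sum_nonneg)
        moreover have "\<bar>e i a\<bar> \<le> B" using a i by auto
        ultimately have "\<bar>real_of_int (m i)\<bar> \<le> \<bar>B\<bar> + (\<Sum>w\<in>W. \<Sum>i\<in>I. \<bar>e i w\<bar>)" by linarith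
        then show ?thesis unfolding B'_def by (simp add: abs_le_iff) linarith
      qed
      have "a = w \<otimes> monomial I (restrict m I)"
        using wm(2) Ic monomial_cong[of I m "restrict m I"] by simp
      moreover have "restrict m I \<in> PiE I (\<lambda>_. {-B'..B'})" using m by auto
      ultimately show "a \<in> ?T" using wm(1) by (intro image_eqI[of _ _ "(w, restrict m I)"]) auto
    qed
    ultimately show ?thesis by (rule finite_subset[rotated])
  qed
  have "coordinates I e"
    unfolding coordinates_def
  proof (intro conjI ballI allI)
    show "e i \<in> carrier (real_hom G)" if "i \<in> I" for i
      using e_mult that by (auto simp: real_hom_carrier e_def)
    show "\<exists>k::nat. k > 0 \<and> (\<forall>a\<in>carrier G. \<exists>n. a [^] k = monomial I n \<and> (\<forall>i\<in>I. real_of_int (n i) = real k * e i a))"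
    proof (intro exI[of _ k] conjI ballI k)
      fix a assume "a \<in> carrier G"
      then show "\<exists>n. a [^] k = monomial I n \<and> (\<forall>i\<in>I. real_of_int (n i) = real k * e i a)"
        using c k by (intro exI[of _ "c a"]) (auto simp: e_def)
    qed
  qed (use fin Ic dual fin_ball in auto)
  then show ?thesis by (rule that)
qed

end

section \<open>Linear algebra\<close>

lemma convergent_subseq_real:
  fixes f :: "nat \<Rightarrow> real"
  assumes "\<And>n. \<bar>f n\<bar> \<le> B"
  obtains r y where "strict_mono r" "(\<lambda>n. f (r n)) \<longlonglongrightarrow> y"
proof -
  obtain r where r: "strict_mono r" "monoseq (\<lambda>n. f (r n))"
    using seq_monosub[of f] by auto
  moreover have "Bseq (\<lambda>n. f (r n))"
    using assms by (intro BseqI'[of _ B]) auto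
  ultimately have "convergent (\<lambda>n. f (r n))" by (intro Bseq_monoseq_convergent)
  then show ?thesis using that r(1) by (auto simp: convergent_def)
qed

lemma convergent_subseq_finite:
  fixes f :: "nat \<Rightarrow> 'i \<Rightarrow> real"
  assumes "finite I" "\<And>n i. i \<in> I \<Longrightarrow> \<bar>f n i\<bar> \<le> B"
  shows "\<exists>r y. strict_mono r \<and> (\<forall>i\<in>I. (\<lambda>n. f (r n) i) \<longlonglongrightarrow> y i)"
  using assms
proof (induction I)
  case empty
  show ?case by (intro exI[of _ id] exI) (auto simp: strict_mono_def)
next
  case (insert j I)
  then obtain r y where r: "strict_mono r" "\<And>i. i \<in> I \<Longrightarrow> (\<lambda>n. f (r n) i) \<longlonglongrightarrow> y i"
    by (metis insertI2)
  obtain s z where s: "strict_mono s" "(\<lambda>n. f (r (s n)) j) \<longlonglongrightarrow> z"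
    using convergent_subseq_real[of "\<lambda>n. f (r n) j" B] insert.prems by auto
  have "(\<lambda>n. f ((r \<circ> s) n) i) \<longlonglongrightarrow> (y(j := z)) i" if "i \<in> insert j I" for i
    using that s(2) LIMSEQ_subseq_LIMSEQ[OF r(2) s(1), of i] insert.hyps by (auto simp: o_def)
  moreover have "strict_mono (r \<circ> s)" using r(1) s(1) by (rule strict_mono_o)
  ultimately show ?case by blast
qed

text \<open>Gaussian elimination on the rows \<open>l i\<close>: if the column j0 vanishes, the unit
  covector at j0 is orthogonal to all rows; otherwise a pivot row clears this column and the
  induction hypothesis applies to the others.\<close>

lemma orthogonal_or_spanning:
  fixes l :: "'i \<Rightarrow> 'j \<Rightarrow> real"
  assumes "finite J" "finite I"
  shows "(\<exists>c. (\<exists>j\<in>J. c j \<noteq> 0) \<and> (\<forall>i\<in>I. (\<Sum>j\<in>J. c j * l i j) = 0)) \<or>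
    (\<forall>w. \<exists>x. \<forall>j\<in>J. w j = (\<Sum>i\<in>I. x i * l i j))"
  using assms(1)
proof (induction J arbitrary: l)
  case (insert j0 J)
  show ?case
  proof (cases "\<forall>i\<in>I. l i j0 = 0")
    case True
    have "(\<Sum>j\<in>insert j0 J. (if j = j0 then 1 else 0) * l i j) = l i j0" for i
    proof -
      have "(\<Sum>j\<in>J. (if j = j0 then 1 else 0) * l i j) = 0"
        using insert.hyps by (intro sum.neutral) auto
      then show ?thesis using insert.hyps by simp
    qed
    with True show ?thesis by (intro disjI1 exI[of _ "\<lambda>j. if j = j0 then 1 else 0"]) auto
  next
    case False
    then obtain i0 where i0: "i0 \<in> I" "l i0 j0 \<noteq> 0" by blast
    define a where "a i = l i j0 / l i0 j0" for i
    define l' where "l' i j = l i j - a i * l i0 j" for i j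
    have a0: "l i j0 = a i * l i0 j0" for i using i0 by (simp add: a_def)
    from insert.IH[of l'] show ?thesis
    proof
      assume "\<exists>c. (\<exists>j\<in>J. c j \<noteq> 0) \<and> (\<forall>i\<in>I. (\<Sum>j\<in>J. c j * l' i j) = 0)"
      then obtain c where c: "\<exists>j\<in>J. c j \<noteq> 0" "\<And>i. i \<in> I \<Longrightarrow> (\<Sum>j\<in>J. c j * l' i j) = 0" by blast
      \<comment> \<open>The new coefficient makes d orthogonal to the pivot row, and the remaining
        rows differ from the reduced ones by multiples of the pivot row.\<close>
      define d where "d = c(j0 := - (\<Sum>j\<in>J. c j * l i0 j) / l i0 j0)"
      have dJ: "d j = c j" if "j \<in> J" for j using that insert.hyps by (auto simp: d_def)
      have "(\<Sum>j\<in>insert j0 J. d j * l i j) = 0" if i: "i \<in> I" for i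
      proof -
        have "(\<Sum>j\<in>insert j0 J. d j * l i j) = d j0 * l i j0 + (\<Sum>j\<in>J. c j * l i j)"
          using insert.hyps dJ by (simp cong: sum.cong)
        also have "d j0 * l i j0 = - (\<Sum>j\<in>J. c j * l i0 j) * a i"
          using i0 by (simp add: d_def a_def)
        also have "(\<Sum>j\<in>J. c j * l i j) = (\<Sum>j\<in>J. c j * l' i j) + (\<Sum>j\<in>J. c j * l i0 j) * a i"
          unfolding sum_distrib_right sum.distrib[symmetric]
          by (intro sum.cong) (simp_all add: l'_def algebra_simps)
        finally show ?thesis using c(2)[OF i] by simp
      qed
      moreover have "\<exists>j\<in>insert j0 J. d j \<noteq> 0" using c(1) dJ by auto
      ultimately show ?thesis by blast
    next
      assume sol: "\<forall>w. \<exists>x. \<forall>j\<in>J. w j = (\<Sum>i\<in>I. x i * l' i j)"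
      have "\<exists>x. \<forall>j\<in>insert j0 J. w j = (\<Sum>i\<in>I. x i * l i j)" for w
      proof -
        obtain x where x: "\<And>j. j \<in> J \<Longrightarrow> w j - w j0 / l i0 j0 * l i0 j = (\<Sum>i\<in>I. x i * l' i j)"
          using sol[rule_format, of "\<lambda>j. w j - w j0 / l i0 j0 * l i0 j"] by blast
        \<comment> \<open>The pivot row is used w j0 / l i0 j0 times, less the multiples of it that
          were subtracted in forming the reduced rows.\<close>
        define t where "t = w j0 / l i0 j0 - (\<Sum>i\<in>I. x i * a i)"
        define x' where "x' i = x i + (if i = i0 then t else 0)" for i
        have x': "(\<Sum>i\<in>I. x' i * l i j) = (\<Sum>i\<in>I. x i * l i j) + t * l i0 j" for j
        proof -
          have "(\<Sum>i\<in>I. (if i = i0 then t else 0) * l i j) = (\<Sum>i\<in>I. if i = i0 then t * l i0 j else 0)"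
            by (intro sum.cong) auto
          also have "\<dots> = t * l i0 j" using i0 assms(2) by (simp add: sum.delta)
          finally show ?thesis by (simp add: x'_def distrib_right sum.distrib)
        qed
        have "w j0 = (\<Sum>i\<in>I. x' i * l i j0)"
        proof -
          have "(\<Sum>i\<in>I. x i * l i j0) = (\<Sum>i\<in>I. x i * a i) * l i0 j0"
            unfolding sum_distrib_right by (intro sum.cong) (simp_all add: mult.assoc flip: a0)
          then show ?thesis using i0 unfolding x' by (simp add: t_def left_diff_distrib)
        qed
        moreover have "w j = (\<Sum>i\<in>I. x' i * l i j)" if j: "j \<in> J" for j
        proof -
          have "(\<Sum>i\<in>I. x i * l' i j) = (\<Sum>i\<in>I. x i * l i j) - (\<Sum>i\<in>I. x i * a i) * l i0 j"
            by (simp add: l'_def right_diff_distrib sum_subtractf sum_distrib_right mult.assoc)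
          then show ?thesis using x[OF j] unfolding x' by (simp add: t_def left_diff_distrib)
        qed
        ultimately show ?thesis by blast
      qed
      then show ?thesis by blast
    qed
  qed
qed simp

section \<open>Coordinates on the real tensor product\<close>

lemma (in abelian_group) minus_eqI:
  "x \<in> carrier G \<Longrightarrow> y \<in> carrier G \<Longrightarrow> x \<oplus> y = z \<Longrightarrow> z \<ominus> y = x"
  by (auto simp: a_minus_def a_assoc r_neg)

context comm_group
begin

abbreviation V :: "(real, ('a \<times> real \<Rightarrow>\<^sub>0 int) set) module" where
  "V \<equiv> real_tensor G"

lemma pure_tensor_closed: "a \<in> carrier G \<Longrightarrow> pure_tensor G a r \<in> carrier V"
  by (auto simp: pure_tensor_def tensor_carrier intro: tensor_free_frag)

lemma pure_tensor_mult:
  assumes "a \<in> carrier G" "b \<in> carrier G"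
  shows "pure_tensor G (a \<otimes> b) r = pure_tensor G a r \<oplus>\<^bsub>V\<^esub> pure_tensor G b r"
  using assms tensor_relations_left[of a b r]
  by (simp add: pure_tensor_def tensor_add tensor_free_frag tensor_coset_eq_iff diff_diff_eq)

lemma pure_tensor_add:
  assumes "a \<in> carrier G"
  shows "pure_tensor G a (r + s) = pure_tensor G a r \<oplus>\<^bsub>V\<^esub> pure_tensor G a s"
  using assms tensor_relations_right[of a r s]
  by (simp add: pure_tensor_def tensor_add tensor_free_frag tensor_coset_eq_iff diff_diff_eq)

lemma smult_pure_tensor: "c \<odot>\<^bsub>V\<^esub> pure_tensor G a r = pure_tensor G a (c * r)"
  by (simp add: pure_tensor_def tensor_smult)

lemma pure_tensor_zero:
  assumes "a \<in> carrier G"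
  shows "pure_tensor G a 0 = \<zero>\<^bsub>V\<^esub>"
proof -
  interpret V: vectorspace class_ring "V" by (rule real_tensor_vectorspace)
  have "0 \<odot>\<^bsub>V\<^esub> pure_tensor G a 0 = \<zero>\<^bsub>V\<^esub>"
    using V.smult_l_null[OF pure_tensor_closed[OF assms]] by simp
  then show ?thesis by (simp add: smult_pure_tensor)
qed

lemma pure_tensor_one: "pure_tensor G \<one> r = \<zero>\<^bsub>V\<^esub>"
proof -
  interpret V: vectorspace class_ring "V" by (rule real_tensor_vectorspace)
  have "pure_tensor G \<one> r \<oplus>\<^bsub>V\<^esub> pure_tensor G \<one> r = pure_tensor G \<one> r"
    using pure_tensor_mult[of \<one> \<one> r] by simp
  then show ?thesis
    using pure_tensor_closed[of \<one> r] by (simp add: V.M.add.r_cancel_one)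
qed

lemma pure_tensor_nat_pow: "a \<in> carrier G \<Longrightarrow> pure_tensor G (a [^] (n::nat)) r = pure_tensor G a (real n * r)"
proof (induction n)
  case (Suc n)
  then show ?case
    using pure_tensor_add[of a "real n * r" r] by (simp add: pure_tensor_mult algebra_simps)
qed (simp add: pure_tensor_one pure_tensor_zero)

lemma pure_tensor_inv:
  assumes "a \<in> carrier G"
  shows "pure_tensor G (inv a) r = pure_tensor G a (- r)"
proof -
  interpret V: vectorspace class_ring "V" by (rule real_tensor_vectorspace)
  have "pure_tensor G (inv a) r \<oplus>\<^bsub>V\<^esub> pure_tensor G a r =
      pure_tensor G a (- r) \<oplus>\<^bsub>V\<^esub> pure_tensor G a r"
    using assms pure_tensor_mult[of "inv a" a r] pure_tensor_add[of a "- r" r]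
    by (simp add: pure_tensor_one pure_tensor_zero)
  then show ?thesis
    using assms V.M.add.right_cancel by (simp add: pure_tensor_closed)
qed

lemma pure_tensor_int_pow:
  "a \<in> carrier G \<Longrightarrow> pure_tensor G (a [^] (n::int)) r = pure_tensor G a (real_of_int n * r)"
  by (cases n) (simp_all only: int_pow_int int_pow_neg_int pure_tensor_nat_pow pure_tensor_inv
      nat_pow_closed of_int_of_nat_eq of_int_minus mult_minus_left mult_minus_right)

definition combination :: "'a set \<Rightarrow> ('a \<Rightarrow> real) \<Rightarrow> ('a \<times> real \<Rightarrow>\<^sub>0 int) set" where
  "combination I c = finsum V (\<lambda>i. pure_tensor G i (c i)) I"

lemma combination_closed: "I \<subseteq> carrier G \<Longrightarrow> combination I c \<in> carrier V"
proof -
  interpret V: vectorspace class_ring "V" by (rule real_tensor_vectorspace)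
  show "I \<subseteq> carrier G \<Longrightarrow> combination I c \<in> carrier V"
    unfolding combination_def by (intro V.M.finsum_closed) (auto intro: pure_tensor_closed)
qed

lemma combination_empty: "combination {} c = \<zero>\<^bsub>V\<^esub>"
proof -
  interpret V: vectorspace class_ring "V" by (rule real_tensor_vectorspace)
  show ?thesis by (simp add: combination_def V.M.finsum_empty)
qed

lemma combination_insert:
  assumes "finite I" "j \<notin> I" "insert j I \<subseteq> carrier G"
  shows "combination (insert j I) c = pure_tensor G j (c j) \<oplus>\<^bsub>V\<^esub> combination I c"
proof -
  interpret V: vectorspace class_ring "V" by (rule real_tensor_vectorspace)
  show ?thesis
    unfolding combination_def using assms by (intro V.M.finsum_insert) (auto intro: pure_tensor_closed)
qed

lemma combination_cong:
  assumes "I \<subseteq> carrier G" "\<And>i. i \<in> I \<Longrightarrow> c i = d i"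
  shows "combination I c = combination I d"
proof -
  interpret V: vectorspace class_ring "V" by (rule real_tensor_vectorspace)
  show ?thesis
    unfolding combination_def using assms by (intro V.M.finsum_cong') (auto intro: pure_tensor_closed)
qed

lemma combination_add:
  assumes "I \<subseteq> carrier G"
  shows "combination I (\<lambda>i. c i + d i) = combination I c \<oplus>\<^bsub>V\<^esub> combination I d"
proof -
  interpret V: vectorspace class_ring "V" by (rule real_tensor_vectorspace)
  have "combination I (\<lambda>i. c i + d i) =
      finsum V (\<lambda>i. pure_tensor G i (c i) \<oplus>\<^bsub>V\<^esub> pure_tensor G i (d i)) I"
    unfolding combination_def using assms
    by (intro V.M.finsum_cong') (auto simp: pure_tensor_add subset_iff intro: pure_tensor_closed)
  also have "\<dots> = combination I c \<oplus>\<^bsub>V\<^esub> combination I d"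
    unfolding combination_def using assms by (intro V.M.finsum_addf) (auto intro: pure_tensor_closed)
  finally show ?thesis .
qed

lemma smult_combination:
  assumes "finite I" "I \<subseteq> carrier G"
  shows "a \<odot>\<^bsub>V\<^esub> combination I c = combination I (\<lambda>i. a * c i)"
proof -
  interpret V: vectorspace class_ring "V" by (rule real_tensor_vectorspace)
  have "a \<odot>\<^bsub>V\<^esub> combination I c =
      finsum V (\<lambda>i. a \<odot>\<^bsub>V\<^esub> pure_tensor G i (c i)) I"
    unfolding combination_def using assms
    by (intro V.finsum_smult_ldistr) (auto intro: pure_tensor_closed)
  then show ?thesis by (simp add: combination_def smult_pure_tensor)
qed

lemma pure_tensor_monomial:
  assumes "finite I" "I \<subseteq> carrier G"
  shows "pure_tensor G (monomial I n) r = combination I (\<lambda>i. real_of_int (n i) * r)"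
  using assms
proof (induction I)
  case empty
  then show ?case by (simp add: combination_empty pure_tensor_one)
next
  case (insert j I)
  then show ?case
    by (simp add: monomial_insert combination_insert pure_tensor_mult pure_tensor_int_pow monomial_closed)
qed

section \<open>Linear functionals in coordinates\<close>

lemma linear_combination:
  fixes F :: "('a \<times> real \<Rightarrow>\<^sub>0 int) set \<Rightarrow> real"
  assumes "\<And>x y. x \<in> carrier V \<Longrightarrow> y \<in> carrier V \<Longrightarrow>
      F (x \<oplus>\<^bsub>V\<^esub> y) = F x + F y"
    and "\<And>c x. x \<in> carrier V \<Longrightarrow> F (c \<odot>\<^bsub>V\<^esub> x) = c * F x"
    and "finite I" "I \<subseteq> carrier G"
  shows "F (combination I c) = (\<Sum>i\<in>I. c i * F (pure_tensor G i 1))"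
  using assms(3,4)
proof (induction I)
  case empty
  interpret V: vectorspace class_ring "V" by (rule real_tensor_vectorspace)
  show ?case using assms(1)[OF V.M.zero_closed V.M.zero_closed] by (simp add: combination_empty)
next
  case (insert j I)
  have "F (pure_tensor G j (c j)) = c j * F (pure_tensor G j 1)"
    using assms(2)[of "pure_tensor G j 1" "c j"] insert.prems
    by (simp add: smult_pure_tensor pure_tensor_closed)
  then show ?case
    using insert assms(1) by (simp add: combination_insert pure_tensor_closed combination_closed)
qed

lemma functional_combination:
  assumes "\<phi> \<in> carrier (real_hom G)" "finite I" "I \<subseteq> carrier G"
  shows "functional \<phi> (combination I c) = (\<Sum>i\<in>I. c i * \<phi> i)"
proof -
  have "functional \<phi> (combination I c) = (\<Sum>i\<in>I. c i * functional \<phi> (pure_tensor G i 1))"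
    using assms functional_linear[OF assms(1)] by (intro linear_combination) auto
  also have "\<dots> = (\<Sum>i\<in>I. c i * \<phi> i)"
    using assms by (intro sum.cong) (auto simp: functional_pure_tensor)
  finally show ?thesis .
qed

lemma functional_zero:
  assumes "\<phi> \<in> carrier (real_hom G)"
  shows "functional \<phi> \<zero>\<^bsub>V\<^esub> = 0"
  using functional_combination[OF assms, of "{}"] by (simp add: combination_empty)

lemma functional_minus:
  assumes "\<phi> \<in> carrier (real_hom G)" "X \<in> carrier V" "Y \<in> carrier V"
  shows "functional \<phi> (X \<ominus>\<^bsub>V\<^esub> Y) = functional \<phi> X - functional \<phi> Y"
proof -
  interpret V: vectorspace class_ring "V" by (rule real_tensor_vectorspace)
  have "(X \<ominus>\<^bsub>V\<^esub> Y) \<oplus>\<^bsub>V\<^esub> Y = X"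
    using assms by (simp add: a_minus_def V.M.a_assoc V.M.l_neg)
  then show ?thesis
    using functional_linear(1)[OF assms(1), of "X \<ominus>\<^bsub>V\<^esub> Y" Y] assms by simp
qed

lemma coordinates_finite: "coordinates I e \<Longrightarrow> finite I"
  and coordinates_subset: "coordinates I e \<Longrightarrow> I \<subseteq> carrier G"
  and coordinates_hom: "coordinates I e \<Longrightarrow> i \<in> I \<Longrightarrow> e i \<in> carrier (real_hom G)"
  and coordinates_dual: "coordinates I e \<Longrightarrow> i \<in> I \<Longrightarrow> j \<in> I \<Longrightarrow> e i j = (if i = j then 1 else 0)"
  and coordinates_finite_ball: "coordinates I e \<Longrightarrow> finite {a \<in> carrier G. \<forall>i\<in>I. \<bar>e i a\<bar> \<le> B}"
  by (simp_all add: coordinates_def)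

text \<open>The tensor of \<open>a\<close> and \<open>r\<close> equals that of a^k and r / k, and
  a^k is a monomial in \<open>I\<close>. Dividing by k on the real side is what removes the
  torsion.\<close>

lemma pure_tensor_coordinates:
  assumes "coordinates I e" "a \<in> carrier G"
  shows "pure_tensor G a r = combination I (\<lambda>i. r * e i a)"
proof -
  obtain k :: nat and n where k: "k > 0" "a [^] k = monomial I n" "\<And>i. i \<in> I \<Longrightarrow> real_of_int (n i) = real k * e i a"
    using assms unfolding coordinates_def by blast
  have "pure_tensor G a r = pure_tensor G (a [^] k) (r / real k)"
    using assms(2) k(1) by (simp add: pure_tensor_nat_pow)
  also have "\<dots> = combination I (\<lambda>i. real_of_int (n i) * (r / real k))"
    using assms by (simp add: k(2) pure_tensor_monomial coordinates_finite coordinates_subset)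
  also have "\<dots> = combination I (\<lambda>i. r * e i a)"
    using k(1,3) coordinates_subset[OF assms(1)] by (intro combination_cong) auto
  finally show ?thesis .
qed

lemma tensor_coordinates:
  assumes "coordinates I e" "X \<in> carrier V"
  shows "X = combination I (\<lambda>i. functional (e i) X)"
proof -
  interpret V: vectorspace class_ring "V" by (rule real_tensor_vectorspace)
  note I = coordinates_finite[OF assms(1)] coordinates_subset[OF assms(1)]
  let ?c = "\<lambda>u. tensor_relations G #>\<^bsub>tensor_free G\<^esub> u"
  obtain u where u: "u \<in> carrier (tensor_free G)" "X = ?c u"
    using assms(2) by (rule tensor_cases)
  from u(1) have "?c u = combination I (\<lambda>i. functional_rep (e i) u)"
  proof (induction rule: tensor_free_induct)
    case zero
    have "combination I (\<lambda>_. 0) = \<zero>\<^bsub>V\<^esub>"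
      using smult_combination[OF I, of 0 "\<lambda>_. 0"] V.smult_l_null[OF combination_closed[OF I(2)]] by simp
    then show ?case by (simp add: tensor_zero)
  next
    case (diff u v)
    let ?d = "combination I (\<lambda>i. functional_rep (e i) (u - v))"
    have uv: "u - v \<in> carrier (tensor_free G)" using diff(1,2) by (rule tensor_free_diff)
    have "?c (u - v) \<oplus>\<^bsub>V\<^esub> ?c v = ?c u"
      using tensor_add[OF uv diff(2)] by simp
    also have "\<dots> = combination I (\<lambda>i. functional_rep (e i) (u - v) + functional_rep (e i) v)"
      by (simp add: diff(3) functional_rep_diff)
    also have "\<dots> = ?d \<oplus>\<^bsub>V\<^esub> ?c v"
      using I(2) by (simp add: combination_add diff(4))
    finally show ?case
      using V.M.add.right_cancel[of "?c v" "?c (u - v)" ?d] uv diff(2) combination_closed[OF I(2)]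
      by (simp add: tensor_carrier)
  next
    case (frag a r)
    then show ?case
      using pure_tensor_coordinates[OF assms(1) frag, of r] by (simp add: pure_tensor_def)
  qed
  also have "\<dots> = combination I (\<lambda>i. functional (e i) X)"
    using I by (intro combination_cong) (auto simp: u(2) functional_coset coordinates_hom[OF assms(1)])
  finally show ?thesis using u(2) by simp
qed

lemma tensor_eqI:
  assumes "coordinates I e" "X \<in> carrier V" "Y \<in> carrier V"
    and "\<And>i. i \<in> I \<Longrightarrow> functional (e i) X = functional (e i) Y"
  shows "X = Y"
proof -
  have "X = combination I (\<lambda>i. functional (e i) X)" using assms by (intro tensor_coordinates)
  also have "\<dots> = combination I (\<lambda>i. functional (e i) Y)"
    using assms(4) coordinates_subset[OF assms(1)] by (intro combination_cong)
  also have "\<dots> = Y" using assms by (intro tensor_coordinates[symmetric])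
  finally show ?thesis .
qed

lemma functional_coordinate_combination:
  assumes "coordinates I e" "i \<in> I"
  shows "functional (e i) (combination I c) = c i"
proof -
  have "functional (e i) (combination I c) = (\<Sum>j\<in>I. c j * e i j)"
    using assms coordinates_finite coordinates_subset coordinates_hom by (intro functional_combination) auto
  also have "\<dots> = (\<Sum>j\<in>I. if j = i then c i else 0)"
    by (intro sum.cong) (auto simp: coordinates_dual[OF assms])
  finally show ?thesis using assms coordinates_finite[OF assms(1)] by simp
qed

lemma linear_coordinates:
  fixes F :: "('a \<times> real \<Rightarrow>\<^sub>0 int) set \<Rightarrow> real"
  assumes "\<And>x y. x \<in> carrier V \<Longrightarrow> y \<in> carrier V \<Longrightarrow>
      F (x \<oplus>\<^bsub>V\<^esub> y) = F x + F y"
    and "\<And>c x. x \<in> carrier V \<Longrightarrow> F (c \<odot>\<^bsub>V\<^esub> x) = c * F x"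
    and "coordinates I e" "X \<in> carrier V"
  shows "F X = (\<Sum>i\<in>I. functional (e i) X * F (pure_tensor G i 1))"
proof -
  have "F X = F (combination I (\<lambda>i. functional (e i) X))"
    using tensor_coordinates[OF assms(3,4)] by simp
  also have "\<dots> = (\<Sum>i\<in>I. functional (e i) X * F (pure_tensor G i 1))"
    using assms coordinates_finite coordinates_subset by (intro linear_combination) auto
  finally show ?thesis .
qed

lemma real_hom_coordinates:
  assumes "coordinates I e" "\<phi> \<in> carrier (real_hom G)" "a \<in> carrier G"
  shows "\<phi> a = (\<Sum>i\<in>I. e i a * \<phi> i)"
proof -
  have "functional \<phi> (pure_tensor G a 1) =
      (\<Sum>i\<in>I. functional (e i) (pure_tensor G a 1) * functional \<phi> (pure_tensor G i 1))"
    using assms functional_linear[OF assms(2)] pure_tensor_closed by (intro linear_coordinates) auto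
  also have "\<dots> = (\<Sum>i\<in>I. e i a * \<phi> i)"
    using assms coordinates_subset[OF assms(1)] coordinates_hom[OF assms(1)]
    by (intro sum.cong) (auto simp: functional_pure_tensor subset_iff)
  finally show ?thesis using assms by (simp add: functional_pure_tensor)
qed

section \<open>Equivalence of an arbitrary norm with the sum of absolute coordinates\<close>

lemma norm_zero:
  assumes "vs_norm V nm"
  shows "nm \<zero>\<^bsub>V\<^esub> = 0"
proof -
  interpret V: vectorspace class_ring "V" by (rule real_tensor_vectorspace)
  show ?thesis using assms V.M.zero_closed by (auto simp: vs_norm_def)
qed

lemma norm_combination_le:
  assumes "vs_norm V nm" "finite I" "I \<subseteq> carrier G"
  shows "nm (combination I c) \<le> (\<Sum>i\<in>I. \<bar>c i\<bar> * nm (pure_tensor G i 1))"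
  using assms(2,3)
proof (induction I)
  case empty
  then show ?case using norm_zero[OF assms(1)] by (simp add: combination_empty)
next
  case (insert j I)
  have "nm (combination (insert j I) c) \<le> nm (pure_tensor G j (c j)) + nm (combination I c)"
    using insert assms(1) combination_closed[of I c] pure_tensor_closed[of j "c j"]
    by (simp add: combination_insert vs_norm_def)
  also have "nm (c j \<odot>\<^bsub>V\<^esub> pure_tensor G j 1) = \<bar>c j\<bar> * nm (pure_tensor G j 1)"
    using assms(1) pure_tensor_closed[of j 1] insert.prems unfolding vs_norm_def by blast
  then have "nm (pure_tensor G j (c j)) = \<bar>c j\<bar> * nm (pure_tensor G j 1)"
    by (simp add: smult_pure_tensor)
  finally show ?case using insert by simp
qed

lemma norm_le_coordinates:
  assumes "vs_norm V nm" "coordinates I e"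
  obtains C where "0 \<le> C" "\<And>X. X \<in> carrier V \<Longrightarrow> nm X \<le> C * (\<Sum>i\<in>I. \<bar>functional (e i) X\<bar>)"
proof
  note I = coordinates_finite[OF assms(2)] coordinates_subset[OF assms(2)]
  have nn: "0 \<le> nm (pure_tensor G i 1)" if "i \<in> I" for i
    using assms(1) pure_tensor_closed[of i 1] that I by (auto simp: vs_norm_def)
  let ?C = "\<Sum>i\<in>I. nm (pure_tensor G i 1)"
  show "0 \<le> ?C" using nn by (intro sum_nonneg)
  fix X assume "X \<in> carrier V"
  then have "nm X = nm (combination I (\<lambda>i. functional (e i) X))"
    using tensor_coordinates[OF assms(2)] by metis
  also have "\<dots> \<le> (\<Sum>i\<in>I. \<bar>functional (e i) X\<bar> * nm (pure_tensor G i 1))"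
    using assms(1) I by (rule norm_combination_le)
  also have "\<dots> \<le> (\<Sum>i\<in>I. \<bar>functional (e i) X\<bar> * ?C)"
    using nn I(1) by (intro sum_mono mult_left_mono member_le_sum) auto
  also have "\<dots> = ?C * (\<Sum>i\<in>I. \<bar>functional (e i) X\<bar>)"
    by (subst sum_distrib_right[symmetric]) (rule mult.commute)
  finally show "nm X \<le> ?C * (\<Sum>i\<in>I. \<bar>functional (e i) X\<bar>)" .
qed

text \<open>The limit of a subsequence of hypothetical counterexamples, normalised to have coordinates of
  absolute sum \<open>1\<close>, would be a nonzero vector of norm \<open>0\<close>.\<close>
lemma coordinates_le_norm:
  assumes "vs_norm V nm" "coordinates I e"
  obtains C where "0 \<le> C"
    "\<And>X. X \<in> carrier V \<Longrightarrow> (\<Sum>i\<in>I. \<bar>functional (e i) X\<bar>) \<le> C * nm X"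
proof -
  interpret V: vectorspace class_ring "V" by (rule real_tensor_vectorspace)
  note I = coordinates_finite[OF assms(2)] coordinates_subset[OF assms(2)]
  let ?s = "\<lambda>X. \<Sum>i\<in>I. \<bar>functional (e i) X\<bar>"
  have "\<exists>n::nat. \<forall>X\<in>carrier V. ?s X \<le> real (Suc n) * nm X"
  proof (rule ccontr)
    assume "\<not> ?thesis"
    then obtain X where X: "\<And>n. X n \<in> carrier V" "\<And>n::nat. real (Suc n) * nm (X n) < ?s (X n)"
      unfolding not_ex not_all Ball_def not_imp not_le by metis
    have nm0: "0 \<le> nm (X n)" for n using X(1) assms(1) by (simp add: vs_norm_def)
    have s0: "0 < ?s (X n)" for n
      using X(2)[of n] nm0[of n] mult_nonneg_nonneg[of "real (Suc n)" "nm (X n)"] by linarith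
    define Y where "Y n = (1 / ?s (X n)) \<odot>\<^bsub>V\<^esub> X n" for n
    have Yc: "Y n \<in> carrier V" for n
      unfolding Y_def using X(1) by (intro V.smult_closed) auto
    have Yf: "functional (e i) (Y n) = functional (e i) (X n) / ?s (X n)" if "i \<in> I" for i n
      using functional_linear(2)[OF coordinates_hom[OF assms(2) that] X(1) X(1), of "1 / ?s (X n)" n]
      by (simp add: Y_def)
    have Ys: "?s (Y n) = 1" for n
    proof -
      have "?s (Y n) = (\<Sum>i\<in>I. \<bar>functional (e i) (X n)\<bar> / ?s (X n))"
        using s0[of n] by (intro sum.cong) (simp_all add: Yf)
      also have "\<dots> = 1" using s0[of n] by (simp flip: sum_divide_distrib)
      finally show ?thesis .
    qed
    have Yn: "nm (Y n) < 1 / real (Suc n)" for n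
    proof -
      have "nm (Y n) = 1 / ?s (X n) * nm (X n)"
        using assms(1) X(1)[of n] s0[of n] by (simp add: vs_norm_def Y_def)
      moreover have "nm (X n) < ?s (X n) / real (Suc n)"
        using X(2)[of n] by (simp add: field_simps)
      ultimately show ?thesis
        using divide_strict_right_mono[of "nm (X n)" "?s (X n) / real (Suc n)" "?s (X n)"] s0[of n] by simp
    qed
    have "\<bar>functional (e i) (Y n)\<bar> \<le> 1" if "i \<in> I" for i n
      using member_le_sum[of i I "\<lambda>i. \<bar>functional (e i) (Y n)\<bar>"] that I Ys[of n] by auto
    then obtain r y where r: "strict_mono r" "\<And>i. i \<in> I \<Longrightarrow> (\<lambda>n. functional (e i) (Y (r n))) \<longlonglongrightarrow> y i"
      using convergent_subseq_finite[OF I(1), of "\<lambda>n i. functional (e i) (Y n)" 1] by blast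
    define Z where "Z = combination I y"
    have Zc: "Z \<in> carrier V" using combination_closed I by (simp add: Z_def)
    have Zf: "functional (e i) Z = y i" if "i \<in> I" for i
      using functional_coordinate_combination[OF assms(2) that] by (simp add: Z_def)
    have "(\<lambda>n. ?s (Y (r n))) \<longlonglongrightarrow> (\<Sum>i\<in>I. \<bar>y i\<bar>)"
      by (intro tendsto_intros r(2))
    then have sy: "(\<Sum>i\<in>I. \<bar>y i\<bar>) = 1"
      using Ys LIMSEQ_unique[OF tendsto_const] by fastforce
    obtain C where C: "0 \<le> C" "\<And>X. X \<in> carrier V \<Longrightarrow> nm X \<le> C * ?s X"
      using norm_le_coordinates[OF assms] by blast
    \<comment> \<open>Z differs from a term of the subsequence by a vector with small coordinates,
      hence of small norm by the easy inequality, while the norm of that term itself tends to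
      0.\<close>
    have bound: "nm Z \<le> C * (\<Sum>i\<in>I. \<bar>y i - functional (e i) (Y (r n))\<bar>) + 1 / real (Suc (r n))" for n
    proof -
      let ?W = "Z \<ominus>\<^bsub>V\<^esub> Y (r n)"
      have W: "?W \<in> carrier V" using Zc Yc by simp
      have "Z = ?W \<oplus>\<^bsub>V\<^esub> Y (r n)"
        using Zc Yc[of "r n"] by (simp add: a_minus_def V.M.a_assoc V.M.l_neg)
      then have "nm Z \<le> nm ?W + nm (Y (r n))"
        using assms(1) W Yc[of "r n"] unfolding vs_norm_def by metis
      also have "nm ?W \<le> C * ?s ?W" using C(2) W .
      also have "?s ?W = (\<Sum>i\<in>I. \<bar>y i - functional (e i) (Y (r n))\<bar>)"
        using Zc Yc by (intro sum.cong) (simp_all add: functional_minus coordinates_hom[OF assms(2)] Zf)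
      finally show ?thesis using Yn[of "r n"] by simp
    qed
    have "(\<lambda>n. C * (\<Sum>i\<in>I. \<bar>y i - functional (e i) (Y (r n))\<bar>) + 1 / real (Suc (r n))) \<longlonglongrightarrow>
        C * (\<Sum>i\<in>I. \<bar>y i - y i\<bar>) + 0"
      by (intro tendsto_intros r(2) LIMSEQ_subseq_LIMSEQ[OF _ r(1), of "\<lambda>n. 1 / real (Suc n)", unfolded o_def])
        (use LIMSEQ_inverse_real_of_nat[unfolded inverse_eq_divide] in \<open>simp_all del: of_nat_Suc\<close>)
    then have "nm Z \<le> C * (\<Sum>i\<in>I. \<bar>y i - y i\<bar>) + 0"
      by (rule LIMSEQ_le_const) (use bound in blast)
    then have "nm Z = 0" using assms(1) Zc by (simp add: vs_norm_def order_antisym)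
    then have "Z = \<zero>\<^bsub>V\<^esub>" using assms(1) Zc by (simp add: vs_norm_def)
    then have "y i = 0" if "i \<in> I" for i
      using Zf[OF that] functional_zero[OF coordinates_hom[OF assms(2) that]] by simp
    then show False using sy by simp
  qed
  then obtain n :: nat where "\<And>X. X \<in> carrier V \<Longrightarrow> ?s X \<le> real (Suc n) * nm X" by blast
  then show ?thesis using that[of "real (Suc n)"] by simp
qed

text \<open>Each direction uses one of the two inequalities between norm and coordinates. Through
  this equivalence the quasimorphism arguments can work with real-valued coordinates.\<close>

lemma bounded_distance_coordinates:
  assumes "vs_norm V nm" "coordinates I e"
    and "\<And>x. x \<in> X \<Longrightarrow> f x \<in> carrier V" "\<And>x. x \<in> X \<Longrightarrow> g x \<in> carrier V"
  shows "bounded_distance V nm X f g \<longleftrightarrow>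
    (\<exists>B. \<forall>x\<in>X. \<forall>i\<in>I. \<bar>functional (e i) (f x) - functional (e i) (g x)\<bar> \<le> B)"
proof -
  interpret V: vectorspace class_ring "V" by (rule real_tensor_vectorspace)
  note I = coordinates_finite[OF assms(2)] coordinates_subset[OF assms(2)]
  let ?D = "\<lambda>x. f x \<ominus>\<^bsub>V\<^esub> g x"
  have D: "?D x \<in> carrier V" if "x \<in> X" for x using assms(3,4)[OF that] by simp
  have fD: "functional (e i) (?D x) = functional (e i) (f x) - functional (e i) (g x)" if "x \<in> X" "i \<in> I" for x i
    using assms(3,4) that coordinates_hom[OF assms(2)] by (intro functional_minus) auto
  show ?thesis
  proof
    assume "bounded_distance V nm X f g"
    then obtain B where B: "\<And>x. x \<in> X \<Longrightarrow> nm (?D x) \<le> B"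
      by (auto simp: bounded_distance_def bdd_above_def)
    obtain C where C: "0 \<le> C"
      "\<And>X. X \<in> carrier V \<Longrightarrow> (\<Sum>i\<in>I. \<bar>functional (e i) X\<bar>) \<le> C * nm X"
      using coordinates_le_norm[OF assms(1,2)] by blast
    have "\<bar>functional (e i) (f x) - functional (e i) (g x)\<bar> \<le> C * B" if x: "x \<in> X" and i: "i \<in> I" for x i
    proof -
      have "\<bar>functional (e i) (?D x)\<bar> \<le> (\<Sum>i\<in>I. \<bar>functional (e i) (?D x)\<bar>)"
        using I i by (intro member_le_sum) auto
      also have "\<dots> \<le> C * nm (?D x)" using C(2) D x by blast
      also have "\<dots> \<le> C * B" using B[OF x] C(1) by (rule mult_left_mono)
      finally show ?thesis using fD[OF x i] by simp
    qed
    then show "\<exists>B. \<forall>x\<in>X. \<forall>i\<in>I. \<bar>functional (e i) (f x) - functional (e i) (g x)\<bar> \<le> B" by blast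
  next
    assume "\<exists>B. \<forall>x\<in>X. \<forall>i\<in>I. \<bar>functional (e i) (f x) - functional (e i) (g x)\<bar> \<le> B"
    then obtain B where B: "\<And>x i. x \<in> X \<Longrightarrow> i \<in> I \<Longrightarrow> \<bar>functional (e i) (f x) - functional (e i) (g x)\<bar> \<le> B"
      by blast
    obtain C where C: "0 \<le> C"
      "\<And>X. X \<in> carrier V \<Longrightarrow> nm X \<le> C * (\<Sum>i\<in>I. \<bar>functional (e i) X\<bar>)"
      using norm_le_coordinates[OF assms(1,2)] by blast
    have "nm (?D x) \<le> C * (\<Sum>i\<in>I. B)" if x: "x \<in> X" for x
    proof -
      have "nm (?D x) \<le> C * (\<Sum>i\<in>I. \<bar>functional (e i) (?D x)\<bar>)" using C(2) D x by blast
      also have "\<dots> \<le> C * (\<Sum>i\<in>I. B)"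
        using B x C(1) by (intro mult_left_mono sum_mono) (simp_all add: fD)
      finally show ?thesis .
    qed
    then show "bounded_distance V nm X f g"
      by (auto simp: bounded_distance_def bdd_above_def)
  qed
qed

end

section \<open>Norms on the space of real tuples\<close>

lemma coord_space_minus:
  assumes "v \<in> carrier (coord_space r)" "w \<in> carrier (coord_space r)"
  shows "v \<ominus>\<^bsub>coord_space r\<^esub> w = (\<lambda>i\<in>{1..r}. v i - w i)"
proof -
  interpret V: Module.module class_ring "coord_space r" by (rule class_cring.func_space_is_module)
  show ?thesis
  proof (rule V.minus_eqI)
    show "(\<lambda>i\<in>{1..r}. v i - w i) \<oplus>\<^bsub>coord_space r\<^esub> w = v"
      using assms by (auto simp: class_ring.func_space_def fun_eq_iff PiE_def extensional_def)
  qed (use assms in \<open>auto simp: class_ring.func_space_def\<close>)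
qed

lemma coord_space_norm_le:
  assumes "vs_norm (coord_space r) nr"
  obtains C where "0 \<le> C" "\<And>v. v \<in> carrier (coord_space r) \<Longrightarrow> nr v \<le> C * (\<Sum>i\<in>{1..r}. \<bar>v i\<bar>)"
proof
  define d where "d i = (\<lambda>j\<in>{1..r}. if j = i then 1 else (0::real))" for i
  let ?C = "\<Sum>i\<in>{1..r}. nr (d i)"
  have dc: "d i \<in> carrier (coord_space r)" for i by (simp add: d_def class_ring.func_space_def)
  have nn: "0 \<le> nr (d i)" for i using assms dc by (auto simp: vs_norm_def)
  then show "0 \<le> ?C" by (intro sum_nonneg)
  fix v assume v: "v \<in> carrier (coord_space r)"
  \<comment> \<open>Truncation to the first k coordinates, so that the triangle inequality adds one
    multiple of a unit vector at a time.\<close>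
  define t where "t k = (\<lambda>i\<in>{1..r}. if i \<le> k then v i else 0)" for k
  have tc: "t k \<in> carrier (coord_space r)" for k by (simp add: t_def class_ring.func_space_def)
  have "nr (t k) \<le> (\<Sum>i\<in>{1..k}. \<bar>v i\<bar> * nr (d i))" if "k \<le> r" for k
    using that
  proof (induction k)
    case 0
    have "t 0 = \<zero>\<^bsub>coord_space r\<^esub>"
      by (auto simp: t_def class_ring.func_space_def fun_eq_iff)
    then have "nr (t 0) = 0" using assms tc[of 0] unfolding vs_norm_def by blast
    then show ?case by simp
  next
    case (Suc k)
    have sc: "v (Suc k) \<odot>\<^bsub>coord_space r\<^esub> d (Suc k) \<in> carrier (coord_space r)"
      by (simp add: d_def class_ring.func_space_def)
    have "t (Suc k) = t k \<oplus>\<^bsub>coord_space r\<^esub> (v (Suc k) \<odot>\<^bsub>coord_space r\<^esub> d (Suc k))"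
      by (auto simp: t_def d_def class_ring.func_space_def fun_eq_iff le_Suc_eq)
    then have "nr (t (Suc k)) \<le> nr (t k) + nr (v (Suc k) \<odot>\<^bsub>coord_space r\<^esub> d (Suc k))"
      using assms tc[of k] sc unfolding vs_norm_def by simp
    also have "nr (v (Suc k) \<odot>\<^bsub>coord_space r\<^esub> d (Suc k)) = \<bar>v (Suc k)\<bar> * nr (d (Suc k))"
      using assms dc unfolding vs_norm_def by blast
    finally show ?case using Suc by simp
  qed
  from this[of r] have "nr (t r) \<le> (\<Sum>i\<in>{1..r}. \<bar>v i\<bar> * nr (d i))" by simp
  also have "t r = v"
    using v by (auto simp: t_def class_ring.func_space_def fun_eq_iff PiE_def extensional_def)
  also have "(\<Sum>i\<in>{1..r}. \<bar>v i\<bar> * nr (d i)) \<le> (\<Sum>i\<in>{1..r}. \<bar>v i\<bar> * ?C)"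
    using nn by (intro sum_mono mult_left_mono member_le_sum) auto
  also have "\<dots> = ?C * (\<Sum>i\<in>{1..r}. \<bar>v i\<bar>)"
    by (subst sum_distrib_right[symmetric]) (rule mult.commute)
  finally show "nr v \<le> ?C * (\<Sum>i\<in>{1..r}. \<bar>v i\<bar>)" .
qed

section \<open>Linear maps between real tensor products\<close>

context comm_group
begin

lemma coordinate_monomial:
  assumes "coordinates I e" "i \<in> I"
  shows "e i (monomial I n) = real_of_int (n i)"
proof -
  note I = coordinates_finite[OF assms(1)] coordinates_subset[OF assms(1)]
  have "e i (monomial I n) = functional (e i) (pure_tensor G (monomial I n) 1)"
    using functional_pure_tensor[OF coordinates_hom[OF assms] monomial_closed[OF I(2)]] by simp
  also have "\<dots> = real_of_int (n i)"
    using functional_coordinate_combination[OF assms] by (simp add: pure_tensor_monomial[OF I])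
  finally show ?thesis .
qed

end

locale coordinate_pair = A: comm_group A + B: comm_group B
  for A :: "('a, 'c) monoid_scheme" and B :: "('b, 'd) monoid_scheme" +
  fixes I e J d
  assumes coordinates_A: "A.coordinates I e" and coordinates_B: "B.coordinates J d"
begin

lemma linear_map_iff:
  "linear_map class_ring A.V B.V L \<longleftrightarrow>
    L \<in> carrier A.V \<rightarrow> carrier B.V \<and>
    (\<forall>x\<in>carrier A.V. \<forall>y\<in>carrier A.V.
      L (x \<oplus>\<^bsub>A.V\<^esub> y) = L x \<oplus>\<^bsub>B.V\<^esub> L y) \<and>
    (\<forall>c. \<forall>x\<in>carrier A.V. L (c \<odot>\<^bsub>A.V\<^esub> x) = c \<odot>\<^bsub>B.V\<^esub> L x)"
  using A.real_tensor_vectorspace B.real_tensor_vectorspace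
  by (auto simp: linear_map_def mod_hom_def mod_hom_axioms_def LinearCombinations.module_hom_def vectorspace_def)

lemma linear_map_functional:
  assumes L: "linear_map class_ring A.V B.V L"
    and \<phi>: "\<phi> \<in> carrier (real_hom B)" and X: "X \<in> carrier A.V"
  shows "functional \<phi> (L X) = (\<Sum>i\<in>I. functional (e i) X * functional \<phi> (L (pure_tensor A i 1)))"
proof (rule A.linear_coordinates[OF _ _ coordinates_A X])
  fix x y assume "x \<in> carrier A.V" "y \<in> carrier A.V"
  then show "functional \<phi> (L (x \<oplus>\<^bsub>A.V\<^esub> y)) = functional \<phi> (L x) + functional \<phi> (L y)"
    using L B.functional_linear(1)[OF \<phi>, of "L x" "L y"] unfolding linear_map_iff by auto
next
  fix c x assume "x \<in> carrier A.V"
  then show "functional \<phi> (L (c \<odot>\<^bsub>A.V\<^esub> x)) = c * functional \<phi> (L x)"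
    using L B.functional_linear(2)[OF \<phi>, of "L x" "L x" c] unfolding linear_map_iff by auto
qed

lemma linear_map_closed:
  "linear_map class_ring A.V B.V L \<Longrightarrow> x \<in> carrier A.V \<Longrightarrow>
    L x \<in> carrier B.V"
  unfolding linear_map_iff by blast

lemma linear_map_ext:
  assumes L: "linear_map class_ring A.V B.V L"
    and L': "linear_map class_ring A.V B.V L'"
    and eq: "\<And>a. a \<in> carrier A \<Longrightarrow> L (pure_tensor A a 1) = L' (pure_tensor A a 1)"
    and X: "X \<in> carrier A.V"
  shows "L X = L' X"
proof (rule B.tensor_eqI[OF coordinates_B])
  show "L X \<in> carrier B.V" "L' X \<in> carrier B.V"
    using L L' X by (auto intro: linear_map_closed)
  fix j assume "j \<in> J"
  then have "d j \<in> carrier (real_hom B)" by (rule B.coordinates_hom[OF coordinates_B])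
  then show "functional (d j) (L X) = functional (d j) (L' X)"
    using linear_map_functional[OF L _ X] linear_map_functional[OF L' _ X] eq
      A.coordinates_subset[OF coordinates_A] by (simp add: subset_iff)
qed

text \<open>The matrix of L consists of the coordinates of \<open>h\<close> on \<open>I\<close>.
  Although \<open>I\<close> need not generate \<open>A\<close>, L agrees with \<open>h\<close>
  everywhere: each coordinate of \<open>h\<close> is a real homomorphism, and such a homomorphism is
  determined by its values on \<open>I\<close>.\<close>

lemma linear_map_lift:
  assumes h: "h \<in> hom A (add_monoid B.V)"
  obtains L where "linear_map class_ring A.V B.V L"
    "L \<in> extensional (carrier A.V)" "\<And>a. a \<in> carrier A \<Longrightarrow> h a = L (pure_tensor A a 1)"
proof
  note J = B.coordinates_finite[OF coordinates_B] B.coordinates_subset[OF coordinates_B]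
  let ?c = "\<lambda>X j. \<Sum>i\<in>I. functional (e i) X * functional (d j) (h i)"
  let ?L = "\<lambda>X\<in>carrier A.V. B.combination J (?c X)"
  interpret VA: vectorspace class_ring "A.V" by (rule A.real_tensor_vectorspace)
  have e: "e i \<in> carrier (real_hom A)" if "i \<in> I" for i
    using that by (rule A.coordinates_hom[OF coordinates_A])
  have dj: "d j \<in> carrier (real_hom B)" if "j \<in> J" for j
    using that by (rule B.coordinates_hom[OF coordinates_B])
  show "?L \<in> extensional (carrier A.V)" by simp
  show "linear_map class_ring A.V B.V ?L"
    unfolding linear_map_iff
  proof (intro conjI ballI allI)
    show "?L \<in> carrier A.V \<rightarrow> carrier B.V"
      using B.combination_closed[OF J(2)] by auto
    fix x assume x: "x \<in> carrier A.V"
    fix y assume y: "y \<in> carrier A.V"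
    have "B.combination J (?c (x \<oplus>\<^bsub>A.V\<^esub> y)) = B.combination J (\<lambda>j. ?c x j + ?c y j)"
      using x y by (intro B.combination_cong J)
        (simp add: A.functional_linear(1)[OF e] distrib_right sum.distrib cong: sum.cong)
    then show "?L (x \<oplus>\<^bsub>A.V\<^esub> y) = ?L x \<oplus>\<^bsub>B.V\<^esub> ?L y"
      using x y by (simp add: B.combination_add[OF J(2)])
  next
    fix c :: real and x assume x: "x \<in> carrier A.V"
    have "B.combination J (?c (c \<odot>\<^bsub>A.V\<^esub> x)) = B.combination J (\<lambda>j. c * ?c x j)"
      using x by (intro B.combination_cong J)
        (simp add: A.functional_linear(2)[OF e] sum_distrib_left mult.assoc cong: sum.cong)
    moreover have "c \<odot>\<^bsub>A.V\<^esub> x \<in> carrier A.V"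
      using x by (intro VA.smult_closed) auto
    ultimately show "?L (c \<odot>\<^bsub>A.V\<^esub> x) = c \<odot>\<^bsub>B.V\<^esub> ?L x"
      using x by (simp add: B.smult_combination[OF J])
  qed
  fix a assume a: "a \<in> carrier A"
  have ha: "h b \<in> carrier B.V" if "b \<in> carrier A" for b
    using h that by (auto simp: hom_def)
  show "h a = ?L (pure_tensor A a 1)"
  proof (rule B.tensor_eqI[OF coordinates_B ha[OF a]])
    show "?L (pure_tensor A a 1) \<in> carrier B.V"
      using a A.pure_tensor_closed B.combination_closed[OF J(2)] by simp
    fix j assume j: "j \<in> J"
    let ?\<phi> = "\<lambda>a\<in>carrier A. functional (d j) (h a)"
    have "?\<phi> \<in> carrier (real_hom A)"
      using h ha B.functional_linear(1)[OF dj[OF j]] by (auto simp: real_hom_carrier hom_def)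
    then have "?\<phi> a = (\<Sum>i\<in>I. e i a * ?\<phi> i)"
      using a by (rule A.real_hom_coordinates[OF coordinates_A])
    then have "functional (d j) (h a) = (\<Sum>i\<in>I. e i a * functional (d j) (h i))"
      using a A.coordinates_subset[OF coordinates_A] by (simp add: subset_iff cong: sum.cong)
    also have "\<dots> = functional (d j) (?L (pure_tensor A a 1))"
      using a A.pure_tensor_closed[OF a, of 1]
      by (simp add: B.functional_coordinate_combination[OF coordinates_B j] A.functional_pure_tensor[OF e] cong: sum.cong)
    finally show "functional (d j) (h a) = functional (d j) (?L (pure_tensor A a 1))" .
  qed
qed

text \<open>Surjectivity comes from \<open>orthogonal_or_spanning\<close>, since a nonzero covector
  vanishing on the image is excluded. Kernel and cokernel are separate hypotheses because different
  geometric arguments will deal with them.\<close>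

lemma linear_map_bij:
  assumes L: "linear_map class_ring A.V B.V L"
    and ker: "\<And>v. v \<in> carrier A.V \<Longrightarrow> L v = \<zero>\<^bsub>B.V\<^esub> \<Longrightarrow> v = \<zero>\<^bsub>A.V\<^esub>"
    and coker: "\<And>c. (\<And>i. i \<in> I \<Longrightarrow> (\<Sum>j\<in>J. c j * functional (d j) (L (pure_tensor A i 1))) = 0) \<Longrightarrow>
      \<forall>j\<in>J. c j = 0"
  shows "bij_betw L (carrier A.V) (carrier B.V)"
proof (rule bij_betw_imageI)
  interpret VA: vectorspace class_ring "A.V" by (rule A.real_tensor_vectorspace)
  interpret VB: vectorspace class_ring "B.V" by (rule B.real_tensor_vectorspace)
  note I = A.coordinates_finite[OF coordinates_A] A.coordinates_subset[OF coordinates_A]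
  show "inj_on L (carrier A.V)"
  proof (rule inj_onI)
    fix x y assume x: "x \<in> carrier A.V" and y: "y \<in> carrier A.V" and eq: "L x = L y"
    let ?z = "x \<ominus>\<^bsub>A.V\<^esub> y"
    have z: "?z \<in> carrier A.V" using x y by simp
    have xz: "?z \<oplus>\<^bsub>A.V\<^esub> y = x"
      using x y by (simp add: a_minus_def VA.M.a_assoc VA.M.l_neg)
    then have "L ?z \<oplus>\<^bsub>B.V\<^esub> L y = L y"
      using L z y eq unfolding linear_map_iff by metis
    then have "L ?z = \<zero>\<^bsub>B.V\<^esub>"
      using linear_map_closed[OF L] z y by (simp add: VB.M.add.l_cancel_one)
    then have "?z = \<zero>\<^bsub>A.V\<^esub>" using ker z by blast
    then show "x = y" using xz y by simp
  qed
  show "L ` carrier A.V = carrier B.V"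
  proof
    show "L ` carrier A.V \<subseteq> carrier B.V"
      using linear_map_closed[OF L] by auto
    show "carrier B.V \<subseteq> L ` carrier A.V"
    proof
      fix w assume w: "w \<in> carrier B.V"
      let ?l = "\<lambda>i j. functional (d j) (L (pure_tensor A i 1))"
      have span: "\<forall>w. \<exists>x. \<forall>j\<in>J. w j = (\<Sum>i\<in>I. x i * ?l i j)"
        using orthogonal_or_spanning[OF B.coordinates_finite[OF coordinates_B] I(1), of ?l] coker by blast
      then obtain x where x: "\<And>j. j \<in> J \<Longrightarrow> functional (d j) w = (\<Sum>i\<in>I. x i * ?l i j)"
        using span[THEN spec, of "\<lambda>j. functional (d j) w"] by blast
      let ?X = "A.combination I x"
      have X: "?X \<in> carrier A.V" using I by (intro A.combination_closed)
      have "w = L ?X"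
      proof (rule B.tensor_eqI[OF coordinates_B w linear_map_closed[OF L X]])
        fix j assume j: "j \<in> J"
        show "functional (d j) w = functional (d j) (L ?X)"
          using linear_map_functional[OF L B.coordinates_hom[OF coordinates_B j] X]
          by (simp add: x[OF j] A.functional_coordinate_combination[OF coordinates_A] cong: sum.cong)
      qed
      then show "w \<in> L ` carrier A.V" using X by blast
    qed
  qed
qed

text \<open>Both sides of the second claim are linear in \<open>w\<close> and agree on the pure
  tensors of the elements of \<open>J\<close>, which span.\<close>

lemma inverse_dual:
  assumes L: "linear_map class_ring A.V B.V L"
    and bij: "bij_betw L (carrier A.V) (carrier B.V)"
    and \<phi>: "\<phi> \<in> carrier (real_hom A)"
  shows "inverse_dual A B L \<phi> \<in> carrier (real_hom B)"
    and "w \<in> carrier B.V \<Longrightarrow>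
      functional (inverse_dual A B L \<phi>) w = functional \<phi> (inv_into (carrier A.V) L w)"
proof -
  interpret VA: vectorspace class_ring "A.V" by (rule A.real_tensor_vectorspace)
  let ?inv = "inv_into (carrier A.V) L"
  have inv: "?inv w \<in> carrier A.V" "L (?inv w) = w" if "w \<in> carrier B.V" for w
    using bij that bij_betw_inv_into_right[OF bij] bij_betwE[OF bij_betw_inv_into[OF bij]] by auto
  have invL: "?inv (L v) = v" if "v \<in> carrier A.V" for v
    using bij that by (rule bij_betw_inv_into_left)
  have add: "functional \<phi> (?inv (x \<oplus>\<^bsub>B.V\<^esub> y)) = functional \<phi> (?inv x) + functional \<phi> (?inv y)"
    if x: "x \<in> carrier B.V" and y: "y \<in> carrier B.V" for x y
  proof -
    have "L (?inv x \<oplus>\<^bsub>A.V\<^esub> ?inv y) = x \<oplus>\<^bsub>B.V\<^esub> y"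
      using L inv[OF x] inv[OF y] unfolding linear_map_iff by metis
    then have "?inv (x \<oplus>\<^bsub>B.V\<^esub> y) = ?inv x \<oplus>\<^bsub>A.V\<^esub> ?inv y"
      using invL[of "?inv x \<oplus>\<^bsub>A.V\<^esub> ?inv y"] inv[OF x] inv[OF y] by simp
    then show ?thesis using A.functional_linear(1)[OF \<phi>] inv[OF x] inv[OF y] by simp
  qed
  have smult: "functional \<phi> (?inv (c \<odot>\<^bsub>B.V\<^esub> x)) = c * functional \<phi> (?inv x)"
    if x: "x \<in> carrier B.V" for c x
  proof -
    have m: "c \<odot>\<^bsub>A.V\<^esub> ?inv x \<in> carrier A.V"
      using inv[OF x] by (intro VA.smult_closed) auto
    have "L (c \<odot>\<^bsub>A.V\<^esub> ?inv x) = c \<odot>\<^bsub>B.V\<^esub> x"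
      using L inv[OF x] unfolding linear_map_iff by metis
    then have "?inv (c \<odot>\<^bsub>B.V\<^esub> x) = c \<odot>\<^bsub>A.V\<^esub> ?inv x"
      using invL[OF m] by simp
    then show ?thesis using A.functional_linear(2)[OF \<phi> inv(1)[OF x] inv(1)[OF x]] by simp
  qed
  show mem: "inverse_dual A B L \<phi> \<in> carrier (real_hom B)"
    using add B.pure_tensor_closed
    by (auto simp: real_hom_carrier inverse_dual_def B.pure_tensor_mult)
  assume w: "w \<in> carrier B.V"
  have "functional \<phi> (?inv w) = (\<Sum>j\<in>J. functional (d j) w * functional \<phi> (?inv (pure_tensor B j 1)))"
    using add smult by (intro B.linear_coordinates[OF _ _ coordinates_B w]) auto
  moreover have "functional (inverse_dual A B L \<phi>) w =
      (\<Sum>j\<in>J. functional (d j) w * functional (inverse_dual A B L \<phi>) (pure_tensor B j 1))"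
    using B.functional_linear[OF mem] by (intro B.linear_coordinates[OF _ _ coordinates_B w]) auto
  moreover have "functional (inverse_dual A B L \<phi>) (pure_tensor B j 1) = functional \<phi> (?inv (pure_tensor B j 1))"
    if "j \<in> J" for j
    using that B.coordinates_subset[OF coordinates_B] B.functional_pure_tensor[OF mem]
    by (auto simp: inverse_dual_def)
  ultimately show "functional (inverse_dual A B L \<phi>) w = functional \<phi> (?inv w)" by simp
qed

end

section \<open>Abelianization\<close>

context group
begin

lemma ab_class_hom: "ab_class G \<in> hom G (abelianization G)"
proof -
  have "(\<lambda>x. derived G (carrier G) #> x) \<in> hom G (G Mod derived G (carrier G))"
    using derived_is_normal[OF normal_self] by (rule normal.r_coset_hom_Mod)
  moreover have "ab_class G = (\<lambda>x. derived G (carrier G) #> x)"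
    by (rule ext) (simp add: ab_class_def)
  ultimately show ?thesis by (simp add: abelianization_def)
qed

lemma ab_class_group_hom: "group_hom G (abelianization G) (ab_class G)"
  using ab_class_hom abelianization_comm_group[OF is_group]
  by (intro group_hom.intro group_hom_axioms.intro) (auto simp: comm_group_def)

lemma ab_class_surj: "carrier (abelianization G) = ab_class G ` carrier G"
  by (simp add: abelianization_def carrier_FactGroup ab_class_def image_def)

lemma ab_class_closed: "x \<in> carrier G \<Longrightarrow> ab_class G x \<in> carrier (abelianization G)"
  by (simp add: ab_class_surj)

lemma derived_eq_lower_central: "derived G (carrier G) = lower_central G 1"
proof -
  have "derived_set G (carrier G) = {commutator x y |x y. x \<in> carrier G \<and> y \<in> carrier G}"
    by (auto simp: commutator_def)
  then show ?thesis
    using lower_central_Suc[of 0] by (simp add: derived_def)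
qed

lemma ab_class_eq_imp:
  assumes "x \<in> carrier G" "y \<in> carrier G" "ab_class G x = ab_class G y"
  shows "x \<otimes> inv y \<in> lower_central G 1"
proof -
  interpret D: normal "lower_central G 1" G by (rule lower_central_normal)
  have "x \<in> lower_central G 1 #> x" using rcos_self[OF assms(1) D.subgroup_axioms] .
  then have "x \<in> lower_central G 1 #> y"
    using assms(3) by (simp add: ab_class_def derived_eq_lower_central)
  then obtain h where "h \<in> lower_central G 1" "x = h \<otimes> y" by (auto simp: r_coset_def)
  then show ?thesis using assms lower_central_carrier[of h 1] by (simp add: word_simps)
qed

definition ab_rep :: "'a set \<Rightarrow> 'a" where
  "ab_rep a = (SOME x. x \<in> carrier G \<and> ab_class G x = a)"

lemma ab_rep:
  assumes "a \<in> carrier (abelianization G)"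
  shows "ab_rep a \<in> carrier G" "ab_class G (ab_rep a) = a"
proof -
  have "\<exists>x. x \<in> carrier G \<and> ab_class G x = a" using assms by (auto simp: ab_class_surj)
  then have "ab_rep a \<in> carrier G \<and> ab_class G (ab_rep a) = a"
    unfolding ab_rep_def by (rule someI_ex)
  then show "ab_rep a \<in> carrier G" "ab_class G (ab_rep a) = a" by auto
qed

lemma ab_proj_closed: "x \<in> carrier G \<Longrightarrow> ab_proj G x \<in> carrier (ab_real G)"
  using comm_group.pure_tensor_closed[OF abelianization_comm_group[OF is_group]] ab_class_closed
  by (simp add: ab_proj_def ab_real_def)

lemma functional_ab_proj:
  "\<phi> \<in> carrier (real_hom (abelianization G)) \<Longrightarrow> x \<in> carrier G \<Longrightarrow>
    functional \<phi> (ab_proj G x) = \<phi> (ab_class G x)"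
  using comm_group.functional_pure_tensor[OF abelianization_comm_group[OF is_group]] ab_class_closed
  by (simp add: ab_proj_def)

lemma real_hom_ab_class_mult:
  "\<phi> \<in> carrier (real_hom (abelianization G)) \<Longrightarrow> x \<in> carrier G \<Longrightarrow> y \<in> carrier G \<Longrightarrow>
    \<phi> (ab_class G (x \<otimes> y)) = \<phi> (ab_class G x) + \<phi> (ab_class G y)"
  using ab_class_closed hom_mult[OF ab_class_hom] by (simp add: real_hom_carrier)

lemma hom_factors_abelianization:
  assumes H: "H \<in> hom G K" and K: "comm_group K"
  obtains h where "h \<in> hom (abelianization G) K" "\<And>x. x \<in> carrier G \<Longrightarrow> H x = h (ab_class G x)"
proof -
  interpret K: comm_group K by fact
  interpret H: group_hom G K H using H by unfold_locales
  interpret c: group_hom G "abelianization G" "ab_class G" by (rule ab_class_group_hom)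
  have "{commutator x y |x y. x \<in> carrier G \<and> y \<in> lower_central G 0} \<subseteq> kernel G K H"
  proof clarify
    fix x y assume xy: "x \<in> carrier G" "y \<in> lower_central G 0"
    then have "H (commutator x y) = H x \<otimes>\<^bsub>K\<^esub> H y \<otimes>\<^bsub>K\<^esub> inv\<^bsub>K\<^esub> H x \<otimes>\<^bsub>K\<^esub> inv\<^bsub>K\<^esub> H y"
      by (simp add: commutator_def)
    also have "\<dots> = H y \<otimes>\<^bsub>K\<^esub> (H x \<otimes>\<^bsub>K\<^esub> inv\<^bsub>K\<^esub> H x) \<otimes>\<^bsub>K\<^esub> inv\<^bsub>K\<^esub> H y"
      using xy K.m_comm[of "H x" "H y"] by (simp add: K.m_assoc)
    also have "\<dots> = \<one>\<^bsub>K\<^esub>" using xy by simp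
    finally show "commutator x y \<in> kernel G K H" using xy by (simp add: kernel_def)
  qed
  then have ker: "lower_central G 1 \<subseteq> kernel G K H"
    using lower_central_Suc[of 0] generate_subgroup_incl[OF _ H.subgroup_kernel] by simp
  have H_eq: "H x = H y" if "x \<in> carrier G" "y \<in> carrier G" "ab_class G x = ab_class G y" for x y
  proof -
    have "H (x \<otimes> inv y) = \<one>\<^bsub>K\<^esub>"
      using ab_class_eq_imp[OF that] ker by (auto simp: kernel_def)
    then have "H x \<otimes>\<^bsub>K\<^esub> inv\<^bsub>K\<^esub> H y = \<one>\<^bsub>K\<^esub>" using that by simp
    then show ?thesis using that K.inv_equality[of "H x" "inv\<^bsub>K\<^esub> H y"] by simp
  qed
  have eq: "H x = H (ab_rep (ab_class G x))" if "x \<in> carrier G" for x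
    using that ab_rep[of "ab_class G x"] by (intro H_eq) auto
  have "(\<lambda>a. H (ab_rep a)) \<in> hom (abelianization G) K"
  proof (rule homI)
    show "H (ab_rep a) \<in> carrier K" if "a \<in> carrier (abelianization G)" for a
      using ab_rep(1)[OF that] by simp
    fix a b assume ab: "a \<in> carrier (abelianization G)" "b \<in> carrier (abelianization G)"
    have "ab_class G (ab_rep a \<otimes> ab_rep b) = a \<otimes>\<^bsub>abelianization G\<^esub> b"
      using ab_rep[OF ab(1)] ab_rep[OF ab(2)] by simp
    then have "H (ab_rep (a \<otimes>\<^bsub>abelianization G\<^esub> b)) = H (ab_rep a \<otimes> ab_rep b)"
      using eq[of "ab_rep a \<otimes> ab_rep b"] ab_rep(1)[OF ab(1)] ab_rep(1)[OF ab(2)] by simp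
    then show "H (ab_rep (a \<otimes>\<^bsub>abelianization G\<^esub> b)) = H (ab_rep a) \<otimes>\<^bsub>K\<^esub> H (ab_rep b)"
      using ab_rep(1)[OF ab(1)] ab_rep(1)[OF ab(2)] by simp
  qed
  then show ?thesis using that eq by blast
qed

end

context finitely_generated_group
begin

lemma abelianization_coordinates:
  obtains I e where "comm_group.coordinates (abelianization G) I e"
proof -
  interpret A: comm_group "abelianization G" by (rule abelianization_comm_group[OF is_group])
  interpret c: group_hom G "abelianization G" "ab_class G" by (rule ab_class_group_hom)
  have "generate (abelianization G) (ab_class G ` S) = ab_class G ` generate G S"
    using generators_closed by (rule c.generate_img)
  also have "\<dots> = carrier (abelianization G)"
    using finite_generating_set by (simp add: finite_generating_set_def ab_class_surj)
  finally have gen: "generate (abelianization G) (ab_class G ` S) = carrier (abelianization G)" .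
  have "finite (ab_class G ` S)" "ab_class G ` S \<subseteq> carrier (abelianization G)"
    using finite_generators generators_closed by (auto simp: ab_class_surj)
  then show ?thesis using gen by (rule A.finitely_generated_coordinates) (rule that)
qed

lemma real_hom_ab_class_bound:
  assumes "\<phi> \<in> carrier (real_hom (abelianization G))"
  obtains C where "0 \<le> C" "\<And>x. x \<in> carrier G \<Longrightarrow> \<bar>\<phi> (ab_class G x)\<bar> \<le> C * real (wl x)"
  using real_hom_word_length[of "\<lambda>x. \<phi> (ab_class G x)"] real_hom_ab_class_mult[OF assms] by blast

text \<open>A path of bounded speed whose projection to the abelianization stays bounded is, up to bounded
  error, a product of elements of a finite subset of the commutator subgroup.\<close>
lemma vertical_path_sublinear:
  assumes nil: "nilpotent G" and co: "comm_group.coordinates (abelianization G) I e"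
    and g: "\<And>n. g n \<in> carrier G" "\<And>n. wl (inv (g n) \<otimes> g (Suc n)) \<le> C"
    and B: "\<And>n i. i \<in> I \<Longrightarrow> \<bar>e i (ab_class G (g n))\<bar> \<le> B"
  obtains K K' where "0 \<le> K" "\<And>n. real (wl (g n)) \<le> K * sqrt (real n) + K'"
proof -
  interpret A: comm_group "abelianization G" by (rule abelianization_comm_group[OF is_group])
  define Z where "Z = {a \<in> carrier (abelianization G). \<forall>i\<in>I. \<bar>e i a\<bar> \<le> B}"
  have Z: "finite Z" unfolding Z_def using co by (rule A.coordinates_finite_ball)
  have gZ: "ab_class G (g n) \<in> Z" for n
    using B g(1) ab_class_closed by (simp add: Z_def)
  define b where "b n = ab_rep (ab_class G (g n))" for n
  have b: "b n \<in> carrier G" "ab_class G (b n) = ab_class G (g n)" for n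
    using ab_rep[of "ab_class G (g n)"] ab_class_closed[OF g(1)] by (simp_all add: b_def)
  \<comment> \<open>The lift \<open>b n\<close> has the same class as \<open>g n\<close> and is
    taken from a finite list, because these classes stay in the finite set \<open>Z\<close>. So
    \<open>h n\<close> lies in the commutator subgroup and remains close to
    \<open>g n\<close>.\<close>
  define h where "h n = g n \<otimes> inv (b n)" for n
  have h: "h n \<in> lower_central G 1" for n
    unfolding h_def using g(1) b by (intro ab_class_eq_imp) auto
  have hc: "h n \<in> carrier G" for n using h by (rule lower_central_carrier)
  \<comment> \<open>An increment of h is an increment of g, of length at most C, multiplied on both
    sides by lifts or their inverses; only finitely many elements arise in this way.\<close>
  define F where "F = lower_central G 1 \<inter>
    (\<lambda>(p, s, q). p \<otimes> s \<otimes> inv q) ` (ab_rep ` Z \<times> {x \<in> carrier G. wl x \<le> C} \<times> ab_rep ` Z)"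
  have F: "finite F" "F \<subseteq> lower_central G 1"
    unfolding F_def using Z finite_word_ball by auto
  define f where "f n = inv (h n) \<otimes> h (Suc n)" for n
  have f: "f n \<in> F" for n
  proof -
    have "f n = b n \<otimes> (inv (g n) \<otimes> g (Suc n)) \<otimes> inv (b (Suc n))"
      using g(1) b(1) by (simp add: f_def h_def word_simps)
    moreover have "f n \<in> lower_central G 1"
      unfolding f_def using h subgroup.m_closed[OF normal_imp_subgroup[OF lower_central_normal]]
        subgroup.m_inv_closed[OF normal_imp_subgroup[OF lower_central_normal]] by blast
    moreover have "b n \<in> ab_rep ` Z" for n unfolding b_def using gZ by blast
    ultimately show ?thesis
      unfolding F_def using g by (auto intro!: image_eqI[of _ _ "(b n, inv (g n) \<otimes> g (Suc n), b (Suc n))"])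
  qed
  have fc: "f n \<in> carrier G" for n using hc by (simp add: f_def)
  have prod: "h n = h 0 \<otimes> word_prod (map f [0..<n])" for n
  proof (induction n)
    case (Suc n)
    have w: "word_prod (map f [0..<n]) \<in> carrier G" using fc by (intro word_prod_closed) auto
    have "word_prod (map f [0..<n] @ [f n]) = word_prod (map f [0..<n]) \<otimes> word_prod [f n]"
      using fc by (intro word_prod_append) auto
    then have "h 0 \<otimes> word_prod (map f [0..<Suc n]) = h 0 \<otimes> word_prod (map f [0..<n]) \<otimes> f n"
      using fc w hc by (simp add: m_assoc)
    also have "\<dots> = h n \<otimes> f n" using Suc by simp
    also have "\<dots> = h (Suc n)" using hc by (simp add: f_def word_simps)
    finally show ?case by simp
  qed (use hc in simp)
  obtain K where K: "0 \<le> K" "\<And>ws. set ws \<subseteq> F \<Longrightarrow> real (wl (word_prod ws)) \<le> K * (sqrt (length ws) + 2)"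
    using commutator_subgroup_distortion[OF nil F] by blast
  \<comment> \<open>The summands account for the starting point, the additive constant of the
    distortion bound, and the lift \<open>b n\<close>.\<close>
  define K' where "K' = real (wl (h 0)) + 2 * K + (\<Sum>a\<in>Z. real (wl (ab_rep a)))"
  have "real (wl (g n)) \<le> K * sqrt (real n) + K'" for n
  proof -
    have w: "word_prod (map f [0..<n]) \<in> carrier G" using fc by (intro word_prod_closed) auto
    have "g n = h n \<otimes> b n" using g(1) b(1) by (simp add: h_def word_simps)
    then have "wl (g n) \<le> wl (h n) + wl (b n)" using word_length_mult[OF hc b(1)] by simp
    moreover have "wl (h n) \<le> wl (h 0) + wl (word_prod (map f [0..<n]))"
      using word_length_mult[OF hc w, of 0] prod[of n] by simp
    moreover have "real (wl (word_prod (map f [0..<n]))) \<le> K * (sqrt (real n) + 2)"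
      using K(2)[of "map f [0..<n]"] f by auto
    moreover have "real (wl (b n)) \<le> (\<Sum>a\<in>Z. real (wl (ab_rep a)))"
      unfolding b_def using Z gZ by (intro member_le_sum[of "ab_class G (g n)" Z "\<lambda>a. real (wl (ab_rep a))"]) auto
    ultimately show ?thesis by (simp add: K'_def algebra_simps)
  qed
  then show ?thesis using that K(1) by blast
qed

text \<open>The path follows n v with coordinates rounded down. Consecutive roundings differ by
  bounded integers, so only finitely many lifts occur as steps, and this bounds the speed.\<close>

lemma path_in_direction:
  assumes co: "comm_group.coordinates (abelianization G) I e"
  obtains x C where "\<And>n. x n \<in> carrier G" "\<And>n. wl (inv (x n) \<otimes> x (Suc n)) \<le> C"
    "\<And>n i. i \<in> I \<Longrightarrow> e i (ab_class G (x n)) = real_of_int \<lfloor>real n * v i\<rfloor>"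
proof -
  interpret A: comm_group "abelianization G" by (rule abelianization_comm_group[OF is_group])
  note I = A.coordinates_finite[OF co] A.coordinates_subset[OF co]
  define t where "t m = ab_rep (A.monomial I m)" for m
  have t: "t m \<in> carrier G" "ab_class G (t m) = A.monomial I m" for m
    using ab_rep[OF A.monomial_closed[OF I(2)]] by (simp_all add: t_def)
  define m where "m n = (\<lambda>i\<in>I. \<lfloor>real (Suc n) * v i\<rfloor> - \<lfloor>real n * v i\<rfloor>)" for n
  define x where "x = rec_nat \<one> (\<lambda>n y. y \<otimes> t (m n))"
  have x0: "x 0 = \<one>" and xS: "x (Suc n) = x n \<otimes> t (m n)" for n by (simp_all add: x_def)
  have xc: "x n \<in> carrier G" for n by (induction n) (simp_all add: x0 xS t)
  define B where "B = (\<Sum>i\<in>I. \<lceil>\<bar>v i\<bar>\<rceil> + 1)"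
  have m: "m n \<in> PiE I (\<lambda>_. {-B..B})" for n
  proof (rule PiE_I)
    fix i assume i: "i \<in> I"
    have "\<lceil>\<bar>v i\<bar>\<rceil> + 1 \<le> B"
      unfolding B_def using i I(1) by (intro member_le_sum[of i I "\<lambda>i. \<lceil>\<bar>v i\<bar>\<rceil> + 1"]) auto
    moreover have "real (Suc n) * v i = real n * v i + v i" by (simp add: algebra_simps)
    then have "\<bar>\<lfloor>real (Suc n) * v i\<rfloor> - \<lfloor>real n * v i\<rfloor>\<bar> \<le> \<lceil>\<bar>v i\<bar>\<rceil> + 1" by linarith
    ultimately show "m n i \<in> {-B..B}" using i by (auto simp: m_def)
  qed (simp add: m_def)
  define C where "C = (\<Sum>p\<in>PiE I (\<lambda>_. {-B..B}). wl (t p))"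
  have "wl (inv (x n) \<otimes> x (Suc n)) \<le> C" for n
  proof -
    have "inv (x n) \<otimes> x (Suc n) = t (m n)" using xc[of n] t by (simp add: xS word_simps)
    moreover have "wl (t (m n)) \<le> C"
      unfolding C_def using m I(1) by (intro member_le_sum[of "m n" _ "\<lambda>p. wl (t p)"]) (auto intro: finite_PiE)
    ultimately show ?thesis by simp
  qed
  moreover have "e i (ab_class G (x n)) = real_of_int \<lfloor>real n * v i\<rfloor>" if i: "i \<in> I" for n i
  proof (induction n)
    case 0
    have "e i (ab_class G (\<one> \<otimes> \<one>)) = e i (ab_class G \<one>) + e i (ab_class G \<one>)"
      using A.coordinates_hom[OF co i] by (intro real_hom_ab_class_mult) auto
    then show ?case by (simp add: x0)
  next
    case (Suc n)
    have "e i (ab_class G (x (Suc n))) = e i (ab_class G (x n)) + e i (ab_class G (t (m n)))"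
      unfolding xS using A.coordinates_hom[OF co i] xc t by (intro real_hom_ab_class_mult) auto
    then show ?case using Suc i by (simp add: t(2) A.coordinate_monomial[OF co i] m_def)
  qed
  ultimately show ?thesis using that xc by blast
qed

end

section \<open>Quasi-isometries with bounded Abelian defect\<close>

text \<open>At n = m^2 the left-hand side is quadratic in m and the right-hand side is
  linear.\<close>

lemma not_linear_le_sqrt:
  fixes a b c :: real
  assumes "0 < a" "\<And>n::nat. a * real n \<le> b * sqrt (real n) + c"
  shows False
proof -
  obtain m :: nat where m: "(\<bar>b\<bar> + \<bar>c\<bar>) / a < real m" using reals_Archimedean2 by blast
  have m1: "1 \<le> real m"
  proof -
    have "0 \<le> (\<bar>b\<bar> + \<bar>c\<bar>) / a" using assms(1) by simp
    then have "0 < real m" using m by linarith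
    then show ?thesis by simp
  qed
  have "\<bar>b\<bar> + \<bar>c\<bar> < a * real m" using m assms(1) by (simp add: field_simps)
  then have "(\<bar>b\<bar> + \<bar>c\<bar>) * real m < a * real m * real m"
    using m1 by (intro mult_strict_right_mono) auto
  moreover have "a * real m * real m \<le> b * real m + c"
    using assms(2)[of "m * m"] by (simp add: real_sqrt_mult mult.assoc)
  moreover have "b * real m \<le> \<bar>b\<bar> * real m" by (intro mult_right_mono) auto
  moreover have "\<bar>c\<bar> * 1 \<le> \<bar>c\<bar> * real m" using m1 by (intro mult_left_mono) auto
  ultimately show False by (simp add: distrib_right)
qed

locale nilpotent_quasi_isometry =
  N: finitely_generated_group N S + M: finitely_generated_group M T +
  coordinate_pair "abelianization N" "abelianization M" I e J d
  for N :: "('a, 'c) monoid_scheme" and S and M :: "('b, 'd) monoid_scheme" and T and I e J d +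
  fixes \<Psi> :: "'a \<Rightarrow> 'b"
  assumes nilpotent_N: "nilpotent N" and nilpotent_M: "nilpotent M"
    and qi: "quasi_isometry (carrier N) (word_dist N S) (carrier M) (word_dist M T) \<Psi>"
    and \<Psi>_one: "\<Psi> \<one>\<^bsub>N\<^esub> = \<one>\<^bsub>M\<^esub>"
begin

lemma \<Psi>_closed: "x \<in> carrier N \<Longrightarrow> \<Psi> x \<in> carrier M"
  using qi by (auto simp: quasi_isometry_def)

lemma quasi_isometry_constants:
  obtains K C :: real where "1 \<le> K" "0 \<le> C"
    "\<And>x y. x \<in> carrier N \<Longrightarrow> y \<in> carrier N \<Longrightarrow>
      real (M.wl (inv\<^bsub>M\<^esub> (\<Psi> x) \<otimes>\<^bsub>M\<^esub> \<Psi> y)) \<le> K * real (N.wl (inv\<^bsub>N\<^esub> x \<otimes>\<^bsub>N\<^esub> y)) + C"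
    "\<And>x. x \<in> carrier N \<Longrightarrow> real (N.wl x) \<le> K * (real (M.wl (\<Psi> x)) + C)"
    "\<And>y. y \<in> carrier M \<Longrightarrow> \<exists>x\<in>carrier N. real (M.wl (inv\<^bsub>M\<^esub> (\<Psi> x) \<otimes>\<^bsub>M\<^esub> y)) \<le> C"
proof -
  obtain K C :: real where K: "1 \<le> K" "0 \<le> C"
    and b: "\<forall>x\<in>carrier N. \<forall>y\<in>carrier N.
        word_dist N S x y / K - C \<le> word_dist M T (\<Psi> x) (\<Psi> y) \<and>
        word_dist M T (\<Psi> x) (\<Psi> y) \<le> K * word_dist N S x y + C"
    and c: "\<forall>y\<in>carrier M. \<exists>x\<in>carrier N. word_dist M T (\<Psi> x) y \<le> C"
    using qi unfolding quasi_isometry_def by blast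
  have "real (N.wl x) \<le> K * (real (M.wl (\<Psi> x)) + C)" if x: "x \<in> carrier N" for x
  proof -
    have "real (N.wl x) / K - C \<le> real (M.wl (\<Psi> x))"
      using b[rule_format, of "\<one>\<^bsub>N\<^esub>" x] x \<Psi>_closed[OF x] by (simp add: word_dist_def \<Psi>_one)
    then show ?thesis using K(1) by (simp add: field_simps)
  qed
  then show ?thesis using that[OF K] b c unfolding word_dist_def by blast
qed

section \<open>Existence and uniqueness of the homomorphism near the quasi-isometry\<close>

lemma defect_hom_exists:
  assumes D: "\<And>x y j. x \<in> carrier N \<Longrightarrow> y \<in> carrier N \<Longrightarrow> j \<in> J \<Longrightarrow>
    \<bar>d j (ab_class M (\<Psi> (x \<otimes>\<^bsub>N\<^esub> y))) - d j (ab_class M (\<Psi> x)) - d j (ab_class M (\<Psi> y))\<bar> \<le> D"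
  obtains H where "H \<in> hom N (add_monoid (ab_real M))" "H \<in> extensional (carrier N)"
    "\<And>x j. x \<in> carrier N \<Longrightarrow> j \<in> J \<Longrightarrow> \<bar>d j (ab_class M (\<Psi> x)) - functional (d j) (H x)\<bar> \<le> D"
proof -
  note J = B.coordinates_finite[OF coordinates_B] B.coordinates_subset[OF coordinates_B]
  have "\<exists>h. (\<forall>x\<in>carrier N. \<forall>y\<in>carrier N. h (x \<otimes>\<^bsub>N\<^esub> y) = h x + h y) \<and>
      (\<forall>x\<in>carrier N. \<bar>d j (ab_class M (\<Psi> x)) - h x\<bar> \<le> D)" if "j \<in> J" for j
    using N.quasimorphism_near_hom[OF nilpotent_N, of "\<lambda>x. d j (ab_class M (\<Psi> x))" D] D that by metis
  then obtain h where h: "\<And>j x y. j \<in> J \<Longrightarrow> x \<in> carrier N \<Longrightarrow> y \<in> carrier N \<Longrightarrow> h j (x \<otimes>\<^bsub>N\<^esub> y) = h j x + h j y"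
    "\<And>j x. j \<in> J \<Longrightarrow> x \<in> carrier N \<Longrightarrow> \<bar>d j (ab_class M (\<Psi> x)) - h j x\<bar> \<le> D"
    by metis
  define H where "H = (\<lambda>x\<in>carrier N. B.combination J (\<lambda>j. h j x))"
  have "H \<in> hom N (add_monoid (ab_real M))"
  proof (rule homI)
    show "H x \<in> carrier (add_monoid (ab_real M))" if "x \<in> carrier N" for x
      using that B.combination_closed[OF J(2)] by (simp add: H_def ab_real_def)
    fix x y assume xy: "x \<in> carrier N" "y \<in> carrier N"
    have "B.combination J (\<lambda>j. h j (x \<otimes>\<^bsub>N\<^esub> y)) = B.combination J (\<lambda>j. h j x + h j y)"
      using h(1) xy by (intro B.combination_cong J)
    then show "H (x \<otimes>\<^bsub>N\<^esub> y) = H x \<otimes>\<^bsub>add_monoid (ab_real M)\<^esub> H y"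
      using xy by (simp add: H_def ab_real_def B.combination_add[OF J(2)])
  qed
  moreover have "\<bar>d j (ab_class M (\<Psi> x)) - functional (d j) (H x)\<bar> \<le> D" if "x \<in> carrier N" "j \<in> J" for x j
    using h(2)[OF that(2,1)] that B.functional_coordinate_combination[OF coordinates_B that(2)]
    by (simp add: H_def)
  ultimately show ?thesis using that by (simp add: H_def)
qed

text \<open>On x^n the coordinates of the two homomorphisms differ by n times their difference at
  \<open>x\<close>, but by a bounded amount.\<close>

lemma near_hom_unique:
  assumes H: "H \<in> hom N (add_monoid (ab_real M))"
      "\<And>x j. x \<in> carrier N \<Longrightarrow> j \<in> J \<Longrightarrow> \<bar>d j (ab_class M (\<Psi> x)) - functional (d j) (H x)\<bar> \<le> D"
    and H': "H' \<in> hom N (add_monoid (ab_real M))"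
      "\<And>x j. x \<in> carrier N \<Longrightarrow> j \<in> J \<Longrightarrow> \<bar>d j (ab_class M (\<Psi> x)) - functional (d j) (H' x)\<bar> \<le> D'"
    and x: "x \<in> carrier N"
  shows "H x = H' x"
proof -
  have closed: "H x \<in> carrier B.V" "H' x \<in> carrier B.V"
    if "x \<in> carrier N" for x
    using H(1) H'(1) that by (auto simp: hom_def ab_real_def)
  show ?thesis
  proof (rule B.tensor_eqI[OF coordinates_B closed[OF x]])
    fix j assume j: "j \<in> J"
    have dj: "d j \<in> carrier (real_hom (abelianization M))"
      using j by (rule B.coordinates_hom[OF coordinates_B])
    have pow: "functional (d j) (F (x [^]\<^bsub>N\<^esub> n)) = real n * functional (d j) (F x)"
      if F: "F \<in> hom N (add_monoid (ab_real M))" for F and n :: nat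
    proof -
      have Fc: "F y \<in> carrier B.V" if "y \<in> carrier N" for y
        using F that by (auto simp: hom_def ab_real_def)
      have Fm: "functional (d j) (F (y \<otimes>\<^bsub>N\<^esub> z)) = functional (d j) (F y) + functional (d j) (F z)"
        if "y \<in> carrier N" "z \<in> carrier N" for y z
        using F that B.functional_linear(1)[OF dj Fc Fc] by (auto simp: hom_def ab_real_def)
      show ?thesis
      proof (induction n)
        case 0
        show ?case using Fm[of "\<one>\<^bsub>N\<^esub>" "\<one>\<^bsub>N\<^esub>"] by simp
      next
        case (Suc n)
        then show ?case using Fm[of "x [^]\<^bsub>N\<^esub> n" x] x by (simp add: distrib_right)
      qed
    qed
    have "real n * \<bar>functional (d j) (H x) - functional (d j) (H' x)\<bar> \<le> D + D'" for n :: nat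
    proof -
      have "real n * \<bar>functional (d j) (H x) - functional (d j) (H' x)\<bar> =
          \<bar>functional (d j) (H (x [^]\<^bsub>N\<^esub> n)) - functional (d j) (H' (x [^]\<^bsub>N\<^esub> n))\<bar>"
        unfolding pow[OF H(1)] pow[OF H'(1)] right_diff_distrib[symmetric] abs_mult by simp
      also have "\<dots> \<le> D + D'"
        using H(2)[of "x [^]\<^bsub>N\<^esub> n" j] H'(2)[of "x [^]\<^bsub>N\<^esub> n" j] x j by simp
      finally show ?thesis .
    qed
    then have "functional (d j) (H x) - functional (d j) (H' x) = 0"
      by (rule multiples_bounded_imp_zero)
    then show "functional (d j) (H x) = functional (d j) (H' x)" by simp
  qed
qed

lemma functional_L_ab_proj:
  assumes L: "linear_map class_ring (ab_real N) (ab_real M) L"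
    and \<phi>: "\<phi> \<in> carrier (real_hom (abelianization M))" and x: "x \<in> carrier N"
  shows "functional \<phi> (L (ab_proj N x)) =
    (\<Sum>i\<in>I. e i (ab_class N x) * functional \<phi> (L (pure_tensor (abelianization N) i 1)))"
proof -
  have "functional \<phi> (L (ab_proj N x)) =
      (\<Sum>i\<in>I. functional (e i) (ab_proj N x) * functional \<phi> (L (pure_tensor (abelianization N) i 1)))"
    using linear_map_functional[OF L[unfolded ab_real_def] \<phi>] N.ab_proj_closed[OF x, unfolded ab_real_def] .
  then show ?thesis
    by (simp add: N.functional_ab_proj[OF A.coordinates_hom[OF coordinates_A] x] cong: sum.cong)
qed

text \<open>A vector \<open>v\<close> in the kernel is followed by a path in \<open>N\<close> of linear length, whose image under
  \<open>\<Psi>\<close> projects to a bounded set and hence has length \<open>O(\<surd>n)\<close>.\<close>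
lemma near_linear_kernel:
  assumes L: "linear_map class_ring (ab_real N) (ab_real M) L"
    and D: "\<And>x j. x \<in> carrier N \<Longrightarrow> j \<in> J \<Longrightarrow>
      \<bar>d j (ab_class M (\<Psi> x)) - functional (d j) (L (ab_proj N x))\<bar> \<le> D"
    and v: "v \<in> carrier (ab_real N)" "L v = \<zero>\<^bsub>ab_real M\<^esub>"
  shows "v = \<zero>\<^bsub>ab_real N\<^esub>"
proof -
  interpret VA: vectorspace class_ring "A.V" by (rule A.real_tensor_vectorspace)
  note I = A.coordinates_finite[OF coordinates_A] and J = B.coordinates_finite[OF coordinates_B]
  have dj: "d j \<in> carrier (real_hom (abelianization M))" if "j \<in> J" for j
    using that by (rule B.coordinates_hom[OF coordinates_B])
  have "functional (e i0) v = 0" if i0: "i0 \<in> I" for i0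
  proof (rule ccontr)
    assume nz: "functional (e i0) v \<noteq> 0"
    let ?v = "\<lambda>i. functional (e i) v"
    let ?l = "\<lambda>i j. functional (d j) (L (pure_tensor (abelianization N) i 1))"
    obtain x :: "nat \<Rightarrow> 'a" and Cx where x: "\<And>n. x n \<in> carrier N"
      "\<And>n. N.wl (inv\<^bsub>N\<^esub> (x n) \<otimes>\<^bsub>N\<^esub> x (Suc n)) \<le> Cx"
      "\<And>n i. i \<in> I \<Longrightarrow> e i (ab_class N (x n)) = real_of_int \<lfloor>real n * ?v i\<rfloor>"
      using N.path_in_direction[OF coordinates_A, of ?v] by blast
    obtain K C where K: "1 \<le> K" "0 \<le> C"
      "\<And>x y. x \<in> carrier N \<Longrightarrow> y \<in> carrier N \<Longrightarrow>
        real (M.wl (inv\<^bsub>M\<^esub> (\<Psi> x) \<otimes>\<^bsub>M\<^esub> \<Psi> y)) \<le> K * real (N.wl (inv\<^bsub>N\<^esub> x \<otimes>\<^bsub>N\<^esub> y)) + C"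
      "\<And>x. x \<in> carrier N \<Longrightarrow> real (N.wl x) \<le> K * (real (M.wl (\<Psi> x)) + C)"
      using quasi_isometry_constants by metis
    have steps: "M.wl (inv\<^bsub>M\<^esub> (\<Psi> (x n)) \<otimes>\<^bsub>M\<^esub> \<Psi> (x (Suc n))) \<le> nat \<lceil>K * real Cx + C\<rceil>" for n
    proof -
      have "K * real (N.wl (inv\<^bsub>N\<^esub> (x n) \<otimes>\<^bsub>N\<^esub> x (Suc n))) \<le> K * real Cx"
        using x(2)[of n] K(1) by (intro mult_left_mono) auto
      then have "real (M.wl (inv\<^bsub>M\<^esub> (\<Psi> (x n)) \<otimes>\<^bsub>M\<^esub> \<Psi> (x (Suc n)))) \<le> K * real Cx + C"
        using K(3)[OF x(1) x(1), of n "Suc n"] by linarith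
      then show ?thesis by linarith
    qed
    \<comment> \<open>As L v = 0, the point n v can be subtracted before applying L. What remains
      has rounding errors as coordinates, of absolute value at most 1, so its image is
      bounded.\<close>
    have bounded: "\<bar>d j (ab_class M (\<Psi> (x n)))\<bar> \<le> D + (\<Sum>j\<in>J. \<Sum>i\<in>I. \<bar>?l i j\<bar>)" if j: "j \<in> J" for n j
    proof -
      have "functional (d j) (L v) = 0"
        using B.functional_zero[OF dj[OF j]] by (simp add: v(2) ab_real_def)
      then have "(\<Sum>i\<in>I. ?v i * ?l i j) = 0"
        using linear_map_functional[OF L[unfolded ab_real_def] dj[OF j] v(1)[unfolded ab_real_def]] by simp
      then have 0: "(\<Sum>i\<in>I. real n * ?v i * ?l i j) = 0"
        by (simp add: mult.assoc flip: sum_distrib_left)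
      have "functional (d j) (L (ab_proj N (x n))) = (\<Sum>i\<in>I. real_of_int \<lfloor>real n * ?v i\<rfloor> * ?l i j)"
        using functional_L_ab_proj[OF L dj[OF j] x(1)] by (simp add: x(3) cong: sum.cong)
      also have "\<dots> = (\<Sum>i\<in>I. (real_of_int \<lfloor>real n * ?v i\<rfloor> - real n * ?v i) * ?l i j)"
        using 0 by (simp add: left_diff_distrib sum_subtractf)
      finally have "\<bar>functional (d j) (L (ab_proj N (x n)))\<bar> \<le>
          (\<Sum>i\<in>I. \<bar>(real_of_int \<lfloor>real n * ?v i\<rfloor> - real n * ?v i) * ?l i j\<bar>)"
        by (simp only: sum_abs)
      also have "\<dots> \<le> (\<Sum>i\<in>I. \<bar>?l i j\<bar>)"
      proof (rule sum_mono)
        fix i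
        have "\<bar>real_of_int \<lfloor>real n * ?v i\<rfloor> - real n * ?v i\<bar> \<le> 1" by linarith
        then show "\<bar>(real_of_int \<lfloor>real n * ?v i\<rfloor> - real n * ?v i) * ?l i j\<bar> \<le> \<bar>?l i j\<bar>"
          unfolding abs_mult using mult_right_mono[of _ 1 "\<bar>?l i j\<bar>"] by fastforce
      qed
      also have "\<dots> \<le> (\<Sum>j\<in>J. \<Sum>i\<in>I. \<bar>?l i j\<bar>)"
        using J j by (intro member_le_sum[of j J "\<lambda>j. \<Sum>i\<in>I. \<bar>?l i j\<bar>"]) (auto intro: sum_nonneg)
      finally show ?thesis using D[OF x(1)[of n] j] by linarith
    qed
    obtain K1 K2 where K1: "0 \<le> K1" "\<And>n. real (M.wl (\<Psi> (x n))) \<le> K1 * sqrt (real n) + K2"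
      using M.vertical_path_sublinear[OF nilpotent_M coordinates_B, of "\<lambda>n. \<Psi> (x n)", OF \<Psi>_closed[OF x(1)] steps bounded]
      by blast
    obtain C1 where C1: "0 \<le> C1" "\<And>y. y \<in> carrier N \<Longrightarrow> \<bar>e i0 (ab_class N y)\<bar> \<le> C1 * real (N.wl y)"
      using N.real_hom_ab_class_bound[OF A.coordinates_hom[OF coordinates_A i0]] by blast
    \<comment> \<open>The coordinate i0 of \<open>x n\<close> grows linearly and bounds the length
      of \<open>x n\<close> from below; the lower quasi-isometry inequality passes this growth on to
      \<open>\<Psi> (x n)\<close>, whose length is O(sqrt n).\<close>
    have "\<bar>?v i0\<bar> * real n \<le> (C1 * K * K1) * sqrt (real n) + (C1 * K * (K2 + C) + 1)" for n :: nat
    proof -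
      have "\<bar>?v i0\<bar> * real n = \<bar>real n * ?v i0\<bar>" by (simp add: abs_mult)
      also have "\<dots> \<le> \<bar>real_of_int \<lfloor>real n * ?v i0\<rfloor>\<bar> + 1" by linarith
      also have "\<bar>real_of_int \<lfloor>real n * ?v i0\<rfloor>\<bar> \<le> C1 * real (N.wl (x n))"
        using C1(2)[OF x(1), of n] x(3)[OF i0, of n] by simp
      also have "C1 * real (N.wl (x n)) \<le> C1 * (K * (K1 * sqrt (real n) + K2 + C))"
        using K(1,4) x(1) K1(2)[of n] C1(1)
        by (intro mult_left_mono order_trans[OF K(4)[OF x(1)]]) auto
      finally show ?thesis by (simp add: algebra_simps)
    qed
    then show False using nz by (intro not_linear_le_sqrt[of "\<bar>?v i0\<bar>"]) auto
  qed
  then show ?thesis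
    using A.tensor_eqI[OF coordinates_A v(1)[unfolded ab_real_def] VA.M.zero_closed]
      A.functional_zero[OF A.coordinates_hom[OF coordinates_A]]
    by (simp add: ab_real_def)
qed

text \<open>A covector vanishing on the image of \<open>L\<close> is bounded on the coarsely dense image of \<open>\<Psi>\<close>, so it
  gives a bounded homomorphism on \<open>M\<close>.\<close>
lemma near_linear_cokernel:
  assumes L: "linear_map class_ring (ab_real N) (ab_real M) L"
    and D: "\<And>x j. x \<in> carrier N \<Longrightarrow> j \<in> J \<Longrightarrow>
      \<bar>d j (ab_class M (\<Psi> x)) - functional (d j) (L (ab_proj N x))\<bar> \<le> D"
    and c: "\<And>i. i \<in> I \<Longrightarrow>
      (\<Sum>j\<in>J. c j * functional (d j) (L (pure_tensor (abelianization N) i 1))) = 0"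
    and j0: "j0 \<in> J"
  shows "c j0 = 0"
proof -
  note J = B.coordinates_finite[OF coordinates_B] B.coordinates_subset[OF coordinates_B]
  let ?l = "\<lambda>i j. functional (d j) (L (pure_tensor (abelianization N) i 1))"
  have dj: "d j \<in> carrier (real_hom (abelianization M))" if "j \<in> J" for j
    using that by (rule B.coordinates_hom[OF coordinates_B])
  define \<psi> where "\<psi> y = (\<Sum>j\<in>J. c j * d j (ab_class M y))" for y
  have \<psi>_mult: "\<psi> (y \<otimes>\<^bsub>M\<^esub> z) = \<psi> y + \<psi> z" if "y \<in> carrier M" "z \<in> carrier M" for y z
    using that by (simp add: \<psi>_def M.real_hom_ab_class_mult[OF dj] distrib_left sum.distrib cong: sum.cong)
  obtain C2 where C2: "0 \<le> C2" "\<And>y. y \<in> carrier M \<Longrightarrow> \<bar>\<psi> y\<bar> \<le> C2 * real (M.wl y)"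
    using M.real_hom_word_length[of \<psi>] \<psi>_mult by blast
  obtain C where C: "0 \<le> C"
    "\<And>y. y \<in> carrier M \<Longrightarrow> \<exists>x\<in>carrier N. real (M.wl (inv\<^bsub>M\<^esub> (\<Psi> x) \<otimes>\<^bsub>M\<^esub> y)) \<le> C"
    using quasi_isometry_constants by metis
  have image: "\<bar>\<psi> (\<Psi> x)\<bar> \<le> (\<Sum>j\<in>J. \<bar>c j\<bar> * D)" if x: "x \<in> carrier N" for x
  proof -
    have "(\<Sum>j\<in>J. c j * functional (d j) (L (ab_proj N x))) = (\<Sum>j\<in>J. c j * (\<Sum>i\<in>I. e i (ab_class N x) * ?l i j))"
      using functional_L_ab_proj[OF L dj x] by (simp cong: sum.cong)
    also have "\<dots> = (\<Sum>j\<in>J. \<Sum>i\<in>I. e i (ab_class N x) * (c j * ?l i j))"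
      by (simp add: sum_distrib_left mult.left_commute)
    also have "\<dots> = (\<Sum>i\<in>I. e i (ab_class N x) * (\<Sum>j\<in>J. c j * ?l i j))"
      by (subst sum.swap) (simp add: sum_distrib_left)
    also have "\<dots> = 0" using c by simp
    finally have "\<psi> (\<Psi> x) = (\<Sum>j\<in>J. c j * (d j (ab_class M (\<Psi> x)) - functional (d j) (L (ab_proj N x))))"
      by (simp add: \<psi>_def right_diff_distrib sum_subtractf)
    then have "\<bar>\<psi> (\<Psi> x)\<bar> \<le> (\<Sum>j\<in>J. \<bar>c j * (d j (ab_class M (\<Psi> x)) - functional (d j) (L (ab_proj N x)))\<bar>)"
      by (simp only: sum_abs)
    also have "\<dots> \<le> (\<Sum>j\<in>J. \<bar>c j\<bar> * D)"
      unfolding abs_mult using D[OF x] by (intro sum_mono mult_left_mono) auto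
    finally show ?thesis .
  qed
  \<comment> \<open>Each y is an image point times an element of length at most C, and on the latter
    \<open>\<psi>\<close> is bounded because it is a homomorphism.\<close>
  have bound: "\<bar>\<psi> y\<bar> \<le> (\<Sum>j\<in>J. \<bar>c j\<bar> * D) + C2 * C" if y: "y \<in> carrier M" for y
  proof -
    obtain x where x: "x \<in> carrier N" "real (M.wl (inv\<^bsub>M\<^esub> (\<Psi> x) \<otimes>\<^bsub>M\<^esub> y)) \<le> C"
      using C(2)[OF y] by blast
    have "y = \<Psi> x \<otimes>\<^bsub>M\<^esub> (inv\<^bsub>M\<^esub> (\<Psi> x) \<otimes>\<^bsub>M\<^esub> y)"
      using \<Psi>_closed[OF x(1)] y by (simp add: M.mult_inv_cancel)
    then have "\<psi> y = \<psi> (\<Psi> x) + \<psi> (inv\<^bsub>M\<^esub> (\<Psi> x) \<otimes>\<^bsub>M\<^esub> y)"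
      using \<psi>_mult[of "\<Psi> x" "inv\<^bsub>M\<^esub> (\<Psi> x) \<otimes>\<^bsub>M\<^esub> y"] \<Psi>_closed[OF x(1)] y by simp
    moreover have "\<bar>\<psi> (inv\<^bsub>M\<^esub> (\<Psi> x) \<otimes>\<^bsub>M\<^esub> y)\<bar> \<le> C2 * C"
      using C2(2)[of "inv\<^bsub>M\<^esub> (\<Psi> x) \<otimes>\<^bsub>M\<^esub> y"] \<Psi>_closed[OF x(1)] y mult_left_mono[OF x(2) C2(1)] by simp
    ultimately show ?thesis using image[OF x(1)] by linarith
  qed
  \<comment> \<open>For a lift of the element j0 of \<open>J\<close>, duality makes
    \<open>\<psi> y\<close> equal to \<open>c j0\<close>.\<close>
  obtain y where y: "y \<in> carrier M" "ab_class M y = j0"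
    using j0 J(2) by (auto simp: M.ab_class_surj)
  have \<psi>_pow: "\<psi> (y [^]\<^bsub>M\<^esub> n) = real n * \<psi> y" for n :: nat
  proof (induction n)
    case 0
    show ?case using \<psi>_mult[of "\<one>\<^bsub>M\<^esub>" "\<one>\<^bsub>M\<^esub>"] by simp
  next
    case (Suc n)
    then show ?case using \<psi>_mult[of "y [^]\<^bsub>M\<^esub> n" y] y(1) by (simp add: distrib_right)
  qed
  have "real n * \<bar>\<psi> y\<bar> \<le> (\<Sum>j\<in>J. \<bar>c j\<bar> * D) + C2 * C" for n :: nat
    using bound[of "y [^]\<^bsub>M\<^esub> n"] y(1) by (simp add: \<psi>_pow abs_mult)
  then have "\<psi> y = 0" by (rule multiples_bounded_imp_zero)
  moreover have "\<psi> y = (\<Sum>j\<in>J. if j = j0 then c j0 else 0)"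
    unfolding \<psi>_def y(2) by (intro sum.cong) (auto simp: B.coordinates_dual[OF coordinates_B _ j0])
  ultimately show ?thesis using J(1) j0 by simp
qed

lemma near_linear_bij:
  assumes L: "linear_map class_ring (ab_real N) (ab_real M) L"
    and D: "\<And>x j. x \<in> carrier N \<Longrightarrow> j \<in> J \<Longrightarrow>
      \<bar>d j (ab_class M (\<Psi> x)) - functional (d j) (L (ab_proj N x))\<bar> \<le> D"
  shows "bij_betw L (carrier (ab_real N)) (carrier (ab_real M))"
  unfolding ab_real_def
proof (rule linear_map_bij[OF L[unfolded ab_real_def]])
  show "v = \<zero>\<^bsub>A.V\<^esub>"
    if "v \<in> carrier A.V" "L v = \<zero>\<^bsub>B.V\<^esub>" for v
    using near_linear_kernel[OF L D] that by (simp add: ab_real_def)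
  show "\<forall>j\<in>J. c j = 0"
    if "\<And>i. i \<in> I \<Longrightarrow> (\<Sum>j\<in>J. c j * functional (d j) (L (pure_tensor (abelianization N) i 1))) = 0" for c
    using near_linear_cokernel[OF L D that] by blast
qed

text \<open>Each \<open>\<phi> i\<close> is its dual functional composed with L. So the i-th entry
  of the difference is the dual functional applied to the difference of
  \<open>ab_proj M (\<Psi> x)\<close> and \<open>L (ab_proj N x)\<close>, whose coordinates are
  bounded.\<close>

lemma coord_map_bounded:
  assumes L: "linear_map class_ring (ab_real N) (ab_real M) L"
    and bij: "bij_betw L (carrier (ab_real N)) (carrier (ab_real M))"
    and D: "\<And>x j. x \<in> carrier N \<Longrightarrow> j \<in> J \<Longrightarrow>
      \<bar>d j (ab_class M (\<Psi> x)) - functional (d j) (L (ab_proj N x))\<bar> \<le> D"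
    and \<phi>: "\<And>i. i \<in> {1..r} \<Longrightarrow> \<phi> i \<in> carrier (real_hom (abelianization N))"
    and nr: "vs_norm (coord_space r) nr"
  shows "bounded_distance (coord_space r) nr (carrier N)
    (\<lambda>x. coord_map M r (\<lambda>i. inverse_dual (abelianization N) (abelianization M) L (\<phi> i)) (\<Psi> x))
    (\<lambda>x. coord_map N r \<phi> x)"
proof -
  note J = B.coordinates_finite[OF coordinates_B] B.coordinates_subset[OF coordinates_B]
  have dj: "d j \<in> carrier (real_hom (abelianization M))" if "j \<in> J" for j
    using that by (rule B.coordinates_hom[OF coordinates_B])
  let ?\<theta> = "\<lambda>i. inverse_dual (abelianization N) (abelianization M) L (\<phi> i)"
  let ?F = "\<lambda>x. coord_map M r ?\<theta> (\<Psi> x)"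
  note dual = inverse_dual[OF L[unfolded ab_real_def] bij[unfolded ab_real_def] \<phi>]
  obtain C where C: "0 \<le> C" "\<And>v. v \<in> carrier (coord_space r) \<Longrightarrow> nr v \<le> C * (\<Sum>i\<in>{1..r}. \<bar>v i\<bar>)"
    using coord_space_norm_le[OF nr] by blast
  have coord: "\<bar>?F x i - coord_map N r \<phi> x i\<bar> \<le> (\<Sum>j\<in>J. D * \<bar>?\<theta> i j\<bar>)"
    if x: "x \<in> carrier N" and i: "i \<in> {1..r}" for x i
  proof -
    let ?X = "ab_proj N x" and ?Y = "ab_proj M (\<Psi> x)"
    have X: "?X \<in> carrier A.V"
      using N.ab_proj_closed[OF x] by (simp add: ab_real_def)
    have Y: "?Y \<in> carrier B.V"
      using M.ab_proj_closed[OF \<Psi>_closed[OF x]] by (simp add: ab_real_def)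
    have LX: "L ?X \<in> carrier B.V"
      using L[unfolded ab_real_def] X by (rule linear_map_closed)
    have "functional (\<phi> i) ?X = functional (?\<theta> i) (L ?X)"
      using dual(2)[OF i LX] bij_betw_inv_into_left[OF bij[unfolded ab_real_def] X] by simp
    also have "\<dots> = (\<Sum>j\<in>J. functional (d j) (L ?X) * functional (?\<theta> i) (pure_tensor (abelianization M) j 1))"
      using B.functional_linear[OF dual(1)[OF i]] by (intro B.linear_coordinates[OF _ _ coordinates_B LX]) auto
    finally have 1: "functional (\<phi> i) ?X = (\<Sum>j\<in>J. functional (d j) (L ?X) * ?\<theta> i j)"
      using J(2) B.functional_pure_tensor[OF dual(1)[OF i]] by (simp add: subset_iff cong: sum.cong)
    have "functional (?\<theta> i) ?Y = (\<Sum>j\<in>J. functional (d j) ?Y * functional (?\<theta> i) (pure_tensor (abelianization M) j 1))"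
      using B.functional_linear[OF dual(1)[OF i]] by (intro B.linear_coordinates[OF _ _ coordinates_B Y]) auto
    then have 2: "functional (?\<theta> i) ?Y = (\<Sum>j\<in>J. d j (ab_class M (\<Psi> x)) * ?\<theta> i j)"
      using J(2) B.functional_pure_tensor[OF dual(1)[OF i]] M.functional_ab_proj[OF dj \<Psi>_closed[OF x]]
      by (simp add: subset_iff cong: sum.cong)
    have "?F x i - coord_map N r \<phi> x i =
        (\<Sum>j\<in>J. (d j (ab_class M (\<Psi> x)) - functional (d j) (L ?X)) * ?\<theta> i j)"
      using i by (simp add: coord_map_def 1 2 left_diff_distrib sum_subtractf)
    then have "\<bar>?F x i - coord_map N r \<phi> x i\<bar> \<le>
        (\<Sum>j\<in>J. \<bar>(d j (ab_class M (\<Psi> x)) - functional (d j) (L ?X)) * ?\<theta> i j\<bar>)"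
      by (simp only: sum_abs)
    also have "\<dots> \<le> (\<Sum>j\<in>J. D * \<bar>?\<theta> i j\<bar>)"
      unfolding abs_mult using D[OF x] by (intro sum_mono mult_right_mono) auto
    finally show ?thesis .
  qed
  have "nr (?F x \<ominus>\<^bsub>coord_space r\<^esub> coord_map N r \<phi> x) \<le> C * (\<Sum>i\<in>{1..r}. \<Sum>j\<in>J. D * \<bar>?\<theta> i j\<bar>)"
    if x: "x \<in> carrier N" for x
  proof -
    have mem: "coord_map G r \<chi> y \<in> carrier (coord_space r)" for G :: "('g, 'h) monoid_scheme" and \<chi> y
      by (simp add: coord_map_def class_ring.func_space_def)
    have "?F x \<ominus>\<^bsub>coord_space r\<^esub> coord_map N r \<phi> x = (\<lambda>i\<in>{1..r}. ?F x i - coord_map N r \<phi> x i)"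
      by (rule coord_space_minus[OF mem mem])
    moreover have "nr (\<lambda>i\<in>{1..r}. ?F x i - coord_map N r \<phi> x i) \<le>
        C * (\<Sum>i\<in>{1..r}. \<bar>(\<lambda>i\<in>{1..r}. ?F x i - coord_map N r \<phi> x i) i\<bar>)"
      by (rule C(2)) (simp add: class_ring.func_space_def)
    moreover have "\<dots> \<le> C * (\<Sum>i\<in>{1..r}. \<Sum>j\<in>J. D * \<bar>?\<theta> i j\<bar>)"
      using C(1) coord[OF x] by (intro mult_left_mono sum_mono) auto
    ultimately show ?thesis by simp
  qed
  then show ?thesis by (auto simp: bounded_distance_def bdd_above_def)
qed

end

theorem theorem7p2:
  fixes N :: "('a, 'c) monoid_scheme" and M :: "('b, 'd) monoid_scheme"
    and S :: "'a set" and T :: "'b set"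
    and \<Psi> :: "'a \<Rightarrow> 'b"
    and nm :: "('b set \<times> real \<Rightarrow>\<^sub>0 int) set \<Rightarrow> real"
  assumes "group N" and "finite_generating_set N S" and "torsion_free N" and "nilpotent N"
    and "group M" and "finite_generating_set M T" and "torsion_free M" and "nilpotent M"
    and "quasi_isometry (carrier N) (word_dist N S) (carrier M) (word_dist M T) \<Psi>"
    and "\<Psi> \<one>\<^bsub>N\<^esub> = \<one>\<^bsub>M\<^esub>"
    and "vs_norm (ab_real M) nm"
    and "bounded_abelian_defect N M nm \<Psi>"
  shows
    "(\<exists>!H. H \<in> hom N (add_monoid (ab_real M)) \<and> H \<in> extensional (carrier N) \<and>
           bounded_distance (ab_real M) nm (carrier N) (\<lambda>x. ab_proj M (\<Psi> x)) H) \<and>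
     (\<forall>H. H \<in> hom N (add_monoid (ab_real M)) \<and>
          bounded_distance (ab_real M) nm (carrier N) (\<lambda>x. ab_proj M (\<Psi> x)) H \<longrightarrow>
       (\<exists>h \<in> hom (abelianization N) (add_monoid (ab_real M)).
          \<forall>x\<in>carrier N. H x = h (ab_class N x)) \<and>
       (\<exists>!L. linear_map class_ring (ab_real N) (ab_real M) L \<and>
             L \<in> extensional (carrier (ab_real N)) \<and>
             (\<forall>x\<in>carrier N. H x = L (ab_proj N x))) \<and>
       (\<forall>L. linear_map class_ring (ab_real N) (ab_real M) L \<and>
            (\<forall>x\<in>carrier N. H x = L (ab_proj N x)) \<longrightarrow>
         bounded_distance (ab_real M) nm (carrier N)
           (\<lambda>x. ab_proj M (\<Psi> x)) (\<lambda>x. L (ab_proj N x)) \<and>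
         bij_betw L (carrier (ab_real N)) (carrier (ab_real M)) \<and>
         (\<forall>\<phi>\<in>carrier (real_hom (abelianization N)).
            inverse_dual (abelianization N) (abelianization M) L \<phi>
              \<in> carrier (real_hom (abelianization M)) \<and>
            (\<forall>w\<in>carrier (ab_real M).
               functional (inverse_dual (abelianization N) (abelianization M) L \<phi>) w =
               functional \<phi> (inv_into (carrier (ab_real N)) L w))) \<and>
         (\<forall>r \<phi> nr.
            r = vectorspace.dim class_ring (real_hom (abelianization N)) \<and>
            inj_on \<phi> {1..r} \<and>
            vectorspace.basis class_ring (real_hom (abelianization N)) (\<phi> ` {1..r}) \<and>
            vs_norm (coord_space r) nr \<longrightarrow>
              bounded_distance (coord_space r) nr (carrier N)
                (\<lambda>x. coord_map M r
                   (\<lambda>i. inverse_dual (abelianization N) (abelianization M) L (\<phi> i)) (\<Psi> x))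
                (\<lambda>x. coord_map N r \<phi> x))))"
    (is "(\<exists>!H. ?hom H \<and> ?ext H \<and> ?near H) \<and> (\<forall>H. ?hom H \<and> ?near H \<longrightarrow> ?factors H \<and> (\<exists>!L. ?lin L \<and> ?extL L \<and> ?lift H L) \<and> (\<forall>L. ?lin L \<and> ?lift H L \<longrightarrow> ?rest L))")
proof -
  have fgN: "finitely_generated_group N S" and fgM: "finitely_generated_group M T"
    using assms by (auto simp: finitely_generated_group_def finitely_generated_group_axioms_def)
  obtain I e where Ie: "comm_group.coordinates (abelianization N) I e"
    using finitely_generated_group.abelianization_coordinates[OF fgN] by blast
  obtain J d where Jd: "comm_group.coordinates (abelianization M) J d"
    using finitely_generated_group.abelianization_coordinates[OF fgM] by blast
  interpret nilpotent_quasi_isometry N S M T I e J d \<Psi>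
    using fgN fgM Ie Jd assms abelianization_comm_group[of N] abelianization_comm_group[of M]
    by (intro nilpotent_quasi_isometry.intro coordinate_pair.intro coordinate_pair_axioms.intro
        nilpotent_quasi_isometry_axioms.intro)
  interpret VB: vectorspace class_ring "B.V" by (rule B.real_tensor_vectorspace)
  note nm = assms(11)[unfolded ab_real_def]
  have dj: "d j \<in> carrier (real_hom (abelianization M))" if "j \<in> J" for j
    using that by (rule B.coordinates_hom[OF Jd])
  have proj: "ab_proj M (\<Psi> x) \<in> carrier B.V" if "x \<in> carrier N" for x
    using M.ab_proj_closed[OF \<Psi>_closed[OF that]] by (simp add: ab_real_def)
  \<comment> \<open>Closeness in norm is traded for coordinatewise bounds, the form taken by the
    existence and uniqueness lemmas.\<close>
  have near_iff: "?near H \<longleftrightarrow>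
      (\<exists>D. \<forall>x\<in>carrier N. \<forall>j\<in>J. \<bar>d j (ab_class M (\<Psi> x)) - functional (d j) (H x)\<bar> \<le> D)"
    if "?hom H" for H
  proof -
    have "H x \<in> carrier B.V" if "x \<in> carrier N" for x
      using \<open>?hom H\<close> that by (auto simp: hom_def ab_real_def)
    then show ?thesis
      unfolding ab_real_def using B.bounded_distance_coordinates[OF nm Jd, of "carrier N" "\<lambda>x. ab_proj M (\<Psi> x)" H]
      by (simp add: proj M.functional_ab_proj[OF dj \<Psi>_closed])
  qed
  have unique: "H x = H' x" if H: "?hom H" "?near H" and H': "?hom H'" "?near H'" and x: "x \<in> carrier N" for H H' x
  proof -
    obtain D where D: "\<And>x j. x \<in> carrier N \<Longrightarrow> j \<in> J \<Longrightarrow> \<bar>d j (ab_class M (\<Psi> x)) - functional (d j) (H x)\<bar> \<le> D"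
      using H near_iff by blast
    obtain D' where D': "\<And>x j. x \<in> carrier N \<Longrightarrow> j \<in> J \<Longrightarrow> \<bar>d j (ab_class M (\<Psi> x)) - functional (d j) (H' x)\<bar> \<le> D'"
      using H' near_iff by blast
    show ?thesis using near_hom_unique[OF H(1) D H'(1) D' x] .
  qed
  have "\<exists>H. ?hom H \<and> ?ext H \<and> ?near H"
  proof -
    obtain D where D: "\<And>x y. x \<in> carrier N \<Longrightarrow> y \<in> carrier N \<Longrightarrow>
        nm (ab_proj M (\<Psi> (x \<otimes>\<^bsub>N\<^esub> y)) \<ominus>\<^bsub>ab_real M\<^esub> ab_proj M (\<Psi> x) \<ominus>\<^bsub>ab_real M\<^esub> ab_proj M (\<Psi> y)) \<le> D"
      using assms(12) by (auto simp: bounded_abelian_defect_def bdd_above_def)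
    obtain C where C: "0 \<le> C" "\<And>X. X \<in> carrier B.V \<Longrightarrow>
        (\<Sum>j\<in>J. \<bar>functional (d j) X\<bar>) \<le> C * nm X"
      using B.coordinates_le_norm[OF nm Jd] by blast
    \<comment> \<open>Coordinates are at most C times the norm, so each coordinate of the projection
      of \<open>\<Psi>\<close> is a quasimorphism with defect at most \<open>C * D\<close>.\<close>
    have "\<bar>d j (ab_class M (\<Psi> (x \<otimes>\<^bsub>N\<^esub> y))) - d j (ab_class M (\<Psi> x)) - d j (ab_class M (\<Psi> y))\<bar> \<le> C * D"
      if xy: "x \<in> carrier N" "y \<in> carrier N" and j: "j \<in> J" for x y j
    proof -
      let ?X = "ab_proj M (\<Psi> (x \<otimes>\<^bsub>N\<^esub> y)) \<ominus>\<^bsub>B.V\<^esub> ab_proj M (\<Psi> x)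
        \<ominus>\<^bsub>B.V\<^esub> ab_proj M (\<Psi> y)"
      have X: "?X \<in> carrier B.V"
        using proj xy by simp
      have "functional (d j) ?X =
          d j (ab_class M (\<Psi> (x \<otimes>\<^bsub>N\<^esub> y))) - d j (ab_class M (\<Psi> x)) - d j (ab_class M (\<Psi> y))"
        using xy proj by (simp add: B.functional_minus[OF dj[OF j]] M.functional_ab_proj[OF dj[OF j] \<Psi>_closed])
      moreover have "\<bar>functional (d j) ?X\<bar> \<le> (\<Sum>j\<in>J. \<bar>functional (d j) ?X\<bar>)"
        using j B.coordinates_finite[OF Jd] by (intro member_le_sum[of j J "\<lambda>j. \<bar>functional (d j) ?X\<bar>"]) auto
      moreover have "C * nm ?X \<le> C * D"
        using D[OF xy] C(1) by (intro mult_left_mono) (simp_all add: ab_real_def)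
      ultimately show ?thesis using C(2)[OF X] by linarith
    qed
    then obtain H where "?hom H" "?ext H"
      "\<And>x j. x \<in> carrier N \<Longrightarrow> j \<in> J \<Longrightarrow> \<bar>d j (ab_class M (\<Psi> x)) - functional (d j) (H x)\<bar> \<le> C * D"
      using defect_hom_exists by blast
    then show ?thesis using near_iff by blast
  qed
  moreover have "H = H'" if "?hom H \<and> ?ext H \<and> ?near H" "?hom H' \<and> ?ext H' \<and> ?near H'" for H H'
    using that unique by (intro extensionalityI[of H "carrier N"]) auto
  ultimately have part1: "\<exists>!H. ?hom H \<and> ?ext H \<and> ?near H" by blast
  have part2: "?factors H \<and> (\<exists>!L. ?lin L \<and> ?extL L \<and> ?lift H L) \<and> (\<forall>L. ?lin L \<and> ?lift H L \<longrightarrow> ?rest L)"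
    if H: "?hom H" "?near H" for H
  proof -
    have cg: "comm_group (add_monoid (ab_real M))"
      unfolding ab_real_def by (rule VB.M.a_comm_group)
    obtain h where h: "h \<in> hom (abelianization N) (add_monoid (ab_real M))"
      "\<And>x. x \<in> carrier N \<Longrightarrow> H x = h (ab_class N x)"
      using N.hom_factors_abelianization[OF H(1) cg] by blast
    obtain L where L: "linear_map class_ring A.V B.V L"
      "L \<in> extensional (carrier A.V)"
      "\<And>a. a \<in> carrier (abelianization N) \<Longrightarrow> h a = L (pure_tensor (abelianization N) a 1)"
      using linear_map_lift[OF h(1)[unfolded ab_real_def]] by blast
    have "?lin L \<and> ?extL L \<and> ?lift H L"
      using L h(2) N.ab_class_closed by (simp add: ab_real_def ab_proj_def)
    \<comment> \<open>Every class in the abelianization comes from some element of N, so both maps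
      are prescribed on the tensors with 1, which determine a linear map.\<close>
    moreover have "L1 = L2" if L1: "?lin L1 \<and> ?extL L1 \<and> ?lift H L1" and L2: "?lin L2 \<and> ?extL L2 \<and> ?lift H L2" for L1 L2
    proof (rule extensionalityI)
      show "L1 \<in> extensional (carrier (ab_real N))" "L2 \<in> extensional (carrier (ab_real N))"
        using L1 L2 by auto
      fix X assume X: "X \<in> carrier (ab_real N)"
      have "L1 (pure_tensor (abelianization N) a 1) = L2 (pure_tensor (abelianization N) a 1)"
        if "a \<in> carrier (abelianization N)" for a
      proof -
        obtain x where "x \<in> carrier N" "a = ab_class N x" using \<open>a \<in> _\<close> by (auto simp: N.ab_class_surj)
        then show ?thesis using L1 L2 by (metis ab_proj_def)
      qed
      then show "L1 X = L2 X"
        using linear_map_ext[of L1 L2 X] L1 L2 X by (simp add: ab_real_def)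
    qed
    ultimately have ex1: "\<exists>!L. ?lin L \<and> ?extL L \<and> ?lift H L" by blast
    have rest: "?rest L" if lin: "?lin L" and lift: "?lift H L" for L
    proof -
      obtain D where "\<forall>x\<in>carrier N. \<forall>j\<in>J. \<bar>d j (ab_class M (\<Psi> x)) - functional (d j) (H x)\<bar> \<le> D"
        using H near_iff by blast
      then have D: "\<bar>d j (ab_class M (\<Psi> x)) - functional (d j) (L (ab_proj N x))\<bar> \<le> D"
        if "x \<in> carrier N" "j \<in> J" for x j
        using lift that by simp
      have near: "bounded_distance (ab_real M) nm (carrier N) (\<lambda>x. ab_proj M (\<Psi> x)) (\<lambda>x. L (ab_proj N x))"
        using H(2) lift by (simp add: bounded_distance_def cong: image_cong)
      have bij: "bij_betw L (carrier (ab_real N)) (carrier (ab_real M))"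
        using lin D by (rule near_linear_bij)
      note dual = inverse_dual[OF lin[unfolded ab_real_def] bij[unfolded ab_real_def]]
      have coords: "bounded_distance (coord_space r) nr (carrier N)
          (\<lambda>x. coord_map M r (\<lambda>i. inverse_dual (abelianization N) (abelianization M) L (\<phi> i)) (\<Psi> x))
          (\<lambda>x. coord_map N r \<phi> x)"
        if "vectorspace.basis class_ring (real_hom (abelianization N)) (\<phi> ` {1..r})" "vs_norm (coord_space r) nr"
        for r \<phi> nr
      proof (rule coord_map_bounded[OF lin bij D _ that(2)])
        have "\<phi> ` {1..r} \<subseteq> carrier (real_hom (abelianization N))"
          using that(1) real_hom_vectorspace[OF A.is_group] by (simp add: vectorspace.basis_def)
        then show "\<phi> i \<in> carrier (real_hom (abelianization N))" if "i \<in> {1..r}" for i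
          using that by auto
      qed
      show ?thesis
      proof (intro conjI ballI allI impI near bij)
        fix \<phi> assume \<phi>: "\<phi> \<in> carrier (real_hom (abelianization N))"
        show "inverse_dual (abelianization N) (abelianization M) L \<phi> \<in> carrier (real_hom (abelianization M))"
          using \<phi> by (rule dual(1))
        fix w assume "w \<in> carrier (ab_real M)"
        then show "functional (inverse_dual (abelianization N) (abelianization M) L \<phi>) w =
            functional \<phi> (inv_into (carrier (ab_real N)) L w)"
          unfolding ab_real_def by (rule dual(2)[OF \<phi>])
      qed (rule coords; blast)
    qed
    have fac: "?factors H" using h by blast
    have all: "\<forall>L. ?lin L \<and> ?lift H L \<longrightarrow> ?rest L"
    proof (rule allI, rule impI)
      fix L assume "?lin L \<and> ?lift H L"
      then have "?lin L" "?lift H L" by simp_all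
      then show "?rest L" by (rule rest)
    qed
    show ?thesis by (rule conjI[OF fac conjI[OF ex1 all]])
  qed
  show ?thesis
    by (intro conjI part1 allI impI part2) (elim conjE; assumption)+
qed

end
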